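(* Let $d\ge 2$ and $V_1,V_2\in\mathcal V_d$. Denote by $V_j^{\mathrm B}$ the Born approximation of $V_j$, $j=1,2$. Then, for every $b\in(0,1)$, $$V_1^{\mathrm B}|_{U_b}=V_2^{\mathrm B}|_{U_b}\iff V_1|_{U_b}=V_2|_{U_b},$$ where $U_b=\{x\in\mathbb B^d: b<|x|<1\}$ (equalities are understood almost everywhere).
   Context: $\mathbb B^d=\{x\in\mathbb R^d:|x|<1\}$, $\mathbb S^{d-1}=\partial\mathbb B^d$, $|\mathbb S^{d-1}|$ is its surface measure, $\mathbb N_0=\{0,1,2,\dots\}$. The space $\mathcal V_d$: real-valued radial $V\in L^1_{\mathrm{loc}}(\mathbb B^d\setminus\{0\})$, $V=q(|\cdot|)$, with $$\|V\|_{\mathcal V_d}:=\sup_{j\in\mathbb N_0}\int_{2^{-(j+1)}<|x|<2^{-j}}|V(x)||x|^{2-d}dx<\infty .$$ Constants: $\beta_V:=\frac{2}{|\mathbb S^{d-1}|}\max\big(\sqrt{6|\mathbb S^{d-1}|\,\|V\|_{\mathcal V_d}},3e\|V\|_{\mathcal V_d}\big)$, $k_V:=\beta_V-\frac{d-2}{2}$. For an integer $k\ge0$, $k>k_V$, there is a unique solution $b_k$ on $(0,1]$ of $$-\frac1{r^{d-1}}\frac{d}{dr}\Big(r^{d-1}\frac{d b_k}{dr}\Big)+\Big(\frac{k(k+d-2)}{r^2}+q(r)\Big)b_k=0,\qquad b_k(1)=1,$$ such that $b_k(|x|)Y_k(x/|x|)\in L^2(\mathbb B^d,|x|^{-2}dx)$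 for all spherical harmonics $Y_k$ of degree $k$; set $\lambda_k[V]:=\partial_rb_k(1)$ (when the Dirichlet-to-Neumann map of $-\Delta+V$ on $\mathbb B^d$ is well defined, this is its eigenvalue on spherical harmonics of degree $k$). Born approximation: $V^{\mathrm B}$ is the unique radial function that belongs to $L^1(\mathbb B^d,|x|^{2s}dx)$ for some $s>0$ and satisfies $$\frac1{|\mathbb S^{d-1}|}\int_{\mathbb B^d}V^{\mathrm B}(x)|x|^{2k}dx=\lambda_k[V]-k\qquad\text{for all sufficiently large integers }k$$ (it exists for every $V\in\mathcal V_d$). *)

theory Defs
  imports "HOL-Analysis.Analysis"
begin

text \<open>
  Euclidean space of dimension $d$ is a type of class \<open>euclidean_space\<close> with
  \<open>DIM('a)\<close> = $d$. Functions on the unit ball are represented by total functions, considered up to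
  Lebesgue null sets; their values outside the ball never matter.
\<close>

text \<open>
  Surface measure of the unit sphere, normalised by polar coordinates: the unit ball has volume
  $|S^{d-1}| / d$.
\<close>

definition sphere_area :: "'a::euclidean_space itself \<Rightarrow> real" where
  "sphere_area _ = real DIM('a) * measure lebesgue (ball (0::'a) 1)"

definition radial_profile :: "('a::euclidean_space \<Rightarrow> real) \<Rightarrow> (real \<Rightarrow> real) \<Rightarrow> bool" where
  "radial_profile V q \<longleftrightarrow>
     q \<in> borel_measurable borel \<and> (AE x in lebesgue_on (ball 0 1). V x = q (norm x))"

definition radial :: "('a::euclidean_space \<Rightarrow> real) \<Rightarrow> bool" where
  "radial V \<longleftrightarrow> (\<exists>q. radial_profile V q)"

definition locally_integrable_on :: "('a::euclidean_space \<Rightarrow> real) \<Rightarrow> 'a set \<Rightarrow> bool" where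
  "locally_integrable_on V U \<longleftrightarrow>
     (\<forall>K. compact K \<and> K \<subseteq> U \<longrightarrow> V absolutely_integrable_on K)"

definition dyadic_shell :: "nat \<Rightarrow> 'a::euclidean_space set" where
  "dyadic_shell j = {x. 1 / 2 ^ (j + 1) < norm x \<and> norm x < 1 / 2 ^ j}"

definition potential_norm :: "('a::euclidean_space \<Rightarrow> real) \<Rightarrow> ennreal" where
  "potential_norm V =
     (SUP j. \<integral>\<^sup>+ x \<in> dyadic_shell j. ennreal (\<bar>V x\<bar> * norm x powr (2 - real DIM('a))) \<partial>lebesgue)"

definition potential_space :: "('a::euclidean_space \<Rightarrow> real) set" where
  "potential_space =
     {V. radial V \<and> locally_integrable_on V (ball 0 1 - {0}) \<and> potential_norm V < \<infinity>}"

definition laplacian :: "('a::euclidean_space \<Rightarrow> real) \<Rightarrow> 'a \<Rightarrow> real" where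
  "laplacian f x = (\<Sum>e\<in>Basis. deriv (deriv (\<lambda>t. f (x + t *\<^sub>R e))) 0)"

definition spherical_harmonic :: "nat \<Rightarrow> ('a::euclidean_space \<Rightarrow> real) \<Rightarrow> bool" where
  "spherical_harmonic k Y \<longleftrightarrow>
     (\<exists>P. real_polynomial_function P \<and> (\<forall>c x. P (c *\<^sub>R x) = c ^ k * P x) \<and>
          (\<forall>x. laplacian P x = 0) \<and> (\<forall>\<omega>\<in>sphere 0 1. Y \<omega> = P \<omega>))"

text \<open>Membership in $L^2(B, |x|^{-2} dx)$, where $B$ is the unit ball.\<close>

definition in_weighted_L2 :: "('a::euclidean_space \<Rightarrow> real) \<Rightarrow> bool" where
  "in_weighted_L2 f \<longleftrightarrow>
     f \<in> borel_measurable (lebesgue_on (ball 0 1)) \<and>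
     (\<lambda>x. (f x)\<^sup>2 / (norm x)\<^sup>2) absolutely_integrable_on ball 0 1"

text \<open>\<open>f\<close> is locally absolutely continuous on $(0,1]$ and \<open>g\<close> is its almost everywhere derivative.\<close>

definition has_ae_deriv :: "(real \<Rightarrow> real) \<Rightarrow> (real \<Rightarrow> real) \<Rightarrow> bool" where
  "has_ae_deriv f g \<longleftrightarrow>
     (\<forall>r s. 0 < r \<and> r \<le> s \<and> s \<le> 1 \<longrightarrow>
        g absolutely_integrable_on {r..s} \<and> f s - f r = integral {r..s} g)"

text \<open>
  Since \<open>q\<close> is merely locally integrable, the radial equation is understood in the sense of
  Caratheodory: \<open>u\<close> is differentiable on $(0,1]$ (one-sidedly at 1), $r^{d-1} u'(r)$ is locally
  absolutely continuous there, and the equation holds for almost every $r$. The function \<open>g\<close> is the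
  derivative of $r^{d-1} u'(r)$.
\<close>

definition solves_radial_ode :: "nat \<Rightarrow> (real \<Rightarrow> real) \<Rightarrow> nat \<Rightarrow> (real \<Rightarrow> real) \<Rightarrow> bool" where
  "solves_radial_ode d q k u \<longleftrightarrow>
     (\<exists>u' g. (\<forall>r\<in>{0<..1}. (u has_real_derivative u' r) (at r within {0<..1})) \<and>
             has_ae_deriv (\<lambda>r. r ^ (d - 1) * u' r) g \<and>
             (AE r in lebesgue_on {0<..<1}.
                - (1 / r ^ (d - 1)) * g r
                + (real k * (real k + real d - 2) / r\<^sup>2 + q r) * u r = 0))"

definition radial_solution :: "('a::euclidean_space \<Rightarrow> real) \<Rightarrow> nat \<Rightarrow> (real \<Rightarrow> real) \<Rightarrow> bool" where
  "radial_solution V k u \<longleftrightarrow>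
     (\<exists>q. radial_profile V q \<and> solves_radial_ode DIM('a) q k u) \<and> u 1 = 1 \<and>
     (\<forall>Y::'a \<Rightarrow> real. spherical_harmonic k Y \<longrightarrow>
        in_weighted_L2 (\<lambda>x. u (norm x) * Y (x /\<^sub>R norm x)))"

text \<open>
  The eigenvalue $\lambda_k[V]$. For \<open>V\<close> in \<open>potential_space\<close> the solution exists and is unique on
  $(0,1]$ once \<open>k\<close> exceeds a bound depending on the norm of \<open>V\<close>; only such \<open>k\<close> are relevant below.
\<close>

definition dn_eigenvalue :: "('a::euclidean_space \<Rightarrow> real) \<Rightarrow> nat \<Rightarrow> real" where
  "dn_eigenvalue V k =
     (THE l. \<exists>u. radial_solution V k u \<and> (u has_real_derivative l) (at 1 within {0<..1}))"

text \<open>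
  The Born approximation is determined only up to null sets, so it is rendered as a relation that
  holds for all of its representatives.
\<close>

definition born_approximation ::
    "('a::euclidean_space \<Rightarrow> real) \<Rightarrow> ('a \<Rightarrow> real) \<Rightarrow> bool" where
  "born_approximation V W \<longleftrightarrow>
     radial W \<and>
     (\<exists>s>0. (\<lambda>x. W x * norm x powr (2 * s)) absolutely_integrable_on ball 0 1) \<and>
     (\<forall>\<^sub>F k in sequentially.
        1 / sphere_area TYPE('a) * integral (ball 0 1) (\<lambda>x. W x * norm x ^ (2 * k))
          = dn_eigenvalue V k - real k)"

definition outer_shell :: "real \<Rightarrow> 'a::euclidean_space set" where
  "outer_shell b = {x. b < norm x \<and> norm x < 1}"

end

(*
  Put r = exp (-t), Q(t) = exp (-2 t) q(exp (-t)) and N = 2 k + d - 2. The logarithmic derivative of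
  the solution decaying at the origin is r b_k'(r) / b_k(r) = k + n(t), where n solves a Riccati
  equation whose solution is the Laplace transform n(t) = int_t^oo F(t,x) exp (-N (x - t)) dx of an
  amplitude F that does not depend on k (Simon's A-function in characteristic coordinates,
  F(t,x) = A(t, x - t)). In these terms the Riccati equation reads
    F(t,x) = Q(x) - int_{s>=t} int F(s,y) F(s,x+s-y) dy ds,    F(s,y) = 0 for y < s.
  Hence lambda_k - k = n(0), and since polynomials in exp (-2 t) determine integrable functions, the
  profile w of the Born approximation is given by exp (-2 t) w(exp (-t)) = F(0,t).
  For x < T the equation involves only Q on (-oo,T). Conversely, if two amplitudes agree at t = 0 for
  x < T, subtracting the equations at times 0 and t and Gronwall's inequality show that they agree for
  all t >= 0, and the equation at t = 0 then gives back Q on (0,T).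
*)
theory Submission
  imports Defs
begin

section \<open>Polar coordinates\<close>

text \<open>The potential is only uniformly locally integrable in t, so for fixed t the amplitude is
  a function of x that is finite almost everywhere and integrable against exp (-c x) for large c,
  without continuity or pointwise bounds. Every estimate is therefore made on Laplace transforms of
  nonnegative functions, where Tonelli and monotone convergence apply unconditionally; real-valued
  differences appear only where both parts are finite. The choice of coordinates matters: A itself
  satisfies the transport equation A_t = A_x + A * A, whereas along characteristics x is a mere
  parameter and Q(x) enters as a term that does not change with t as long as t <= x. This is why Q
  drops out of the difference of the equations at two times. The solutions b_k are reconstructed
  from the amplitude, by exponentiating the logarithmic derivative, and not the amplitude from them.
  The link with the eigenvalue is then a uniqueness argument: a second solution would be too large
  at the origin for the weighted square integrability, once k is large compared with the norm of
  V.\<close>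

lemma nn_integral_scale:
  fixes f :: "'a::euclidean_space \<Rightarrow> ennreal"
  assumes [measurable]: "f \<in> borel_measurable borel" and "0 < c"
  shows "(\<integral>\<^sup>+ x. f x \<partial>lborel) = ennreal (c ^ DIM('a)) * (\<integral>\<^sup>+ x. f (c *\<^sub>R x) \<partial>lborel)"
proof -
  have "(\<integral>\<^sup>+ x. f x \<partial>lborel) = (\<integral>\<^sup>+ x. f x \<partial>density (distr lborel borel (\<lambda>x. 0 + c *\<^sub>R x)) (\<lambda>_. \<bar>c\<bar> ^ DIM('a)))"
    by (subst lborel_affine[of c 0]) (use assms in auto)
  also have "\<dots> = ennreal (c ^ DIM('a)) * (\<integral>\<^sup>+ x. f (c *\<^sub>R x) \<partial>lborel)"
    using \<open>0 < c\<close> by (simp add: nn_integral_density nn_integral_distr nn_integral_cmult)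
  finally show ?thesis .
qed

lemma nn_integral_exp_tail:
  fixes d a :: real assumes "0 < d"
  shows "(\<integral>\<^sup>+ t. ennreal (d * exp (- d * t)) * indicator {a..} t \<partial>lborel) = ennreal (exp (- d * a))"
proof -
  have "((\<lambda>t. exp (- d * t)) \<longlongrightarrow> 0) at_top"
  proof -
    have "filterlim (\<lambda>t. - d * t) at_bot at_top"
      using assms filterlim_tendsto_neg_mult_at_bot[OF tendsto_const, of "-d" "\<lambda>x. x" at_top] by (simp add: filterlim_ident)
    then show ?thesis using exp_at_bot filterlim_compose by blast
  qed
  then have "((\<lambda>t. - exp (- d * t)) \<longlongrightarrow> 0) at_top" using tendsto_minus by fastforce
  then show ?thesis
    by (subst nn_integral_FTC_atLeast[where F="\<lambda>t. - exp (- d * t)" and T=0])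
      (use assms in \<open>auto intro!: derivative_eq_intros\<close>)
qed

text \<open>Instead of a surface measure, image measures are compared: under x -> - ln (norm x) a
  half-line \<open>{a<..}\<close> pulls back to a dilated ball (up to the origin), whose
  \<open>g\<close>-mass scales by \<open>c ^ DIM('a)\<close> because \<open>g\<close> is invariant
  under dilations. Measures that are finite and equal on all these half-lines coincide. The weight
  \<open>g\<close> makes room for the angular factor of a spherical harmonic.\<close>

lemma nn_integral_polar:
  fixes g :: "'a::euclidean_space \<Rightarrow> ennreal" and f :: "real \<Rightarrow> ennreal"
  assumes g[measurable]: "g \<in> borel_measurable borel"
    and hom: "\<And>c x. 0 < c \<Longrightarrow> g (c *\<^sub>R x) = g x"
    and C: "C = (\<integral>\<^sup>+ x. g x * indicator (ball 0 1) x \<partial>lborel)" "C < \<infinity>"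
    and f[measurable]: "f \<in> borel_measurable borel"
  shows "(\<integral>\<^sup>+ x. g x * f (- ln (norm x)) * indicator (ball 0 1) x \<partial>lborel)
     = C * (\<integral>\<^sup>+ t. f t * ennreal (real DIM('a) * exp (- real DIM('a) * t)) * indicator {0<..} t \<partial>lborel)"
proof -
  let ?d = "real DIM('a)"
  have d: "0 < ?d" by simp
  have ind[measurable]: "(\<lambda>x::'a. indicator (ball 0 c - {0}) x :: ennreal) \<in> borel_measurable borel" for c
    by (intro borel_measurable_indicator) auto
  \<comment> \<open>The origin is removed because \<open>ln 0 = 0\<close> would place it at t = 0
    instead of at infinity.\<close>
  define A where "A = density lborel (\<lambda>x::'a. g x * indicator (ball 0 1 - {0}) x)"
  define M where "M = distr A borel (\<lambda>x. - ln (norm x))"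
  define N where "N = density lborel (\<lambda>t. C * (ennreal (?d * exp (- ?d * t)) * indicator {0<..} t))"
  have null: "AE x in lborel. x \<noteq> (0::'a)"
    using AE_lborel_singleton by blast
  have C': "(\<integral>\<^sup>+ x. g x * indicator (ball 0 1 - {0}) x \<partial>lborel) = C"
    unfolding C by (intro nn_integral_cong_AE eventually_mono[OF null]) (auto simp: indicator_def)
  have eM: "emeasure M {a<..} = C * ennreal (exp (- ?d * max a 0))" for a
  proof -
    define c where "c = exp (- max a 0)"
    have c: "0 < c" by (simp add: c_def)
    have "emeasure M {a<..} = emeasure A ((\<lambda>x. - ln (norm x)) -` {a<..} \<inter> space A)"
      unfolding M_def by (rule emeasure_distr) (simp_all add: A_def)
    also have "\<dots> = (\<integral>\<^sup>+ x. g x * indicator (ball 0 1 - {0}) x * indicator ((\<lambda>x. - ln (norm x)) -` {a<..}) x \<partial>lborel)"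
    proof -
      have s: "(\<lambda>x::'a. - ln (norm x)) -` {a<..} \<in> sets lborel"
        using measurable_sets_borel[of "\<lambda>x::'a. - ln (norm x)" borel "{a<..}"] by simp
      have m: "(\<lambda>x. g x * indicator (ball 0 1 - {0}) x) \<in> borel_measurable lborel"
        using borel_measurable_times_ennreal[OF g ind[of 1]] by simp
      show ?thesis unfolding A_def using emeasure_density[OF m s] by simp
    qed
    also have "\<dots> = (\<integral>\<^sup>+ x. g x * indicator (ball 0 c - {0}) x \<partial>lborel)"
    proof (intro nn_integral_cong)
      fix x :: 'a
      have "x \<in> ball 0 1 \<and> - ln (norm x) > a \<longleftrightarrow> x \<in> ball 0 c" if "x \<noteq> 0"
      proof -
        have "norm x < c \<longleftrightarrow> ln (norm x) < - max a 0"
          unfolding c_def using that by (metis exp_ln exp_less_cancel_iff zero_less_norm_iff)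
        moreover have "norm x < 1 \<longleftrightarrow> ln (norm x) < 0" using that by simp
        ultimately show ?thesis by auto
      qed
      then show "g x * indicator (ball 0 1 - {0}) x * indicator ((\<lambda>x. - ln (norm x)) -` {a<..}) x = g x * indicator (ball 0 c - {0}) x"
        by (cases "x = 0") (auto simp: indicator_def)
    qed
    also have "\<dots> = ennreal (c ^ DIM('a)) * (\<integral>\<^sup>+ x. g (c *\<^sub>R x) * indicator (ball 0 c - {0}) (c *\<^sub>R x) \<partial>lborel)"
      by (rule nn_integral_scale[OF borel_measurable_times_ennreal[OF g ind] c])
    also have "(\<integral>\<^sup>+ x. g (c *\<^sub>R x) * indicator (ball 0 c - {0}) (c *\<^sub>R x) \<partial>lborel) = C"
      unfolding C'[symmetric] using c hom by (intro nn_integral_cong) (auto simp: indicator_def)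
    also have "c ^ DIM('a) = exp (- ?d * max a 0)"
      unfolding c_def by (simp add: exp_of_nat_mult[symmetric])
    finally show ?thesis by (simp add: mult.commute)
  qed
  have eN: "emeasure N {a<..} = C * ennreal (exp (- ?d * max a 0))" for a
  proof -
    have "emeasure N {a<..} = (\<integral>\<^sup>+ t. C * (ennreal (?d * exp (- ?d * t)) * indicator {0<..} t) * indicator {a<..} t \<partial>lborel)"
      unfolding N_def by (subst emeasure_density) auto
    also have "\<dots> = (\<integral>\<^sup>+ t. C * (ennreal (?d * exp (- ?d * t)) * indicator {max a 0..} t) \<partial>lborel)"
      using AE_lborel_singleton[of "max a 0"]
      by (intro nn_integral_cong_AE) (auto simp: indicator_def max_def split: if_splits)
    also have "\<dots> = C * (\<integral>\<^sup>+ t. ennreal (?d * exp (- ?d * t)) * indicator {max a 0..} t \<partial>lborel)"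
      by (rule nn_integral_cmult) measurable
    also have "\<dots> = C * ennreal (exp (- ?d * max a 0))"
      by (subst nn_integral_exp_tail[OF d]) simp
    finally show ?thesis .
  qed
  have "M = N"
  proof (rule measure_eqI_lessThan)
    show "emeasure M {x<..} < \<infinity>" for x unfolding eM using C(2) by (simp add: ennreal_mult_less_top)
    show "emeasure M {x<..} = emeasure N {x<..}" for x unfolding eM eN ..
  qed (simp_all add: M_def N_def)
  have "(\<integral>\<^sup>+ x. g x * f (- ln (norm x)) * indicator (ball 0 1) x \<partial>lborel)
     = (\<integral>\<^sup>+ x. g x * indicator (ball 0 1 - {0}) x * f (- ln (norm x)) \<partial>lborel)"
    by (intro nn_integral_cong_AE eventually_mono[OF null]) (auto simp: indicator_def)
  also have "\<dots> = (\<integral>\<^sup>+ t. f t \<partial>M)"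
    unfolding M_def A_def by (simp add: nn_integral_distr nn_integral_density)
  also have "\<dots> = (\<integral>\<^sup>+ t. C * (ennreal (?d * exp (- ?d * t)) * indicator {0<..} t) * f t \<partial>lborel)"
    unfolding \<open>M = N\<close> N_def by (simp add: nn_integral_density)
  also have "\<dots> = C * (\<integral>\<^sup>+ t. f t * ennreal (?d * exp (- ?d * t)) * indicator {0<..} t \<partial>lborel)"
    by (subst nn_integral_cmult[symmetric]) (auto simp: mult_ac)
  finally show ?thesis .
qed

lemma sphere_area_ball: "sphere_area TYPE('a::euclidean_space) = real DIM('a) * measure lborel (ball (0::'a) 1)"
  by (simp add: sphere_area_def)

lemma sphere_area_pos: "0 < sphere_area TYPE('a::euclidean_space)"
  unfolding sphere_area_ball by (simp add: content_ball_pos)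

lemma nn_integral_radial:
  fixes f :: "real \<Rightarrow> ennreal"
  assumes f[measurable]: "f \<in> borel_measurable borel"
  shows "(\<integral>\<^sup>+ x. f (- ln (norm x)) * indicator (ball (0::'a::euclidean_space) 1) x \<partial>lborel)
     = ennreal (sphere_area TYPE('a)) * (\<integral>\<^sup>+ t. f t * ennreal (exp (- real DIM('a) * t)) * indicator {0<..} t \<partial>lborel)"
proof -
  have e: "ennreal (measure lborel (ball (0::'a) 1)) = emeasure lborel (ball (0::'a) 1)"
    by (metis emeasure_eq_ennreal_measure emeasure_lborel_ball_finite less_irrefl infinity_ennreal_def)
  have "(\<integral>\<^sup>+ x. f (- ln (norm x)) * indicator (ball (0::'a::euclidean_space) 1) x \<partial>lborel)
   = ennreal (measure lborel (ball (0::'a) 1)) * (\<integral>\<^sup>+ t. f t * ennreal (real DIM('a) * exp (- real DIM('a) * t)) * indicator {0<..} t \<partial>lborel)"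
    using nn_integral_polar[of "\<lambda>_::'a. 1" "ennreal (measure lborel (ball (0::'a) 1))" f]
    by (simp add: e[symmetric])
  also have "\<dots> = ennreal (measure lborel (ball (0::'a) 1)) * (\<integral>\<^sup>+ t. ennreal (real DIM('a)) * (f t * ennreal (exp (- real DIM('a) * t)) * indicator {0<..} t) \<partial>lborel)"
    by (rule arg_cong2[where f="(*)", OF refl], rule nn_integral_cong) (auto simp: ennreal_mult mult_ac)
  also have "\<dots> = ennreal (sphere_area TYPE('a)) * (\<integral>\<^sup>+ t. f t * ennreal (exp (- real DIM('a) * t)) * indicator {0<..} t \<partial>lborel)"
    by (subst nn_integral_cmult) (auto simp: sphere_area_ball ennreal_mult mult_ac)
  finally show ?thesis .
qed

text \<open>A set is null when its indicator has integral zero, and the exponential density in the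
  polar formula is positive, so null sets correspond.\<close>

lemma AE_radial_iff:
  assumes [measurable]: "Measurable.pred borel P"
  shows "(AE x in lebesgue_on (ball (0::'a::euclidean_space) 1). P (- ln (norm x))) \<longleftrightarrow> (AE t in lborel. 0 < t \<longrightarrow> P t)"
proof -
  have "(AE x in lebesgue_on (ball (0::'a) 1). P (- ln (norm x))) \<longleftrightarrow> (AE x in lebesgue. x \<in> ball (0::'a) 1 \<longrightarrow> P (- ln (norm x)))"
    by (rule AE_restrict_space_iff) simp
  also have "\<dots> \<longleftrightarrow> (AE x in lborel. x \<in> ball (0::'a) 1 \<longrightarrow> P (- ln (norm x)))"
    by (rule AE_completion_iff)
  also have "\<dots> \<longleftrightarrow> (\<integral>\<^sup>+ x. of_bool (\<not> P (- ln (norm x))) * indicator (ball (0::'a) 1) x \<partial>lborel) = 0"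
    by (subst nn_integral_0_iff_AE) (auto simp: indicator_def)
  also have "\<dots> \<longleftrightarrow> (\<integral>\<^sup>+ t. of_bool (\<not> P t) * ennreal (exp (- real DIM('a) * t)) * indicator {0<..} t \<partial>lborel) = 0"
    using sphere_area_pos[where 'a='a] by (subst nn_integral_radial[where f="\<lambda>t. of_bool (\<not> P t)"]) auto
  also have "\<dots> \<longleftrightarrow> (AE t in lborel. 0 < t \<longrightarrow> P t)"
    by (subst nn_integral_0_iff_AE) (auto simp: indicator_def)
  finally show ?thesis .
qed

section \<open>The amplitude of a potential\<close>

text \<open>With A(s,z) = F(s, s + z), the inner integral is the ordinary convolution of A(s,.) with
  itself at x - s when G = H = F. The time set is a parameter because the comparison of two times
  also needs bounded intervals.\<close>

definition conv :: "real set \<Rightarrow> (real \<Rightarrow> real \<Rightarrow> ennreal) \<Rightarrow> (real \<Rightarrow> real \<Rightarrow> ennreal) \<Rightarrow> real \<Rightarrow> ennreal"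
  where "conv S G H x =
    (\<integral>\<^sup>+ s. indicator S s * (\<integral>\<^sup>+ y. G s y * H s (x + s - y) \<partial>lborel) \<partial>lborel)"

text \<open>
  The amplitude is split as \<open>F = F\<^sub>T - F\<^sub>F\<close> with nonnegative parts indexed by their sign. The quadratic
  term of the equation then enters each part positively: \<open>F\<^sub>\<sigma>\<close> receives the products \<open>F\<^sub>\<tau> F\<^sub>\<rho>\<close> of signs with
  \<open>\<tau>\<rho> = -\<sigma>\<close>, that is, \<open>\<rho> = (\<sigma> \<noteq> \<tau>)\<close>. Both parts are monotone limits of the iteration from \<open>0\<close>.
\<close>

primrec amp_iter :: "(real \<Rightarrow> real) \<Rightarrow> nat \<Rightarrow> bool \<Rightarrow> real \<Rightarrow> real \<Rightarrow> ennreal" where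
  "amp_iter Q 0 = (\<lambda>\<sigma> t x. 0)"
| "amp_iter Q (Suc n) = (\<lambda>\<sigma> t x. indicator {t..} x * ennreal (if \<sigma> then Q x else - Q x)
     + (\<Sum>\<tau>\<in>UNIV. conv {t..} (amp_iter Q n \<tau>) (amp_iter Q n (\<sigma> \<noteq> \<tau>)) x))"

definition amp :: "(real \<Rightarrow> real) \<Rightarrow> bool \<Rightarrow> real \<Rightarrow> real \<Rightarrow> ennreal" where
  "amp Q \<sigma> t x = (SUP n. amp_iter Q n \<sigma> t x)"

abbreviation jointly_measurable :: "(real \<Rightarrow> real \<Rightarrow> ennreal) \<Rightarrow> bool" where
  "jointly_measurable G \<equiv> (\<lambda>p. G (fst p) (snd p)) \<in> borel_measurable (borel \<Otimes>\<^sub>M borel)"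

lemma jointly_measurable_comp:
  assumes "jointly_measurable G" "f \<in> borel_measurable M" "g \<in> borel_measurable M"
  shows "(\<lambda>x. G (f x) (g x)) \<in> borel_measurable M"
  using measurable_compose[OF _ assms(1), of "\<lambda>x. (f x, g x)" M] assms(2,3) by simp

lemma indicator_atLeast_measurable[measurable (raw)]:
  fixes f g :: "'b \<Rightarrow> real"
  assumes [measurable]: "f \<in> borel_measurable M" "g \<in> borel_measurable M"
  shows "(\<lambda>x. indicator {f x..} (g x) :: ennreal) \<in> borel_measurable M"
proof -
  have "(\<lambda>x. indicator {f x..} (g x) :: ennreal) = (\<lambda>x. if f x \<le> g x then 1 else 0)"
    by (auto simp: indicator_def)
  then show ?thesis by simp
qed

lemma conv_measurable:
  assumes G: "jointly_measurable G" and H: "jointly_measurable H"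
  shows "jointly_measurable (\<lambda>t. conv {t..} G H)"
proof -
  note [measurable] = jointly_measurable_comp[OF G] jointly_measurable_comp[OF H]
  show ?thesis unfolding conv_def by measurable
qed

lemma conv_measurable1:
  assumes G: "jointly_measurable G" and H: "jointly_measurable H" and [measurable]: "S \<in> sets borel"
  shows "conv S G H \<in> borel_measurable borel"
proof -
  note [measurable] = jointly_measurable_comp[OF G] jointly_measurable_comp[OF H]
  show ?thesis unfolding conv_def by measurable
qed

lemma amp_iter_measurable:
  assumes [measurable]: "Q \<in> borel_measurable borel"
  shows "jointly_measurable (amp_iter Q n \<sigma>)"
proof (induction n arbitrary: \<sigma>)
  case (Suc n)
  note [measurable] = conv_measurable[OF Suc Suc]
  have [measurable]: "(\<lambda>x. if \<sigma> then Q x else - Q x) \<in> borel_measurable borel" by (cases \<sigma>) auto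
  show ?case unfolding amp_iter.simps UNIV_bool by simp
qed simp

lemma amp_measurable:
  assumes [measurable]: "Q \<in> borel_measurable borel"
  shows "jointly_measurable (amp Q \<sigma>)"
  using amp_iter_measurable[OF assms] unfolding amp_def by measurable

lemma conv_mono:
  assumes "\<And>s y. G s y \<le> G' s y" "\<And>s y. H s y \<le> H' s y"
  shows "conv S G H x \<le> conv S G' H' x"
  unfolding conv_def by (intro nn_integral_mono mult_left_mono mult_mono assms) auto

lemma amp_iter_mono: "amp_iter Q n \<sigma> t x \<le> amp_iter Q (Suc n) \<sigma> t x"
proof (induction n arbitrary: \<sigma> t x)
  case (Suc n)
  show ?case
    unfolding amp_iter.simps(2)[of Q "Suc n"] amp_iter.simps(2)[of Q "n"]
    by (intro add_left_mono sum_mono conv_mono) (use Suc in simp_all)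
qed simp

lemma amp_iter_incseq: "incseq (\<lambda>n. amp_iter Q n \<sigma> t x)"
  by (intro incseq_SucI amp_iter_mono)

text \<open>The arguments y and x + s - y add up to x + s, so if both are at least s then both are
  at most x. For x < s nothing is left.\<close>

lemma conv_support:
  assumes "\<And>s y. y < s \<Longrightarrow> G s y = 0" "\<And>s y. y < s \<Longrightarrow> H s y = 0" "S \<subseteq> {t..}" "x < t"
  shows "conv S G H x = 0"
proof -
  have "indicator S s * (\<integral>\<^sup>+ y. G s y * H s (x + s - y) \<partial>lborel) = (0::ennreal)" for s
  proof (cases "s \<in> S")
    case True
    then have "x < s" using assms by auto
    then have "G s y * H s (x + s - y) = 0" for y
      using assms(1)[of y s] assms(2)[of "x+s-y" s] by (cases "y < s") auto
    then have "(\<lambda>y. G s y * H s (x + s - y)) = (\<lambda>_. 0)" by blast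
    then show ?thesis by (simp only: nn_integral_const) simp
  qed simp
  then have "(\<lambda>s. indicator S s * (\<integral>\<^sup>+ y. G s y * H s (x + s - y) \<partial>lborel)) = (\<lambda>_. 0)" by blast
  then show ?thesis unfolding conv_def by (simp only: nn_integral_const) simp
qed

lemma amp_iter_support: "x < t \<Longrightarrow> amp_iter Q n \<sigma> t x = 0"
proof (induction n arbitrary: \<sigma> t x)
  case (Suc n)
  then show ?case by (simp add: conv_support[where t=t] UNIV_bool)
qed simp

lemma amp_support: "x < t \<Longrightarrow> amp Q \<sigma> t x = 0"
  unfolding amp_def by (simp add: amp_iter_support)

lemma SUP_mult_incseq_ennreal:
  fixes f g :: "nat \<Rightarrow> ennreal"
  assumes "incseq f" "incseq g"
  shows "(SUP n. f n) * (SUP n. g n) = (SUP n. f n * g n)"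
proof (rule antisym)
  have "(SUP n. f n) * (SUP n. g n) = (SUP n. SUP m. f n * g m)"
    unfolding SUP_mult_right_ennreal by (intro SUP_cong refl SUP_mult_left_ennreal)
  also have "\<dots> \<le> (SUP n. f n * g n)"
  proof (intro SUP_least)
    fix n m
    have "f n * g m \<le> f (max n m) * g (max n m)"
      using assms by (intro mult_mono) (auto simp: incseq_def)
    also have "\<dots> \<le> (SUP n. f n * g n)" by (rule SUP_upper) simp
    finally show "f n * g m \<le> (SUP n. f n * g n)" .
  qed
  finally show "(SUP n. f n) * (SUP n. g n) \<le> (SUP n. f n * g n)" .
  show "(SUP n. f n * g n) \<le> (SUP n. f n) * (SUP n. g n)"
    by (intro SUP_least mult_mono SUP_upper) auto
qed

lemma conv_SUP:
  assumes G: "\<And>n. jointly_measurable (G n)" and H: "\<And>n. jointly_measurable (H n)"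
    and iG: "\<And>s y. incseq (\<lambda>n. G n s y)" and iH: "\<And>s y. incseq (\<lambda>n. H n s y)"
    and [measurable]: "S \<in> sets borel"
  shows "conv S (\<lambda>s y. SUP n. G n s y) (\<lambda>s y. SUP n. H n s y) x = (SUP n. conv S (G n) (H n) x)"
proof -
  note [measurable] = jointly_measurable_comp[OF G] jointly_measurable_comp[OF H]
  have iGH: "incseq (\<lambda>n y. G n s y * H n s (x + s - y))" for s
    using iG iH by (auto simp: incseq_def le_fun_def intro!: mult_mono)
  have "conv S (\<lambda>s y. SUP n. G n s y) (\<lambda>s y. SUP n. H n s y) x
     = (\<integral>\<^sup>+ s. indicator S s * (\<integral>\<^sup>+ y. (SUP n. G n s y * H n s (x + s - y)) \<partial>lborel) \<partial>lborel)"
    unfolding conv_def by (simp add: SUP_mult_incseq_ennreal[OF iG iH])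
  also have "\<dots> = (\<integral>\<^sup>+ s. (SUP n. indicator S s * (\<integral>\<^sup>+ y. G n s y * H n s (x + s - y) \<partial>lborel)) \<partial>lborel)"
    by (subst nn_integral_monotone_convergence_SUP[OF iGH]) (auto simp: SUP_mult_left_ennreal)
  also have "\<dots> = (SUP n. conv S (G n) (H n) x)"
    unfolding conv_def
  proof (rule nn_integral_monotone_convergence_SUP)
    show "incseq (\<lambda>n s. indicator S s * (\<integral>\<^sup>+ y. G n s y * H n s (x + s - y) \<partial>lborel))"
      using iGH by (auto simp: incseq_def le_fun_def intro!: mult_left_mono nn_integral_mono)
  qed measurable
  finally show ?thesis .
qed

text \<open>Monotone convergence carries the iteration to its limit. The identity holds at every
  point, with the value infinity allowed; finiteness is a separate question, settled almost
  everywhere by Laplace bounds.\<close>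

lemma amp_eq:
  assumes [measurable]: "Q \<in> borel_measurable borel"
  shows "amp Q \<sigma> t x = indicator {t..} x * ennreal (if \<sigma> then Q x else - Q x)
     + (\<Sum>\<tau>\<in>UNIV. conv {t..} (amp Q \<tau>) (amp Q (\<sigma> \<noteq> \<tau>)) x)"
proof -
  have c: "conv {t..} (amp Q \<tau>) (amp Q \<rho>) x = (SUP n. conv {t..} (amp_iter Q n \<tau>) (amp_iter Q n \<rho>) x)" for \<tau> \<rho>
    unfolding amp_def by (rule conv_SUP) (auto intro: amp_iter_measurable amp_iter_incseq)
  have inc: "incseq (\<lambda>n. conv {t..} (amp_iter Q n \<tau>) (amp_iter Q n \<rho>) x)" for \<tau> \<rho>
    by (intro incseq_SucI conv_mono amp_iter_mono)
  have "amp Q \<sigma> t x = (SUP n. amp_iter Q (Suc n) \<sigma> t x)"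
    unfolding amp_def by (rule antisym)
      (auto intro!: SUP_mono amp_iter_mono simp del: amp_iter.simps)
  also have "\<dots> = indicator {t..} x * ennreal (if \<sigma> then Q x else - Q x)
     + (SUP n. \<Sum>\<tau>\<in>UNIV. conv {t..} (amp_iter Q n \<tau>) (amp_iter Q n (\<sigma> \<noteq> \<tau>)) x)"
    unfolding amp_iter.simps by (simp add: ennreal_SUP_add_right[symmetric])
  also have "(SUP n. \<Sum>\<tau>\<in>UNIV. conv {t..} (amp_iter Q n \<tau>) (amp_iter Q n (\<sigma> \<noteq> \<tau>)) x)
     = (\<Sum>\<tau>\<in>UNIV. conv {t..} (amp Q \<tau>) (amp Q (\<sigma> \<noteq> \<tau>)) x)"
    unfolding UNIV_bool c by (simp add: ennreal_SUP_add inc)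
  finally show ?thesis .
qed

section \<open>Laplace transforms and the integrated Riccati equation\<close>

definition lap :: "real \<Rightarrow> (real \<Rightarrow> real \<Rightarrow> ennreal) \<Rightarrow> real \<Rightarrow> ennreal" where
  "lap \<kappa> G t = (\<integral>\<^sup>+ y. G t y * ennreal (exp (- \<kappa> * y)) \<partial>lborel)"

lemma lap_measurable:
  assumes G: "jointly_measurable G" shows "lap \<kappa> G \<in> borel_measurable borel"
proof -
  note [measurable] = jointly_measurable_comp[OF G]
  show ?thesis unfolding lap_def by measurable
qed

lemma nn_integral_shift:
  fixes f :: "real \<Rightarrow> ennreal"
  assumes [measurable]: "f \<in> borel_measurable borel"
  shows "(\<integral>\<^sup>+ x. f (x + a) \<partial>lborel) = (\<integral>\<^sup>+ x. f x \<partial>lborel)"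
  using nn_integral_real_affine[OF assms, of 1 a] by (simp add: add.commute)

text \<open>Since the arguments of the two factors add up to x + s, exp (-\<kappa> x) splits into
  exp (\<kappa> s) times the weights of the factors, and Tonelli separates the integrals. The factor
  exp (\<kappa> s) appears because the weight in \<open>lap\<close> is not recentred at the time
  s.\<close>

lemma lap_conv:
  assumes G: "jointly_measurable G" and H: "jointly_measurable H" and [measurable]: "S \<in> sets borel"
  shows "(\<integral>\<^sup>+ x. conv S G H x * ennreal (exp (- \<kappa> * x)) \<partial>lborel)
    = (\<integral>\<^sup>+ s. indicator S s * ennreal (exp (\<kappa> * s)) * lap \<kappa> G s * lap \<kappa> H s \<partial>lborel)"
proof -
  note [measurable] = jointly_measurable_comp[OF G] jointly_measurable_comp[OF H] lap_measurable[OF G] lap_measurable[OF H]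
  have inner: "(\<integral>\<^sup>+ x. H s (x + s - y) * ennreal (exp (- \<kappa> * x)) \<partial>lborel) = ennreal (exp (\<kappa> * (s - y))) * lap \<kappa> H s" for s y
  proof -
    have "(\<integral>\<^sup>+ x. H s (x + s - y) * ennreal (exp (- \<kappa> * x)) \<partial>lborel)
      = (\<integral>\<^sup>+ x. ennreal (exp (\<kappa> * (s - y))) * (H s (x + (s - y)) * ennreal (exp (- \<kappa> * (x + (s - y))))) \<partial>lborel)"
    proof (intro nn_integral_cong)
      fix x
      have "exp (- \<kappa> * x) = exp (\<kappa> * (s - y)) * exp (- \<kappa> * (x + (s - y)))"
        by (simp add: exp_add[symmetric] algebra_simps)
      then show "H s (x + s - y) * ennreal (exp (- \<kappa> * x)) = ennreal (exp (\<kappa> * (s - y))) * (H s (x + (s - y)) * ennreal (exp (- \<kappa> * (x + (s - y)))))"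
        by (simp add: ennreal_mult mult.left_commute add_diff_eq)
    qed
    also have "\<dots> = ennreal (exp (\<kappa> * (s - y))) * (\<integral>\<^sup>+ x. H s (x + (s - y)) * ennreal (exp (- \<kappa> * (x + (s - y)))) \<partial>lborel)"
      by (rule nn_integral_cmult) measurable
    also have "\<dots> = ennreal (exp (\<kappa> * (s - y))) * lap \<kappa> H s"
      unfolding lap_def by (subst nn_integral_shift[where a="s-y"]) simp_all
    finally show ?thesis .
  qed
  have "(\<integral>\<^sup>+ x. conv S G H x * ennreal (exp (- \<kappa> * x)) \<partial>lborel)
    = (\<integral>\<^sup>+ x. \<integral>\<^sup>+ s. indicator S s * (\<integral>\<^sup>+ y. G s y * H s (x + s - y) * ennreal (exp (- \<kappa> * x)) \<partial>lborel) \<partial>lborel \<partial>lborel)"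
    unfolding conv_def by (simp add: nn_integral_multc[symmetric] mult.assoc)
  also have "\<dots> = (\<integral>\<^sup>+ s. \<integral>\<^sup>+ x. indicator S s * (\<integral>\<^sup>+ y. G s y * H s (x + s - y) * ennreal (exp (- \<kappa> * x)) \<partial>lborel) \<partial>lborel \<partial>lborel)"
    by (rule lborel_pair.Fubini') measurable
  also have "\<dots> = (\<integral>\<^sup>+ s. indicator S s * (\<integral>\<^sup>+ x. \<integral>\<^sup>+ y. G s y * H s (x + s - y) * ennreal (exp (- \<kappa> * x)) \<partial>lborel \<partial>lborel) \<partial>lborel)"
    by (simp add: nn_integral_cmult)
  also have "\<dots> = (\<integral>\<^sup>+ s. indicator S s * (\<integral>\<^sup>+ y. \<integral>\<^sup>+ x. G s y * H s (x + s - y) * ennreal (exp (- \<kappa> * x)) \<partial>lborel \<partial>lborel) \<partial>lborel)"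
    by (subst lborel_pair.Fubini') measurable
  also have "\<dots> = (\<integral>\<^sup>+ s. indicator S s * (\<integral>\<^sup>+ y. G s y * (ennreal (exp (\<kappa> * (s - y))) * lap \<kappa> H s) \<partial>lborel) \<partial>lborel)"
    unfolding mult.assoc by (simp add: nn_integral_cmult inner[unfolded mult_minus_left])
  also have "\<dots> = (\<integral>\<^sup>+ s. indicator S s * (\<integral>\<^sup>+ y. ennreal (exp (\<kappa> * s)) * lap \<kappa> H s * (G s y * ennreal (exp (- \<kappa> * y))) \<partial>lborel) \<partial>lborel)"
    by (simp add: right_diff_distrib exp_diff exp_minus divide_inverse ennreal_mult mult_ac)
  also have "\<dots> = (\<integral>\<^sup>+ s. indicator S s * ennreal (exp (\<kappa> * s)) * lap \<kappa> G s * lap \<kappa> H s \<partial>lborel)"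
    unfolding lap_def[of \<kappa> G] by (subst nn_integral_cmult) (auto simp: mult_ac)
  finally show ?thesis .
qed

text \<open>Causality: both factors of the quadratic term vanish unless s <= y <= x, and then x + s
  - y lies in the same range. The equation at x therefore sees the potential only up to x.\<close>

lemma amp_iter_local:
  assumes "\<And>x. x < T \<Longrightarrow> Q1 x = Q2 x"
  shows "x < T \<Longrightarrow> amp_iter Q1 n \<sigma> t x = amp_iter Q2 n \<sigma> t x"
proof (induction n arbitrary: \<sigma> t x)
  case (Suc n)
  have "amp_iter Q1 n \<tau> s y * amp_iter Q1 n \<rho> s (x + s - y) = amp_iter Q2 n \<tau> s y * amp_iter Q2 n \<rho> s (x + s - y)" for \<tau> \<rho> s y
  proof (cases "s \<le> y \<and> y \<le> x")
    case True
    then show ?thesis using Suc by simp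
  next
    case False
    then show ?thesis
      using amp_iter_support[of y s] amp_iter_support[of "x + s - y" s] by (cases "y < s") auto
  qed
  then show ?case using assms[OF Suc.prems] by (simp add: conv_def)
qed simp

lemma amp_local:
  assumes "\<And>x. x < T \<Longrightarrow> Q1 x = Q2 x" "x < T"
  shows "amp Q1 \<sigma> t x = amp Q2 \<sigma> t x"
  unfolding amp_def using amp_iter_local[OF assms] by simp

lemma lap_add:
  assumes "jointly_measurable G" "jointly_measurable H"
  shows "(\<integral>\<^sup>+ x. (G t x + H t x) * ennreal (exp (- \<kappa> * x)) \<partial>lborel) = lap \<kappa> G t + lap \<kappa> H t"
proof -
  note [measurable] = jointly_measurable_comp[OF assms(1)] jointly_measurable_comp[OF assms(2)]
  show ?thesis unfolding lap_def by (simp add: distrib_right nn_integral_add)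
qed

definition amp_source :: "(real \<Rightarrow> real) \<Rightarrow> real \<Rightarrow> bool \<Rightarrow> real \<Rightarrow> ennreal" where
  "amp_source Q \<kappa> \<sigma> t = (\<integral>\<^sup>+ x. indicator {t..} x * ennreal (if \<sigma> then Q x else - Q x) * ennreal (exp (- \<kappa> * x)) \<partial>lborel)"

text \<open>\<open>G\<close> is left arbitrary so that one computation serves both a step of the
  iteration and the fixed point equation of its limit.\<close>

lemma lap_step:
  assumes [measurable]: "Q \<in> borel_measurable borel" and G: "\<And>\<tau>. jointly_measurable (G \<tau>)"
  shows "(\<integral>\<^sup>+ x. (indicator {t..} x * ennreal (if \<sigma> then Q x else - Q x)
     + (\<Sum>\<tau>\<in>UNIV. conv {t..} (G \<tau>) (G (\<sigma> \<noteq> \<tau>)) x)) * ennreal (exp (- \<kappa> * x)) \<partial>lborel)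
   = amp_source Q \<kappa> \<sigma> t + (\<integral>\<^sup>+ s. indicator {t..} s * ennreal (exp (\<kappa> * s)) * (\<Sum>\<tau>\<in>UNIV. lap \<kappa> (G \<tau>) s * lap \<kappa> (G (\<sigma> \<noteq> \<tau>)) s) \<partial>lborel)"
proof -
  have [measurable]: "(\<lambda>x. if \<sigma> then Q x else - Q x) \<in> borel_measurable borel" by (cases \<sigma>) auto
  note [measurable] = jointly_measurable_comp[OF G] lap_measurable[OF G] conv_measurable1[OF G G]
  show ?thesis
    unfolding amp_source_def UNIV_bool
    by (simp add: distrib_right distrib_left nn_integral_add lap_conv[OF G G, unfolded mult_minus_left] mult.assoc)
qed

lemma lap_amp_iter_Suc:
  assumes [measurable]: "Q \<in> borel_measurable borel"
  shows "lap \<kappa> (amp_iter Q (Suc n) \<sigma>) t = amp_source Q \<kappa> \<sigma> t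
    + (\<integral>\<^sup>+ s. indicator {t..} s * ennreal (exp (\<kappa> * s)) * (\<Sum>\<tau>\<in>UNIV. lap \<kappa> (amp_iter Q n \<tau>) s * lap \<kappa> (amp_iter Q n (\<sigma> \<noteq> \<tau>)) s) \<partial>lborel)"
  unfolding amp_iter.simps
  unfolding lap_def[of \<kappa> "\<lambda>t x. _ t x + _ t x"]
  by (rule lap_step[OF assms, of "\<lambda>\<tau>. amp_iter Q n \<tau>"]) (rule amp_iter_measurable[OF assms])

lemma lap_amp:
  assumes [measurable]: "Q \<in> borel_measurable borel"
  shows "lap \<kappa> (amp Q \<sigma>) t = amp_source Q \<kappa> \<sigma> t
    + (\<integral>\<^sup>+ s. indicator {t..} s * ennreal (exp (\<kappa> * s)) * (\<Sum>\<tau>\<in>UNIV. lap \<kappa> (amp Q \<tau>) s * lap \<kappa> (amp Q (\<sigma> \<noteq> \<tau>)) s) \<partial>lborel)"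
  unfolding lap_def[of \<kappa> "amp Q \<sigma>"] amp_eq[OF assms, of \<sigma> t]
  by (rule lap_step[OF assms, of "\<lambda>\<tau>. amp Q \<tau>"]) (rule amp_measurable[OF assms])

lemma lap_amp_SUP:
  assumes "Q \<in> borel_measurable borel"
  shows "lap \<kappa> (amp Q \<sigma>) t = (SUP n. lap \<kappa> (amp_iter Q n \<sigma>) t)"
proof -
  note [measurable] = jointly_measurable_comp[OF amp_iter_measurable[OF assms]]
  show ?thesis unfolding lap_def amp_def SUP_mult_right_ennreal
    by (rule nn_integral_monotone_convergence_SUP)
      (auto simp: incseq_def le_fun_def intro!: mult_right_mono incseqD[OF amp_iter_incseq])
qed

text \<open>The condition \<open>4 * M \<le> c\<close> makes \<open>2 * M\<close> a bound that the iteration preserves: \<open>M + (2 * M)\<^sup>2 / c \<le> 2 * M\<close>.\<close>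

definition exp_bounded :: "(real \<Rightarrow> real) \<Rightarrow> real \<Rightarrow> real \<Rightarrow> bool" where
  "exp_bounded Q M c \<longleftrightarrow> 0 \<le> M \<and> 0 < c \<and> 4 * M \<le> c \<and> Q \<in> borel_measurable borel \<and>
    (\<forall>t. (\<integral>\<^sup>+ x. indicator {t..} x * ennreal (\<bar>Q x\<bar> * exp (- c * (x - t))) \<partial>lborel) \<le> ennreal M)"

lemma amp_source_bound:
  assumes "exp_bounded Q M \<kappa>"
  shows "amp_source Q \<kappa> True t + amp_source Q \<kappa> False t \<le> ennreal (M * exp (- \<kappa> * t))"
proof -
  have [measurable]: "Q \<in> borel_measurable borel" using assms by (simp add: exp_bounded_def)
  have "amp_source Q \<kappa> True t + amp_source Q \<kappa> False t
    = (\<integral>\<^sup>+ x. ennreal (exp (- \<kappa> * t)) * (indicator {t..} x * ennreal (\<bar>Q x\<bar> * exp (- \<kappa> * (x - t)))) \<partial>lborel)"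
    unfolding amp_source_def
  proof (subst nn_integral_add[symmetric], simp, simp, intro nn_integral_cong)
    fix x
    have "ennreal (Q x) + ennreal (- Q x) = ennreal \<bar>Q x\<bar>"
      by (cases "0 \<le> Q x") (auto simp: ennreal_neg)
    moreover have "exp (- \<kappa> * x) = exp (- \<kappa> * t) * exp (- \<kappa> * (x - t))"
      by (simp add: exp_add[symmetric] algebra_simps)
    ultimately show "indicator {t..} x * ennreal (if True then Q x else - Q x) * ennreal (exp (- \<kappa> * x))
      + indicator {t..} x * ennreal (if False then Q x else - Q x) * ennreal (exp (- \<kappa> * x))
      = ennreal (exp (- \<kappa> * t)) * (indicator {t..} x * ennreal (\<bar>Q x\<bar> * exp (- \<kappa> * (x - t))))"
      by (simp add: ennreal_mult distrib_right[symmetric] distrib_left[symmetric] mult_ac)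
  qed
  also have "\<dots> = ennreal (exp (- \<kappa> * t)) * (\<integral>\<^sup>+ x. (indicator {t..} x * ennreal (\<bar>Q x\<bar> * exp (- \<kappa> * (x - t)))) \<partial>lborel)"
    by (rule nn_integral_cmult) measurable
  also have "\<dots> \<le> ennreal (exp (- \<kappa> * t)) * ennreal M"
    using assms by (intro mult_left_mono) (auto simp: exp_bounded_def)
  finally show ?thesis using assms by (simp add: ennreal_mult mult.commute exp_bounded_def)
qed

text \<open>Added over both signs, the four products form the square of the sum of the two parts, so
  the induction is scalar. Integrating exp (\<kappa> s) exp (-2 \<kappa> s) over s >= t supplies the
  factor 1 / \<kappa> in the quadratic term.\<close>

lemma lap_amp_iter_bound:
  assumes "exp_bounded Q M \<kappa>"
  shows "lap \<kappa> (amp_iter Q n True) t + lap \<kappa> (amp_iter Q n False) t \<le> ennreal (2 * M * exp (- \<kappa> * t))"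
proof (induction n arbitrary: t)
  case (Suc n)
  have Q[measurable]: "Q \<in> borel_measurable borel" and \<kappa>: "0 < \<kappa>" "4 * M \<le> \<kappa>" "0 \<le> M"
    using assms by (simp_all add: exp_bounded_def)
  let ?a = "\<lambda>\<tau>. lap \<kappa> (amp_iter Q n \<tau>)"
  note [measurable] = lap_measurable[OF amp_iter_measurable[OF Q]]
  have "lap \<kappa> (amp_iter Q (Suc n) True) t + lap \<kappa> (amp_iter Q (Suc n) False) t
    = (amp_source Q \<kappa> True t + amp_source Q \<kappa> False t)
      + (\<integral>\<^sup>+ s. indicator {t..} s * ennreal (exp (\<kappa> * s)) * (?a True s + ?a False s)\<^sup>2 \<partial>lborel)"
  proof -
    have "(\<integral>\<^sup>+ s. indicator {t..} s * ennreal (exp (\<kappa> * s)) * (?a True s + ?a False s)\<^sup>2 \<partial>lborel)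
      = (\<integral>\<^sup>+ s. indicator {t..} s * ennreal (exp (\<kappa> * s)) * (\<Sum>\<tau>\<in>UNIV. ?a \<tau> s * ?a (True \<noteq> \<tau>) s)
       + indicator {t..} s * ennreal (exp (\<kappa> * s)) * (\<Sum>\<tau>\<in>UNIV. ?a \<tau> s * ?a (False \<noteq> \<tau>) s) \<partial>lborel)"
      by (intro nn_integral_cong) (simp add: UNIV_bool power2_eq_square distrib_left distrib_right algebra_simps)
    then show ?thesis
      unfolding lap_amp_iter_Suc[OF Q] by (simp add: nn_integral_add UNIV_bool add_ac)
  qed
  also have "\<dots> \<le> ennreal (M * exp (- \<kappa> * t)) + (\<integral>\<^sup>+ s. indicator {t..} s * ennreal (exp (\<kappa> * s)) * (ennreal (2 * M * exp (- \<kappa> * s)))\<^sup>2 \<partial>lborel)"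
    by (intro add_mono amp_source_bound[OF assms] nn_integral_mono mult_left_mono power_mono Suc) auto
  also have "(\<integral>\<^sup>+ s. indicator {t..} s * ennreal (exp (\<kappa> * s)) * (ennreal (2 * M * exp (- \<kappa> * s)))\<^sup>2 \<partial>lborel)
    = (\<integral>\<^sup>+ s. ennreal (4 * M\<^sup>2 / \<kappa>) * (ennreal (\<kappa> * exp (- \<kappa> * s)) * indicator {t..} s) \<partial>lborel)"
  proof (intro nn_integral_cong)
    fix s
    have "exp (\<kappa> * s) * (2 * M * exp (- \<kappa> * s))\<^sup>2 = 4 * M\<^sup>2 / \<kappa> * (\<kappa> * exp (- \<kappa> * s))"
      using \<kappa> by (simp add: power2_eq_square exp_minus field_simps)
    then have "ennreal (exp (\<kappa> * s)) * (ennreal (2 * M * exp (- \<kappa> * s)))\<^sup>2 = ennreal (4 * M\<^sup>2 / \<kappa>) * ennreal (\<kappa> * exp (- \<kappa> * s))"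
      using \<kappa> by (simp add: ennreal_mult[symmetric] ennreal_power)
    then show "indicator {t..} s * ennreal (exp (\<kappa> * s)) * (ennreal (2 * M * exp (- \<kappa> * s)))\<^sup>2 = ennreal (4 * M\<^sup>2 / \<kappa>) * (ennreal (\<kappa> * exp (- \<kappa> * s)) * indicator {t..} s)"
      by (metis mult.assoc mult.commute)
  qed
  also have "\<dots> = ennreal (4 * M\<^sup>2 / \<kappa>) * ennreal (exp (- \<kappa> * t))"
    by (subst nn_integral_cmult) (simp_all add: nn_integral_exp_tail[OF \<kappa>(1), unfolded mult_minus_left])
  also have "ennreal (M * exp (- \<kappa> * t)) + ennreal (4 * M\<^sup>2 / \<kappa>) * ennreal (exp (- \<kappa> * t)) \<le> ennreal (2 * M * exp (- \<kappa> * t))"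
  proof -
    have "4 * M\<^sup>2 / \<kappa> \<le> M"
      using mult_right_mono[OF \<kappa>(2) \<kappa>(3)] \<kappa>(1) by (simp add: divide_le_eq power2_eq_square mult_ac)
    then have "4 * M\<^sup>2 / \<kappa> * exp (- \<kappa> * t) \<le> M * exp (- \<kappa> * t)" by (rule mult_right_mono) simp
    then show ?thesis using \<kappa> by (simp add: ennreal_mult[symmetric] ennreal_plus[symmetric] del: ennreal_plus)
  qed
  finally show ?case by (simp add: add_left_mono)
qed (simp add: lap_def)

lemma lap_amp_bound:
  assumes "exp_bounded Q M \<kappa>"
  shows "lap \<kappa> (amp Q True) t + lap \<kappa> (amp Q False) t \<le> ennreal (2 * M * exp (- \<kappa> * t))"
proof -
  have Q: "Q \<in> borel_measurable borel" using assms by (simp_all add: exp_bounded_def)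
  have inc: "incseq (\<lambda>n. lap \<kappa> (amp_iter Q n \<sigma>) t)" for \<sigma>
    unfolding lap_def by (auto simp: incseq_def intro!: nn_integral_mono mult_right_mono incseqD[OF amp_iter_incseq])
  show ?thesis unfolding lap_amp_SUP[OF Q] ennreal_SUP_add[OF inc inc, symmetric]
    by (intro SUP_least lap_amp_iter_bound assms)
qed

lemma exp_boundedD:
  assumes "exp_bounded Q M c"
  shows "0 \<le> M" "0 < c" "4 * M \<le> c" "Q \<in> borel_measurable borel"
  using assms by (simp_all add: exp_bounded_def)

lemma lap_amp_le:
  assumes "exp_bounded Q M \<kappa>"
  shows "lap \<kappa> (amp Q \<sigma>) t \<le> ennreal (2 * M * exp (- \<kappa> * t))"
  using lap_amp_bound[OF assms, of t] by (cases \<sigma>) (auto elim!: order_trans[rotated])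

lemma lap_amp_finite:
  assumes "exp_bounded Q M \<kappa>"
  shows "lap \<kappa> (amp Q \<sigma>) t < \<infinity>"
  using lap_amp_le[OF assms, of \<sigma> t] by (simp add: le_less_trans)

lemma amp_AE_finite:
  assumes "exp_bounded Q M \<kappa>"
  shows "AE x in lborel. amp Q \<sigma> t x < \<infinity>"
proof -
  note [measurable] = jointly_measurable_comp[OF amp_measurable[OF exp_boundedD(4)[OF assms]]]
  have "AE x in lborel. amp Q \<sigma> t x * ennreal (exp (- \<kappa> * x)) \<noteq> \<infinity>"
    using lap_amp_finite[OF assms, of \<sigma> t] unfolding lap_def
    by (intro nn_integral_PInf_AE) auto
  then show ?thesis by eventually_elim (auto simp: ennreal_mult_eq_top_iff less_top[symmetric])
qed

text \<open>\<open>enn2real\<close> sends infinity to 0, so the value is meaningful only where both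
  parts are finite. Under \<open>exp_bounded\<close> this is almost every x for each fixed
  t.\<close>

definition amp_real :: "(real \<Rightarrow> real) \<Rightarrow> real \<Rightarrow> real \<Rightarrow> real" where
  "amp_real Q t x = enn2real (amp Q True t x) - enn2real (amp Q False t x)"

definition lap_diff :: "(real \<Rightarrow> real) \<Rightarrow> real \<Rightarrow> real \<Rightarrow> real" where
  "lap_diff Q \<kappa> t = enn2real (lap \<kappa> (amp Q True) t) - enn2real (lap \<kappa> (amp Q False) t)"

lemma amp_real_measurable:
  assumes "Q \<in> borel_measurable borel" shows "amp_real Q t \<in> borel_measurable borel"
proof -
  note [measurable] = jointly_measurable_comp[OF amp_measurable[OF assms]]
  show ?thesis unfolding amp_real_def by measurable
qed

lemma amp_real_support: "x < t \<Longrightarrow> amp_real Q t x = 0"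
  by (simp add: amp_real_def amp_support)

lemma lap_diff_bound:
  assumes "exp_bounded Q M \<kappa>"
  shows "\<bar>lap_diff Q \<kappa> t\<bar> \<le> 2 * M * exp (- \<kappa> * t)"
proof -
  have "enn2real (lap \<kappa> (amp Q \<sigma>) t) \<le> 2 * M * exp (- \<kappa> * t)" for \<sigma>
    using lap_amp_le[OF assms, of \<sigma> t] exp_boundedD[OF assms] by (intro enn2real_leI) auto
  then show ?thesis unfolding lap_diff_def
    by (smt (verit) enn2real_nonneg)
qed

lemma lap_diff_integral:
  assumes "exp_bounded Q M \<kappa>"
  shows "integrable lborel (\<lambda>x. amp_real Q t x * exp (- \<kappa> * x))"
    and "lap_diff Q \<kappa> t = (LINT x|lborel. amp_real Q t x * exp (- \<kappa> * x))"
proof -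
  note [measurable] = jointly_measurable_comp[OF amp_measurable[OF exp_boundedD(4)[OF assms]]]
  have eq: "(\<integral>\<^sup>+ x. ennreal (enn2real (amp Q \<sigma> t x) * exp (- \<kappa> * x)) \<partial>lborel) = lap \<kappa> (amp Q \<sigma>) t" for \<sigma>
    unfolding lap_def using amp_AE_finite[OF assms, of \<sigma> t]
    by (intro nn_integral_cong_AE) (auto elim!: eventually_mono simp: ennreal_mult)
  have i: "integrable lborel (\<lambda>x. enn2real (amp Q \<sigma> t x) * exp (- \<kappa> * x))" for \<sigma>
    using eq lap_amp_finite[OF assms, of \<sigma> t] by (intro integrableI_nonneg) auto
  have v: "(LINT x|lborel. enn2real (amp Q \<sigma> t x) * exp (- \<kappa> * x)) = enn2real (lap \<kappa> (amp Q \<sigma>) t)" for \<sigma>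
    unfolding eq[symmetric] by (intro integral_eq_nn_integral) auto
  show "integrable lborel (\<lambda>x. amp_real Q t x * exp (- \<kappa> * x))"
    "lap_diff Q \<kappa> t = (LINT x|lborel. amp_real Q t x * exp (- \<kappa> * x))"
    unfolding amp_real_def left_diff_distrib lap_diff_def v[symmetric]
    using i by (simp_all only: Bochner_Integration.integrable_diff Bochner_Integration.integral_diff)
qed

text \<open>The quadratic terms of the two signs are 2 a b and a^2 + b^2, where a and b are the
  transforms of the two parts; their difference is -(a - b)^2. For n(t) = exp (\<kappa> t)
  \<open>lap_diff Q \<kappa> t\<close> the identity is the integrated form of n' = \<kappa> n + n^2
  - Q.\<close>

lemma lap_diff_eq:
  assumes "exp_bounded Q M \<kappa>"
  defines "h \<equiv> \<lambda>s. exp (- \<kappa> * s) * Q s - exp (\<kappa> * s) * (lap_diff Q \<kappa> s)\<^sup>2"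
  shows "set_integrable lborel {t..} h" and "lap_diff Q \<kappa> t = (LINT s:{t..}|lborel. h s)"
proof -
  note Q[measurable] = exp_boundedD(4)[OF assms(1)]
  note [measurable] = lap_measurable[OF amp_measurable[OF Q]]
  let ?a = "\<lambda>\<tau>. lap \<kappa> (amp Q \<tau>)"
  \<comment> \<open>\<open>p True\<close> and \<open>p False\<close> are the integrands of the
    equations for the two parts, as finite real functions. \<open>max 0\<close> reproduces the
    truncation of negative values by \<open>ennreal\<close>.\<close>
  define p where "p \<sigma> s = indicator {t..} s * (exp (- \<kappa> * s) * max 0 (if \<sigma> then Q s else - Q s)
     + exp (\<kappa> * s) * (\<Sum>\<tau>\<in>UNIV. enn2real (?a \<tau> s) * enn2real (?a (\<sigma> \<noteq> \<tau>) s)))" for \<sigma> s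
  have [measurable]: "p \<sigma> \<in> borel_measurable borel" for \<sigma>
    unfolding p_def by (cases \<sigma>) (simp_all add: UNIV_bool)
  have p0: "0 \<le> p \<sigma> s" for \<sigma> s
    unfolding p_def by (intro mult_nonneg_nonneg add_nonneg_nonneg sum_nonneg) auto
  have ps: "ennreal (p \<sigma> s) = indicator {t..} s * ennreal (if \<sigma> then Q s else - Q s) * ennreal (exp (- \<kappa> * s))
    + indicator {t..} s * ennreal (exp (\<kappa> * s)) * (\<Sum>\<tau>\<in>UNIV. ?a \<tau> s * ?a (\<sigma> \<noteq> \<tau>) s)" for \<sigma> s
  proof -
    have a: "?a \<tau> s = ennreal (enn2real (?a \<tau> s))" for \<tau>
      using lap_amp_finite[OF assms(1), of \<tau> s] by simp
    have q: "ennreal (max 0 y) = ennreal y" for y by (simp add: max_def ennreal_neg)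
    have "(\<Sum>\<tau>\<in>UNIV. ?a \<tau> s * ?a (\<sigma> \<noteq> \<tau>) s) = ennreal (\<Sum>\<tau>\<in>UNIV. enn2real (?a \<tau> s) * enn2real (?a (\<sigma> \<noteq> \<tau>) s))"
      by (subst sum_ennreal[symmetric]) (auto simp: ennreal_mult lap_amp_finite[OF assms(1), unfolded infinity_ennreal_def] intro!: sum.cong)
    moreover have "ennreal (exp (- \<kappa> * s) * max 0 y + exp (\<kappa> * s) * R)
      = ennreal y * ennreal (exp (- \<kappa> * s)) + ennreal (exp (\<kappa> * s)) * ennreal R" if "0 \<le> R" for y R
      using that by (simp add: ennreal_mult q mult.commute)
    moreover have "0 \<le> (\<Sum>\<tau>\<in>UNIV. enn2real (?a \<tau> s) * enn2real (?a (\<sigma> \<noteq> \<tau>) s))"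
      by (intro sum_nonneg) simp
    ultimately show ?thesis
      unfolding p_def by (cases "s \<in> {t..}") (simp_all only: indicator_simps mult_1 mult_zero_left add_0 ennreal_0 simp_thms)
  qed
  have e: "(\<integral>\<^sup>+ s. ennreal (p \<sigma> s) \<partial>lborel) = ?a \<sigma> t" for \<sigma>
  proof -
    have [measurable]: "(\<lambda>x. if \<sigma> then Q x else - Q x) \<in> borel_measurable borel" by (cases \<sigma>) auto
    show ?thesis unfolding ps lap_amp[OF Q, of \<kappa> \<sigma> t] amp_source_def
      by (subst nn_integral_add) (auto simp: UNIV_bool)
  qed
  have i: "integrable lborel (p \<sigma>)" for \<sigma>
    using e lap_amp_finite[OF assms(1), of \<sigma> t] p0 by (intro integrableI_nonneg) auto
  have v: "(LINT s|lborel. p \<sigma> s) = enn2real (?a \<sigma> t)" for \<sigma>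
    unfolding e[symmetric] using p0 by (intro integral_eq_nn_integral) auto
  have h: "indicator {t..} s *\<^sub>R h s = p True s - p False s" for s
  proof -
    have "max 0 (Q s) - max 0 (- Q s) = Q s" by auto
    moreover have "p True s - p False s = indicator {t..} s * (exp (- \<kappa> * s) * (max 0 (Q s) - max 0 (- Q s))
      - exp (\<kappa> * s) * (enn2real (?a True s) - enn2real (?a False s))\<^sup>2)"
      unfolding p_def by (simp add: UNIV_bool power2_eq_square algebra_simps)
    ultimately show ?thesis unfolding h_def lap_diff_def by simp
  qed
  show "set_integrable lborel {t..} h" "lap_diff Q \<kappa> t = (LINT s:{t..}|lborel. h s)"
    unfolding set_integrable_def set_lebesgue_integral_def h lap_diff_def v[symmetric] using i
    by (simp_all only: Bochner_Integration.integrable_diff Bochner_Integration.integral_diff)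
qed

lemma lap_diff_increment:
  assumes "exp_bounded Q M \<kappa>" "a \<le> b"
  defines "h \<equiv> \<lambda>s. exp (- \<kappa> * s) * Q s - exp (\<kappa> * s) * (lap_diff Q \<kappa> s)\<^sup>2"
  shows "h absolutely_integrable_on {a..b}" and "lap_diff Q \<kappa> a - lap_diff Q \<kappa> b = integral {a..b} h"
proof -
  note i = lap_diff_eq[OF assms(1), folded h_def]
  have ab: "set_integrable lborel {a..b} h" "set_integrable lborel {a..<b} h"
    using i(1)[of a] by (rule set_integrable_subset; auto)+
  have "(LINT s:{a..<b} \<union> {b..}|lborel. h s) = (LINT s:{a..<b}|lborel. h s) + (LINT s:{b..}|lborel. h s)"
    by (intro set_integral_Un ab i) auto
  moreover have "{a..<b} \<union> {b..} = {a..}" using assms(2) by auto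
  moreover have "(LINT s:{a..<b}|lborel. h s) = (LINT s:{a..b}|lborel. h s)"
    using assms(2) ab(1) unfolding set_lebesgue_integral_def set_integrable_def
    by (intro integral_cong_AE borel_measurable_integrable[of lborel])
      (use AE_lborel_singleton[of b] ab in \<open>auto simp: set_integrable_def indicator_def elim!: eventually_mono\<close>)
  ultimately have "lap_diff Q \<kappa> a - lap_diff Q \<kappa> b = (LINT s:{a..b}|lborel. h s)"
    using i(2) by simp
  also have "\<dots> = integral {a..b} h"
    by (intro set_borel_integral_eq_integral ab)
  finally show "lap_diff Q \<kappa> a - lap_diff Q \<kappa> b = integral {a..b} h" .
  show "h absolutely_integrable_on {a..b}"
    using ab(1) unfolding set_integrable_def by (simp add: integrable_completion)
qed

section \<open>The amplitude determines the potential\<close>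

text \<open>
  Subtraction on \<^typ>\<open>ennreal\<close> is truncated, so differences of the two amplitudes are compared in the
  additive form \<open>a1 + b2 \<le> a2 + b1 + e\<close> of \<open>(a1 - b1) - (a2 - b2) \<le> e\<close>.
\<close>

lemma ennreal_cross_diff:
  fixes a1 b1 a2 b2 i1 j1 i2 j2 e :: ennreal
  assumes "a1 + i1 + (b2 + j2) = a2 + i2 + (b1 + j1)"
    and "i2 + j1 \<le> i1 + j2 + e"
    and "i1 + j2 < \<infinity>"
  shows "a1 + b2 \<le> a2 + b1 + e"
proof -
  have "(i1 + j2) + (a1 + b2) = (i2 + j1) + (a2 + b1)"
    using assms(1) by (simp add: add_ac)
  also have "\<dots> \<le> (i1 + j2 + e) + (a2 + b1)" using assms(2) by (rule add_right_mono)
  finally have "(i1 + j2) + (a1 + b2) \<le> (i1 + j2) + (a2 + b1 + e)" by (simp add: add_ac)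
  then show ?thesis using assms(3) by (auto simp: ennreal_add_left_cancel_le)
qed

lemma ennreal_abs_diff_le:
  fixes a1 b1 a2 b2 e :: ennreal
  assumes "a1 + b2 \<le> a2 + b1 + e" "a2 + b1 \<le> a1 + b2 + e"
    and "a1 < \<infinity>" "b1 < \<infinity>" "a2 < \<infinity>" "b2 < \<infinity>"
  shows "ennreal \<bar>(enn2real a1 - enn2real b1) - (enn2real a2 - enn2real b2)\<bar> \<le> e"
proof (cases e)
  case (real r)
  define x1 y1 x2 y2 where xy: "x1 = enn2real a1" "y1 = enn2real b1" "x2 = enn2real a2" "y2 = enn2real b2"
  have nonneg: "0 \<le> x1" "0 \<le> y1" "0 \<le> x2" "0 \<le> y2" by (simp_all add: xy)
  have eqs: "a1 = ennreal x1" "b1 = ennreal y1" "a2 = ennreal x2" "b2 = ennreal y2"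
    using assms(3-6) by (simp_all add: xy)
  have "x1 + y2 \<le> x2 + y1 + r" "x2 + y1 \<le> x1 + y2 + r"
    using assms(1,2) nonneg real unfolding eqs by (simp_all add: ennreal_plus[symmetric] del: ennreal_plus)
  then show ?thesis using nonneg real unfolding eqs by (simp add: abs_le_iff)
qed simp

definition amp_dist :: "(real \<Rightarrow> real) \<Rightarrow> (real \<Rightarrow> real) \<Rightarrow> real \<Rightarrow> real \<Rightarrow> ennreal" where
  "amp_dist Q1 Q2 t x = ennreal \<bar>amp_real Q1 t x - amp_real Q2 t x\<bar>"

definition amp_total :: "(real \<Rightarrow> real) \<Rightarrow> real \<Rightarrow> real \<Rightarrow> ennreal" where
  "amp_total Q t x = amp Q True t x + amp Q False t x"

lemma amp_dist_measurable:
  assumes "Q1 \<in> borel_measurable borel" "Q2 \<in> borel_measurable borel"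
  shows "jointly_measurable (amp_dist Q1 Q2)"
proof -
  note [measurable] = amp_measurable[OF assms(1)] amp_measurable[OF assms(2)]
  show ?thesis unfolding amp_dist_def amp_real_def by measurable
qed

lemma amp_total_measurable:
  assumes "Q \<in> borel_measurable borel" shows "jointly_measurable (amp_total Q)"
proof -
  note [measurable] = amp_measurable[OF assms(1)]
  show ?thesis unfolding amp_total_def by measurable
qed

text \<open>Read a - b as a signed amplitude, with index for the potential and prime for the second
  argument. Then this is F1 F1' - F2 F2' = (F1 - F2) F1' + F2 (F1' - F2') with absolute values on
  the right, every negative term having been moved to the other side.\<close>

lemma amp_product_diff:
  fixes a1 b1 a1' b1' a2 b2 a2' b2' :: ennreal
  assumes "a1 < \<infinity>" "b1 < \<infinity>" "a2 < \<infinity>" "b2 < \<infinity>" "a1' < \<infinity>" "b1' < \<infinity>" "a2' < \<infinity>" "b2' < \<infinity>"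
  shows "(a1 * a1' + b1 * b1') + (a2 * b2' + b2 * a2')
    \<le> (a2 * a2' + b2 * b2') + (a1 * b1' + b1 * a1')
      + (ennreal \<bar>(enn2real a1 - enn2real b1) - (enn2real a2 - enn2real b2)\<bar> * (a1' + b1')
         + (a2 + b2) * ennreal \<bar>(enn2real a1' - enn2real b1') - (enn2real a2' - enn2real b2')\<bar>)"
proof -
  have key: "(x1 * x1' + y1 * y1') + (x2 * y2' + y2 * x2')
    \<le> (x2 * x2' + y2 * y2') + (x1 * y1' + y1 * x1')
      + (\<bar>(x1 - y1) - (x2 - y2)\<bar> * (x1' + y1') + (x2 + y2) * \<bar>(x1' - y1') - (x2' - y2')\<bar>)"
    if "0 \<le> x1" "0 \<le> y1" "0 \<le> x2" "0 \<le> y2" "0 \<le> x1'" "0 \<le> y1'" "0 \<le> x2'" "0 \<le> y2'"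
    for x1 y1 x2 y2 x1' y1' x2' y2' :: real
  proof -
    have "(x1 - y1) * (x1' - y1') - (x2 - y2) * (x2' - y2')
      = ((x1 - y1) - (x2 - y2)) * (x1' - y1') + (x2 - y2) * ((x1' - y1') - (x2' - y2'))"
      by (simp add: algebra_simps)
    also have "\<dots> \<le> \<bar>((x1 - y1) - (x2 - y2)) * (x1' - y1')\<bar> + \<bar>(x2 - y2) * ((x1' - y1') - (x2' - y2'))\<bar>"
      by linarith
    also have "\<dots> \<le> \<bar>(x1 - y1) - (x2 - y2)\<bar> * (x1' + y1') + (x2 + y2) * \<bar>(x1' - y1') - (x2' - y2')\<bar>"
      unfolding abs_mult using that by (intro add_mono mult_mono) auto
    finally show ?thesis by (simp add: algebra_simps)
  qed
  define x1 y1 x2 y2 x1' y1' x2' y2' where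
    xy: "x1 = enn2real a1" "y1 = enn2real b1" "x2 = enn2real a2" "y2 = enn2real b2"
      "x1' = enn2real a1'" "y1' = enn2real b1'" "x2' = enn2real a2'" "y2' = enn2real b2'"
  have nonneg: "0 \<le> x1" "0 \<le> y1" "0 \<le> x2" "0 \<le> y2" "0 \<le> x1'" "0 \<le> y1'" "0 \<le> x2'" "0 \<le> y2'"
    by (simp_all add: xy)
  have eqs: "a1 = ennreal x1" "b1 = ennreal y1" "a2 = ennreal x2" "b2 = ennreal y2"
    "a1' = ennreal x1'" "b1' = ennreal y1'" "a2' = ennreal x2'" "b2' = ennreal y2'"
    using assms by (simp_all add: xy)
  show ?thesis
    using ennreal_leI[OF key[OF nonneg]] nonneg unfolding eqs by (simp add: ennreal_mult)
qed

lemma conv_amp_diff: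
  assumes "exp_bounded Q1 M c" "exp_bounded Q2 M c" "S \<in> sets borel"
  shows "(\<Sum>\<tau>\<in>UNIV. conv S (amp Q1 \<tau>) (amp Q1 (False \<noteq> \<tau>)) x) + (\<Sum>\<tau>\<in>UNIV. conv S (amp Q2 \<tau>) (amp Q2 (True \<noteq> \<tau>)) x)
   \<le> (\<Sum>\<tau>\<in>UNIV. conv S (amp Q2 \<tau>) (amp Q2 (False \<noteq> \<tau>)) x) + (\<Sum>\<tau>\<in>UNIV. conv S (amp Q1 \<tau>) (amp Q1 (True \<noteq> \<tau>)) x)
     + (conv S (amp_dist Q1 Q2) (amp_total Q1) x + conv S (amp_total Q2) (amp_dist Q1 Q2) x)"
proof -
  note Q = exp_boundedD(4)[OF assms(1)] exp_boundedD(4)[OF assms(2)]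
  note [measurable] = jointly_measurable_comp[OF amp_measurable[OF Q(1)]] jointly_measurable_comp[OF amp_measurable[OF Q(2)]]
    jointly_measurable_comp[OF amp_dist_measurable[OF Q]] jointly_measurable_comp[OF amp_total_measurable[OF Q(1)]] jointly_measurable_comp[OF amp_total_measurable[OF Q(2)]]
    assms(3)
  define I where "I f = (\<integral>\<^sup>+ s. indicator S s * (\<integral>\<^sup>+ y. f s y \<partial>lborel) \<partial>lborel)" for f :: "real \<Rightarrow> real \<Rightarrow> ennreal"
  let ?f1 = "\<lambda>s y. amp Q1 True s y" let ?g1 = "\<lambda>s y. amp Q1 False s y"
  let ?f2 = "\<lambda>s y. amp Q2 True s y" let ?g2 = "\<lambda>s y. amp Q2 False s y"
  have fin: "AE y in lborel. amp Q \<sigma> s y < \<infinity> \<and> amp Q \<sigma> s (x + s - y) < \<infinity>"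
    if b: "exp_bounded Q M c" for Q \<sigma> s
  proof -
    note [measurable] = jointly_measurable_comp[OF amp_measurable[OF exp_boundedD(4)[OF b]]]
    \<comment> \<open>The second factor is evaluated at the reflected point x + s - y; affine
      reflections preserve null sets.\<close>
    have "AE y in lborel. amp Q \<sigma> s ((x + s) + (-1) * y) < \<infinity>"
      by (rule AE_borel_affine[OF _ _ amp_AE_finite[OF b]]) auto
    with amp_AE_finite[OF b, of \<sigma> s] show ?thesis by eventually_elim simp
  qed
  have "(\<Sum>\<tau>\<in>UNIV. conv S (amp Q1 \<tau>) (amp Q1 (False \<noteq> \<tau>)) x) + (\<Sum>\<tau>\<in>UNIV. conv S (amp Q2 \<tau>) (amp Q2 (True \<noteq> \<tau>)) x)
    = I (\<lambda>s y. (?f1 s y * ?f1 s (x+s-y) + ?g1 s y * ?g1 s (x+s-y)) + (?f2 s y * ?g2 s (x+s-y) + ?g2 s y * ?f2 s (x+s-y)))"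
    unfolding I_def conv_def UNIV_bool by (simp add: nn_integral_add distrib_left add_ac)
  also have "\<dots> \<le> I (\<lambda>s y. (?f2 s y * ?f2 s (x+s-y) + ?g2 s y * ?g2 s (x+s-y)) + (?f1 s y * ?g1 s (x+s-y) + ?g1 s y * ?f1 s (x+s-y))
      + (amp_dist Q1 Q2 s y * amp_total Q1 s (x+s-y) + amp_total Q2 s y * amp_dist Q1 Q2 s (x+s-y)))"
    unfolding I_def
  proof (rule nn_integral_mono, rule mult_left_mono, rule nn_integral_mono_AE)
    fix s
    show "AE y in lborel. (?f1 s y * ?f1 s (x+s-y) + ?g1 s y * ?g1 s (x+s-y)) + (?f2 s y * ?g2 s (x+s-y) + ?g2 s y * ?f2 s (x+s-y))
      \<le> (?f2 s y * ?f2 s (x+s-y) + ?g2 s y * ?g2 s (x+s-y)) + (?f1 s y * ?g1 s (x+s-y) + ?g1 s y * ?f1 s (x+s-y))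
      + (amp_dist Q1 Q2 s y * amp_total Q1 s (x+s-y) + amp_total Q2 s y * amp_dist Q1 Q2 s (x+s-y))"
      using fin[OF assms(1), of True s] fin[OF assms(1), of False s] fin[OF assms(2), of True s] fin[OF assms(2), of False s]
    proof eventually_elim
      case (elim y)
      then show ?case unfolding amp_dist_def amp_total_def amp_real_def
        by (intro amp_product_diff) auto
    qed
  qed simp
  also have "\<dots> = (\<Sum>\<tau>\<in>UNIV. conv S (amp Q2 \<tau>) (amp Q2 (False \<noteq> \<tau>)) x) + (\<Sum>\<tau>\<in>UNIV. conv S (amp Q1 \<tau>) (amp Q1 (True \<noteq> \<tau>)) x)
     + (conv S (amp_dist Q1 Q2) (amp_total Q1) x + conv S (amp_total Q2) (amp_dist Q1 Q2) x)"
    unfolding I_def conv_def UNIV_bool by (simp add: nn_integral_add distrib_left add_ac)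
  finally show ?thesis .
qed

lemma exp_convolution_le:
  fixes l t :: real assumes "0 < l"
  shows "(\<integral>\<^sup>+ s. indicator {0..<t} s * ennreal (exp (l * (s - t))) \<partial>lborel) \<le> ennreal (1 / l)"
proof -
  have "(\<integral>\<^sup>+ s. indicator {0..<t} s * ennreal (exp (l * (s - t))) \<partial>lborel)
    = (\<integral>\<^sup>+ u. indicator {0..<t} (t - u) * ennreal (exp (l * (t - u - t))) \<partial>lborel)"
    using nn_integral_real_affine[of "\<lambda>s. indicator {0..<t} s * ennreal (exp (l * (s - t)))" "-1" t] by simp
  also have "\<dots> \<le> (\<integral>\<^sup>+ u. ennreal (1 / l) * (ennreal (l * exp (- l * u)) * indicator {0..} u) \<partial>lborel)"
    using assms by (intro nn_integral_mono) (auto simp: indicator_def ennreal_mult[symmetric])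
  also have "\<dots> = ennreal (1 / l) * ennreal (exp (- l * 0))"
    by (subst nn_integral_cmult) (simp_all add: nn_integral_exp_tail[OF assms, unfolded mult_minus_left])
  finally show ?thesis by simp
qed

text \<open>In the supremum norm weighted by exp (-l t) the integral operator has norm at most L /
  l, and l = 2 L + 1 makes this at most 1/2. The bound \<open>K\<close> ensures that the weighted
  supremum S is finite, so S <= S / 2 forces S = 0.\<close>

lemma gronwall_zero:
  fixes Z :: "real \<Rightarrow> ennreal"
  assumes [measurable]: "Z \<in> borel_measurable borel"
    and K: "\<And>t. 0 \<le> t \<Longrightarrow> Z t \<le> ennreal K" and L: "0 \<le> L"
    and step: "\<And>t. 0 \<le> t \<Longrightarrow> Z t \<le> ennreal L * (\<integral>\<^sup>+ s. indicator {0..<t} s * Z s \<partial>lborel)"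
    and t: "0 \<le> t"
  shows "Z t = 0"
proof -
  define l where "l = 2 * L + 1"
  have l: "0 < l" "L / l \<le> 1/2" using L by (simp_all add: l_def field_simps)
  define S where "S = (SUP t\<in>{0..}. Z t * ennreal (exp (- l * t)))"
  have up: "Z s * ennreal (exp (- l * s)) \<le> S" if "0 \<le> s" for s
    unfolding S_def using that by (intro SUP_upper) simp
  have "S \<le> ennreal K"
    unfolding S_def
  proof (rule SUP_least)
    fix s :: real assume "s \<in> {0..}"
    then have "exp (- l * s) \<le> 1" using l by simp
    then have "Z s * ennreal (exp (- l * s)) \<le> ennreal K * 1"
      using \<open>s \<in> {0..}\<close> by (intro mult_mono K) auto
    then show "Z s * ennreal (exp (- l * s)) \<le> ennreal K" by simp
  qed
  then have fin: "S < \<infinity>" by (simp add: le_less_trans)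
  have "S \<le> ennreal (1/2) * S"
    unfolding S_def
  proof (rule SUP_least, fold S_def)
    fix t :: real assume t: "t \<in> {0..}"
    have Zs: "Z s \<le> S * ennreal (exp (l * s))" if "0 \<le> s" for s
    proof -
      have "Z s = Z s * ennreal (exp (- l * s)) * ennreal (exp (l * s))"
        by (simp add: mult.assoc ennreal_mult[symmetric] exp_add[symmetric])
      also have "\<dots> \<le> S * ennreal (exp (l * s))" by (intro mult_right_mono up that) simp
      finally show ?thesis .
    qed
    have "Z t * ennreal (exp (- l * t)) \<le> ennreal L * (\<integral>\<^sup>+ s. indicator {0..<t} s * Z s \<partial>lborel) * ennreal (exp (- l * t))"
      using t by (intro mult_right_mono step) auto
    also have "\<dots> \<le> ennreal L * (\<integral>\<^sup>+ s. indicator {0..<t} s * (S * ennreal (exp (l * s))) \<partial>lborel) * ennreal (exp (- l * t))"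
      by (rule mult_right_mono, rule mult_left_mono, rule nn_integral_mono) (auto simp: indicator_def Zs)
    also have "\<dots> = ennreal L * S * (\<integral>\<^sup>+ s. indicator {0..<t} s * ennreal (exp (l * (s - t))) \<partial>lborel)"
    proof -
      have "(\<integral>\<^sup>+ s. indicator {0..<t} s * (S * ennreal (exp (l * s))) \<partial>lborel) * ennreal (exp (- l * t))
        = (\<integral>\<^sup>+ s. S * (indicator {0..<t} s * ennreal (exp (l * (s - t)))) \<partial>lborel)"
        by (subst nn_integral_multc[symmetric], simp, rule nn_integral_cong)
          (simp add: ennreal_mult mult_ac right_diff_distrib exp_diff exp_minus divide_inverse)
      also have "\<dots> = S * (\<integral>\<^sup>+ s. indicator {0..<t} s * ennreal (exp (l * (s - t))) \<partial>lborel)"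
        by (rule nn_integral_cmult) measurable
      finally show ?thesis by (simp add: mult.assoc)
    qed
    also have "\<dots> \<le> ennreal L * S * ennreal (1 / l)"
      by (intro mult_left_mono exp_convolution_le l) simp
    also have "\<dots> = ennreal (L / l) * S"
      using L l ennreal_mult[of L "1 / l"] by (simp add: mult_ac)
    also have "\<dots> \<le> ennreal (1/2) * S"
      by (intro mult_right_mono ennreal_leI l) simp
    finally show "Z t * ennreal (exp (- l * t)) \<le> ennreal (1/2) * S" .
  qed
  with fin have "S = 0"
  proof (cases S)
    case (real r)
    have "ennreal r \<le> ennreal (1/2 * r)"
      using \<open>S \<le> ennreal (1/2) * S\<close> real by (subst ennreal_mult) auto
    then have "r \<le> 1/2 * r" using real by (subst (asm) ennreal_le_iff) auto
    then show ?thesis using real by simp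
  qed simp
  with up[OF t] show ?thesis by simp
qed

section \<open>Comparison of two amplitudes up to the point T\<close>

context
  fixes Q1 Q2 :: "real \<Rightarrow> real" and M c T :: real
  assumes b1: "exp_bounded Q1 M c" and b2: "exp_bounded Q2 M c"
begin

private lemmas meas = exp_boundedD(4)[OF b1] exp_boundedD(4)[OF b2]

private definition D :: "real \<Rightarrow> real \<Rightarrow> ennreal" where "D = amp_dist Q1 Q2"
text \<open>A common majorant of both amplitudes, so that the error estimate is symmetric under
  exchanging the two potentials.\<close>

private definition B :: "real \<Rightarrow> real \<Rightarrow> ennreal" where "B t x = amp_total Q1 t x + amp_total Q2 t x"
text \<open>The data agree only for x < T. By causality the error terms at such x involve the
  distance only below T, so the truncated distance satisfies a closed inequality.\<close>

private definition DT :: "real \<Rightarrow> real \<Rightarrow> ennreal" where "DT t x = D t x * indicator {..<T} x"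

private lemma D_meas: "jointly_measurable D" unfolding D_def by (rule amp_dist_measurable[OF meas])
private lemma DT_meas: "jointly_measurable DT"
proof -
  note [measurable] = jointly_measurable_comp[OF D_meas]
  show ?thesis unfolding DT_def by measurable
qed
private lemma B_meas: "jointly_measurable B"
proof -
  note [measurable] = jointly_measurable_comp[OF amp_total_measurable[OF meas(1)]] jointly_measurable_comp[OF amp_total_measurable[OF meas(2)]]
  show ?thesis unfolding B_def by measurable
qed

private lemma D_support: "x < t \<Longrightarrow> D t x = 0" by (simp add: D_def amp_dist_def amp_real_support)
private lemma B_support: "x < t \<Longrightarrow> B t x = 0" by (simp add: B_def amp_total_def amp_support)

private lemma D_le_B: "D t x \<le> B t x"
proof (cases "B t x = \<infinity>")
  case False
  then have f: "amp Q1 True t x < \<infinity>" "amp Q1 False t x < \<infinity>" "amp Q2 True t x < \<infinity>" "amp Q2 False t x < \<infinity>"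
    by (auto simp: B_def amp_total_def less_top)
  have "D t x \<le> ennreal (enn2real (amp Q1 True t x) + enn2real (amp Q1 False t x)
      + (enn2real (amp Q2 True t x) + enn2real (amp Q2 False t x)))"
    unfolding D_def amp_dist_def amp_real_def
    by (intro ennreal_leI) (smt (verit) enn2real_nonneg)
  also have "\<dots> = B t x" using f by (simp add: B_def amp_total_def)
  finally show ?thesis .
qed simp

private lemma lap_B: "lap c B s \<le> ennreal (4 * M * exp (- c * s))"
proof -
  have "lap c B s = (lap c (amp Q1 True) s + lap c (amp Q1 False) s) + (lap c (amp Q2 True) s + lap c (amp Q2 False) s)"
    using lap_add[OF amp_total_measurable[OF meas(1)] amp_total_measurable[OF meas(2)], of s c]
      lap_add[OF amp_measurable[OF meas(1), of True] amp_measurable[OF meas(1), of False], of s c]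
      lap_add[OF amp_measurable[OF meas(2), of True] amp_measurable[OF meas(2), of False], of s c]
    unfolding lap_def B_def amp_total_def by simp
  also have "\<dots> \<le> ennreal (2 * M * exp (- c * s)) + ennreal (2 * M * exp (- c * s))"
    by (intro add_mono lap_amp_bound b1 b2)
  also have "\<dots> = ennreal (4 * M * exp (- c * s))"
    using exp_boundedD(1)[OF b1] by (simp add: ennreal_plus[symmetric] del: ennreal_plus)
  finally show ?thesis .
qed

private lemma conv_B:
  assumes "S \<in> sets borel"
  shows "conv S D (amp_total Q1) x + conv S (amp_total Q2) D x \<le> conv S D B x + conv S B D x"
    and "conv S D (amp_total Q2) x + conv S (amp_total Q1) D x \<le> conv S D B x + conv S B D x"
  by (intro add_mono conv_mono; simp add: B_def)+

text \<open>The terms \<open>a1\<close>, \<open>a2\<close> stand for whatever remains of the equal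
  amplitudes at time 0 after removing the quadratic term over \<open>S\<close>. The lemma is used
  twice: with \<open>{0..<t}\<close>, where the remainder is the amplitude at time t, and with
  \<open>{0..}\<close>, where it is the potential itself.\<close>

private lemma source_dist:
  assumes S: "S \<in> sets borel"
    and fin: "\<And>\<sigma>. amp Q1 \<sigma> 0 x < \<infinity>" "\<And>\<sigma>. amp Q2 \<sigma> 0 x < \<infinity>"
    and eq: "amp_real Q1 0 x = amp_real Q2 0 x"
    and a1: "\<And>\<sigma>. amp Q1 \<sigma> 0 x = a1 \<sigma> + (\<Sum>\<tau>\<in>UNIV. conv S (amp Q1 \<tau>) (amp Q1 (\<sigma> \<noteq> \<tau>)) x)"
    and a2: "\<And>\<sigma>. amp Q2 \<sigma> 0 x = a2 \<sigma> + (\<Sum>\<tau>\<in>UNIV. conv S (amp Q2 \<tau>) (amp Q2 (\<sigma> \<noteq> \<tau>)) x)"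
  shows "ennreal \<bar>(enn2real (a1 True) - enn2real (a1 False)) - (enn2real (a2 True) - enn2real (a2 False))\<bar>
    \<le> conv S D B x + conv S B D x"
proof (rule ennreal_abs_diff_le)
  define i1 i2 where "i1 \<sigma> = (\<Sum>\<tau>\<in>UNIV. conv S (amp Q1 \<tau>) (amp Q1 (\<sigma> \<noteq> \<tau>)) x)"
    and "i2 \<sigma> = (\<Sum>\<tau>\<in>UNIV. conv S (amp Q2 \<tau>) (amp Q2 (\<sigma> \<noteq> \<tau>)) x)" for \<sigma>
  note a = a1[folded i1_def] a2[folded i2_def]
  have f: "a1 \<sigma> < \<infinity>" "i1 \<sigma> < \<infinity>" "a2 \<sigma> < \<infinity>" "i2 \<sigma> < \<infinity>" for \<sigma>
    using fin[of \<sigma>] unfolding a by (auto simp: less_top[symmetric])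
  show "a1 True < \<infinity>" "a1 False < \<infinity>" "a2 True < \<infinity>" "a2 False < \<infinity>" by (rule f)+
  have swap: "amp_dist Q2 Q1 = D" by (intro ext) (simp add: D_def amp_dist_def abs_minus_commute)
  have "enn2real (amp Q1 True 0 x) + enn2real (amp Q2 False 0 x) = enn2real (amp Q2 True 0 x) + enn2real (amp Q1 False 0 x)"
    using eq by (simp add: amp_real_def)
  then have "ennreal (enn2real (amp Q1 True 0 x) + enn2real (amp Q2 False 0 x)) = ennreal (enn2real (amp Q2 True 0 x) + enn2real (amp Q1 False 0 x))"
    by simp
  then have e: "amp Q1 True 0 x + amp Q2 False 0 x = amp Q2 True 0 x + amp Q1 False 0 x"
    using fin by simp
  have "i2 True + i1 False \<le> i1 True + i2 False + (conv S D B x + conv S B D x)"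
    using conv_amp_diff[OF b1 b2 S, of x] conv_B(1)[OF S, of x]
    unfolding i1_def[symmetric] i2_def[symmetric] D_def[symmetric]
    by (metis (no_types, lifting) add.commute add_left_mono order_trans)
  then show "a1 True + a2 False \<le> a2 True + a1 False + (conv S D B x + conv S B D x)"
    by (rule ennreal_cross_diff[OF e[unfolded a]]) (use f in auto)
  have "i1 True + i2 False \<le> i2 True + i1 False + (conv S D B x + conv S B D x)"
    using conv_amp_diff[OF b2 b1 S, of x] conv_B(2)[OF S, of x]
    unfolding i1_def[symmetric] i2_def[symmetric] swap
    by (metis (no_types, lifting) add.commute add_left_mono order_trans)
  then show "a2 True + a1 False \<le> a1 True + a2 False + (conv S D B x + conv S B D x)"
    by (rule ennreal_cross_diff[OF e[symmetric, unfolded a]]) (use f in auto)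
qed

text \<open>For x < T the support of \<open>B\<close> confines the argument of \<open>D\<close> to
  values below T, so \<open>D\<close> may be truncated. In the Laplace transform the factor exp (c
  s) cancels the decay of \<open>lap c B\<close>, leaving 4 M for each of the two
  convolutions.\<close>

private lemma lap_error:
  assumes S: "S \<in> sets borel"
  shows "(\<integral>\<^sup>+ x. indicator {..<T} x * (conv S D B x + conv S B D x) * ennreal (exp (- c * x)) \<partial>lborel)
    \<le> ennreal (8 * M) * (\<integral>\<^sup>+ s. indicator S s * lap c DT s \<partial>lborel)"
proof -
  note [measurable] = S conv_measurable1[OF DT_meas B_meas S] conv_measurable1[OF B_meas DT_meas S]
    lap_measurable[OF DT_meas] lap_measurable[OF B_meas]
  have 1: "D s y * B s (x + s - y) \<le> DT s y * B s (x + s - y)" if "x < T" for s x y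
    using that by (cases "y \<le> x") (auto simp: DT_def B_support)
  have 2: "B s y * D s (x + s - y) \<le> B s y * DT s (x + s - y)" if "x < T" for s x y
    using that by (cases "s \<le> y") (auto simp: DT_def B_support)
  have "(\<integral>\<^sup>+ x. indicator {..<T} x * (conv S D B x + conv S B D x) * ennreal (exp (- c * x)) \<partial>lborel)
    \<le> (\<integral>\<^sup>+ x. conv S DT B x * ennreal (exp (- c * x)) + conv S B DT x * ennreal (exp (- c * x)) \<partial>lborel)"
  proof (rule nn_integral_mono)
    fix x
    have "conv S D B x \<le> conv S DT B x" "conv S B D x \<le> conv S B DT x" if "x < T"
      unfolding conv_def
      by (rule nn_integral_mono, rule mult_left_mono, rule nn_integral_mono, rule 1 2, rule that, simp)+
    then show "indicator {..<T} x * (conv S D B x + conv S B D x) * ennreal (exp (- c * x))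
      \<le> conv S DT B x * ennreal (exp (- c * x)) + conv S B DT x * ennreal (exp (- c * x))"
      unfolding distrib_right[symmetric]
      by (cases "x < T") (auto intro!: mult_right_mono add_mono)
  qed
  also have "\<dots> = (\<integral>\<^sup>+ s. indicator S s * ennreal (exp (c * s)) * lap c DT s * lap c B s \<partial>lborel)
      + (\<integral>\<^sup>+ s. indicator S s * ennreal (exp (c * s)) * lap c B s * lap c DT s \<partial>lborel)"
    by (simp add: nn_integral_add lap_conv[OF DT_meas B_meas S, unfolded mult_minus_left] lap_conv[OF B_meas DT_meas S, unfolded mult_minus_left])
  also have "\<dots> = (\<integral>\<^sup>+ s. 2 * (indicator S s * ennreal (exp (c * s)) * lap c DT s * lap c B s) \<partial>lborel)"
    by (subst nn_integral_cmult) (simp_all add: mult_2 mult_ac)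
  also have "\<dots> \<le> (\<integral>\<^sup>+ s. ennreal (8 * M) * (indicator S s * lap c DT s) \<partial>lborel)"
  proof (rule nn_integral_mono)
    fix s
    have "2 * (indicator S s * ennreal (exp (c * s)) * lap c DT s * lap c B s)
      \<le> 2 * (indicator S s * ennreal (exp (c * s)) * lap c DT s * ennreal (4 * M * exp (- c * s)))"
      by (intro mult_left_mono lap_B) auto
    also have "\<dots> = (2 * (ennreal (exp (c * s)) * ennreal (4 * M * exp (- c * s)))) * (indicator S s * lap c DT s)"
      by (simp add: mult_ac)
    also have "2 * (ennreal (exp (c * s)) * ennreal (4 * M * exp (- c * s))) = ennreal (8 * M)"
    proof -
      have "2 * (exp (c * s) * (4 * M * exp (- c * s))) = 8 * M" by (simp add: exp_minus field_simps)
      then show ?thesis using exp_boundedD(1)[OF b1]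
        by (metis ennreal_mult' ennreal_numeral exp_ge_zero zero_le_numeral)
    qed
    finally show "2 * (indicator S s * ennreal (exp (c * s)) * lap c DT s * lap c B s)
      \<le> ennreal (8 * M) * (indicator S s * lap c DT s)" .
  qed
  also have "\<dots> = ennreal (8 * M) * (\<integral>\<^sup>+ s. indicator S s * lap c DT s \<partial>lborel)"
    by (rule nn_integral_cmult) measurable
  finally show ?thesis .
qed

lemma amp_determines_potential:
  assumes eq: "AE x in lborel. 0 < x \<and> x < T \<longrightarrow> amp_real Q1 0 x = amp_real Q2 0 x"
  shows "AE x in lborel. 0 < x \<and> x < T \<longrightarrow> Q1 x = Q2 x"
proof -
  have M: "0 \<le> M" and c: "0 < c" using exp_boundedD[OF b1] by auto
  have [measurable]: "Q1 \<in> borel_measurable borel" "Q2 \<in> borel_measurable borel" by (rule meas)+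
  have fin: "AE x in lborel. (\<forall>\<sigma>. amp Q1 \<sigma> 0 x < \<infinity>) \<and> (\<forall>\<sigma>. amp Q2 \<sigma> 0 x < \<infinity>)"
    using amp_AE_finite[OF b1, of True 0] amp_AE_finite[OF b1, of False 0] amp_AE_finite[OF b2, of True 0] amp_AE_finite[OF b2, of False 0]
    by eventually_elim (metis (full_types))
  \<comment> \<open>For t = 0 the range t <= x contains x = 0, where equality of the amplitudes is
    not assumed.\<close>
  have nz: "AE x in lborel. x \<noteq> (0::real)" by (rule AE_lborel_singleton)
  have split: "conv {0..} G H x = conv {t..} G H x + conv {0..<t} G H x" if "0 \<le> t" "jointly_measurable G" "jointly_measurable H" for t G H x
  proof -
    note [measurable] = jointly_measurable_comp[OF that(2)] jointly_measurable_comp[OF that(3)]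
    show ?thesis unfolding conv_def using that(1)
      by (subst nn_integral_add[symmetric]) (auto intro!: nn_integral_cong simp: indicator_def)
  qed
  \<comment> \<open>For t <= x the source terms of the equations at times 0 and t are both Q(x), so
    the difference contains only the times in between.\<close>
  have amp_split: "amp Q \<sigma> 0 x = amp Q \<sigma> t x + (\<Sum>\<tau>\<in>UNIV. conv {0..<t} (amp Q \<tau>) (amp Q (\<sigma> \<noteq> \<tau>)) x)"
    if "0 \<le> t" "t \<le> x" "exp_bounded Q M c" for Q \<sigma> t x
  proof -
    note Q = exp_boundedD(4)[OF that(3)]
    show ?thesis
      unfolding amp_eq[OF Q, of \<sigma> 0 x] amp_eq[OF Q, of \<sigma> t x] split[OF that(1) amp_measurable[OF Q] amp_measurable[OF Q]]
      using that(1,2) by (simp add: sum.distrib add.assoc)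
  qed
  have Z0: "lap c DT t = 0" if "0 \<le> t" for t
  proof (rule gronwall_zero[OF lap_measurable[OF DT_meas] _ _ _ that, where K="4 * M" and L="8 * M"])
    show "lap c DT t \<le> ennreal (4 * M)" if "0 \<le> t" for t
    proof -
      have "lap c DT t \<le> lap c B t"
        unfolding lap_def DT_def using D_le_B
        by (intro nn_integral_mono mult_right_mono) (auto simp: indicator_def)
      also have "\<dots> \<le> ennreal (4 * M * exp (- c * t))" by (rule lap_B)
      also have "\<dots> \<le> ennreal (4 * M)" using M c that by (intro ennreal_leI) (auto intro!: mult_left_le)
      finally show ?thesis .
    qed
    show "lap c DT t \<le> ennreal (8 * M) * (\<integral>\<^sup>+ s. indicator {0..<t} s * lap c DT s \<partial>lborel)" if t: "0 \<le> t" for t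
    proof -
      have "lap c DT t \<le> (\<integral>\<^sup>+ x. indicator {..<T} x * (conv {0..<t} D B x + conv {0..<t} B D x) * ennreal (exp (- c * x)) \<partial>lborel)"
        unfolding lap_def
      proof (rule nn_integral_mono_AE)
        show "AE x in lborel. DT t x * ennreal (exp (- c * x)) \<le> indicator {..<T} x * (conv {0..<t} D B x + conv {0..<t} B D x) * ennreal (exp (- c * x))"
          using eq fin nz
        proof eventually_elim
          case (elim x)
          have "DT t x \<le> indicator {..<T} x * (conv {0..<t} D B x + conv {0..<t} B D x)"
          proof (cases "t \<le> x \<and> x < T")
            case True
            then have "amp_real Q1 0 x = amp_real Q2 0 x" using elim t by auto
            moreover have "DT t x = ennreal \<bar>(enn2real (amp Q1 True t x) - enn2real (amp Q1 False t x)) - (enn2real (amp Q2 True t x) - enn2real (amp Q2 False t x))\<bar>"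
              using True by (simp add: DT_def D_def amp_dist_def amp_real_def)
            ultimately show ?thesis
              using source_dist[of "{0..<t}" x "\<lambda>\<sigma>. amp Q1 \<sigma> t x" "\<lambda>\<sigma>. amp Q2 \<sigma> t x"] elim True t amp_split[of t x, OF _ _ b1] amp_split[of t x, OF _ _ b2]
              by auto
          next
            case False
            then show ?thesis by (auto simp: DT_def D_support)
          qed
          then show ?case by (rule mult_right_mono) simp
        qed
      qed
      also have "\<dots> \<le> ennreal (8 * M) * (\<integral>\<^sup>+ s. indicator {0..<t} s * lap c DT s \<partial>lborel)"
        by (rule lap_error) simp
      finally show ?thesis .
    qed
  qed (use M in auto)
  note [measurable] = conv_measurable1[OF D_meas B_meas] conv_measurable1[OF B_meas D_meas]
  \<comment> \<open>The truncated distance now vanishes in transform at every time s >= 0, so the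
    whole quadratic discrepancy is zero for almost every x < T.\<close>
  have "(\<integral>\<^sup>+ x. indicator {..<T} x * (conv {0..} D B x + conv {0..} B D x) * ennreal (exp (- c * x)) \<partial>lborel) \<le> 0"
  proof -
    have "(\<lambda>s. indicator {0..} s * lap c DT s) = (\<lambda>_. 0)" using Z0 by (auto simp: indicator_def)
    then show ?thesis using lap_error[of "{0..}"] by (simp del: mult_minus_left)
  qed
  then have "AE x in lborel. indicator {..<T} x * (conv {0..} D B x + conv {0..} B D x) * ennreal (exp (- c * x)) = 0"
    by (subst (asm) le_zero_eq, subst (asm) nn_integral_0_iff_AE) auto
  with eq fin show ?thesis
  proof eventually_elim
    case (elim x)
    show ?case
    proof
      assume x: "0 < x \<and> x < T"
      have r: "enn2real (ennreal q) - enn2real (ennreal (- q)) = q" for q :: real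
        by (cases "0 \<le> q") (auto simp: ennreal_neg)
      have "ennreal \<bar>Q1 x - Q2 x\<bar> \<le> conv {0..} D B x + conv {0..} B D x"
        using source_dist[of "{0..}" x "\<lambda>\<sigma>. ennreal (if \<sigma> then Q1 x else - Q1 x)" "\<lambda>\<sigma>. ennreal (if \<sigma> then Q2 x else - Q2 x)"]
          elim x amp_eq[OF meas(1), of _ 0 x] amp_eq[OF meas(2), of _ 0 x]
        by (simp add: r)
      moreover have "conv {0..} D B x + conv {0..} B D x = 0" using elim(3) x by simp
      ultimately show "Q1 x = Q2 x" by simp
    qed
  qed
qed

end

section \<open>The radial equation\<close>

lemma has_ae_deriv_continuous_on:
  assumes "has_ae_deriv f g" "0 < a" "b \<le> 1"
  shows "continuous_on {a..b} f"
proof (cases "a \<le> b")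
  case True
  have i: "g absolutely_integrable_on {a..b}" and v: "f t - f a = integral {a..t} g" if "t \<in> {a..b}" for t
    using assms that True by (simp_all add: has_ae_deriv_def)
  have c: "continuous_on {a..b} (\<lambda>t. f a + integral {a..t} g)"
    using i[of a] True set_lebesgue_integral_eq_integral(1)
    by (intro continuous_intros indefinite_integral_continuous_1) (auto simp: absolutely_integrable_on_def)
  show ?thesis
  proof (rule continuous_on_eq[OF c])
    show "f a + integral {a..t} g = f t" if "t \<in> {a..b}" for t using v[OF that] by linarith
  qed
qed simp

lemma absolutely_integrable_continuous_mult:
  fixes h f :: "real \<Rightarrow> real"
  assumes "continuous_on {a..b} h" "f absolutely_integrable_on {a..b}"
  shows "(\<lambda>x. h x * f x) absolutely_integrable_on {a..b}"
proof (rule absolutely_integrable_bounded_measurable_product_real)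
  show "h \<in> borel_measurable (lebesgue_on {a..b})"
    by (rule continuous_imp_measurable_on_sets_lebesgue[OF assms(1)]) simp
  show "bounded (h ` {a..b})"
    by (intro compact_imp_bounded compact_continuous_image assms compact_Icc)
qed (use assms in auto)

text \<open>Cutting an interval into pieces of length at most \<delta> and adding up loses nothing,
  because \<open>m\<close> is additive over adjacent intervals.\<close>

lemma additive_bound_by_local:
  fixes G :: "real \<Rightarrow> real" and m :: "real \<Rightarrow> real \<Rightarrow> real"
  assumes "0 < \<delta>"
    and loc: "\<And>x y. a \<le> x \<Longrightarrow> x \<le> y \<Longrightarrow> y \<le> b \<Longrightarrow> y - x \<le> \<delta> \<Longrightarrow> \<bar>G y - G x\<bar> \<le> m x y"
    and add: "\<And>x y z. a \<le> x \<Longrightarrow> x \<le> y \<Longrightarrow> y \<le> z \<Longrightarrow> z \<le> b \<Longrightarrow> m x y + m y z = m x z"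
    and xy: "a \<le> x" "x \<le> y" "y \<le> b"
  shows "\<bar>G y - G x\<bar> \<le> m x y"
proof -
  have ind: "y \<le> b \<Longrightarrow> x \<le> y \<Longrightarrow> y - x \<le> real n * \<delta> \<Longrightarrow> \<bar>G y - G x\<bar> \<le> m x y" for n y
  proof (induction n arbitrary: y)
    case 0
    then show ?case using loc[of x y] xy assms(1) by auto
  next
    case (Suc n)
    define z where "z = max x (y - \<delta>)"
    have z: "x \<le> z" "z \<le> y" "y - z \<le> \<delta>" "z - x \<le> real n * \<delta>"
      using Suc.prems assms(1) by (auto simp: z_def max_def algebra_simps)
    have "\<bar>G z - G x\<bar> \<le> m x z" using Suc.IH[of z] z Suc.prems by auto
    moreover have "\<bar>G y - G z\<bar> \<le> m z y" using loc[of z y] z Suc.prems xy by auto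
    moreover have "m x z + m z y = m x y" using add[of x z y] z Suc.prems xy by auto
    ultimately show ?case by linarith
  qed
  obtain n where "(y - x) / \<delta> \<le> real n" using real_arch_simple by blast
  then show ?thesis using ind[of y n] xy assms(1) by (simp add: divide_le_eq)
qed

lemma zero_if_le_epsilon_mult:
  fixes a C :: real
  assumes "\<And>e. 0 < e \<Longrightarrow> \<bar>a\<bar> \<le> e * C" "0 \<le> C"
  shows "a = 0"
proof -
  have "\<bar>a\<bar> \<le> 0"
  proof (rule field_le_epsilon)
    fix e :: real assume e: "0 < e"
    have "\<bar>a\<bar> \<le> e / (C + 1) * C" using e assms(2) by (intro assms(1)) auto
    also have "\<dots> \<le> e" using e assms(2) by (simp add: field_simps)
    finally show "\<bar>a\<bar> \<le> 0 + e" by simp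
  qed
  then show ?thesis by simp
qed

text \<open>Let G be the product minus the integral of the claimed derivative. On a short interval
  its increment is an integral in which \<open>\<phi>\<close> and \<open>f\<close> are frozen at
  endpoints, and uniform continuity bounds it by e times the integral of |g| + |\<phi>'|. This bound
  is additive, so it holds on the whole interval for every e, and G is constant.\<close>

lemma has_ae_deriv_mult:
  assumes \<phi>: "\<And>r. r \<in> {0<..1} \<Longrightarrow> (\<phi> has_real_derivative \<phi>' r) (at r within {0<..1})"
    and \<phi>': "continuous_on {0<..1} \<phi>'"
    and f: "has_ae_deriv f g"
  shows "has_ae_deriv (\<lambda>r. \<phi> r * f r) (\<lambda>r. \<phi>' r * f r + \<phi> r * g r)"
  unfolding has_ae_deriv_def
proof (intro allI impI)
  fix a b :: real assume ab: "0 < a \<and> a \<le> b \<and> b \<le> 1"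
  then have sub: "{a..b} \<subseteq> {0<..1}" by auto
  have g: "g absolutely_integrable_on {a..b}" using f ab unfolding has_ae_deriv_def by auto
  have fc: "continuous_on {a..b} f" using has_ae_deriv_continuous_on[OF f] ab by auto
  have \<phi>c: "continuous_on {a..b} \<phi>"
    using DERIV_continuous_on[OF \<phi>] sub continuous_on_subset by blast
  have \<phi>'c: "continuous_on {a..b} \<phi>'" using \<phi>' sub continuous_on_subset by blast
  define k where "k = (\<lambda>r. \<phi>' r * f r + \<phi> r * g r)"
  have k: "k absolutely_integrable_on {a..b}"
    unfolding k_def
    by (intro set_integral_add absolutely_integrable_continuous_mult \<phi>c \<phi>'c g absolutely_integrable_continuous_real fc)
  define G where "G t = \<phi> t * f t - integral {a..t} k" for t
  define w where "w = (\<lambda>t. \<bar>g t\<bar> + \<bar>\<phi>' t\<bar>)"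
  have w: "w integrable_on {a..b}"
    unfolding w_def
  proof (rule integrable_add)
    show "(\<lambda>x. \<bar>g x\<bar>) integrable_on {a..b}" using g by (simp add: absolutely_integrable_on_def)
    show "(\<lambda>x. \<bar>\<phi>' x\<bar>) integrable_on {a..b}" by (intro integrable_continuous_interval continuous_intros \<phi>'c)
  qed
  have "\<bar>G b - G a\<bar> \<le> e * integral {a..b} w" if e: "0 < e" for e
  proof -
    have "uniformly_continuous_on {a..b} f" "uniformly_continuous_on {a..b} \<phi>"
      using compact_uniformly_continuous fc \<phi>c by blast+
    then obtain d1 d2 where d: "0 < d1" "0 < d2"
      "\<And>x y. x \<in> {a..b} \<Longrightarrow> y \<in> {a..b} \<Longrightarrow> \<bar>x - y\<bar> < d1 \<Longrightarrow> \<bar>f x - f y\<bar> < e"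
      "\<And>x y. x \<in> {a..b} \<Longrightarrow> y \<in> {a..b} \<Longrightarrow> \<bar>x - y\<bar> < d2 \<Longrightarrow> \<bar>\<phi> x - \<phi> y\<bar> < e"
      using e unfolding uniformly_continuous_on_def dist_real_def by metis
    define \<delta> where "\<delta> = min d1 d2 / 2"
    show ?thesis
    proof (rule additive_bound_by_local[where \<delta>=\<delta> and a=a and b=b and m="\<lambda>x y. e * integral {x..y} w"])
      show "0 < \<delta>" using d by (simp add: \<delta>_def)
      show "e * integral {x..y} w + e * integral {y..z} w = e * integral {x..z} w"
        if "a \<le> x" "x \<le> y" "y \<le> z" "z \<le> b" for x y z
      proof -
        have "w integrable_on {x..z}" using integrable_on_subinterval[OF w] that by auto
        then show ?thesis using that
          by (simp add: distrib_left[symmetric] Henstock_Kurzweil_Integration.integral_combine)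
      qed
      fix x y assume xy: "a \<le> x" "x \<le> y" "y \<le> b" "y - x \<le> \<delta>"
      then have sub': "{x..y} \<subseteq> {a..b}" by auto
      note int = integrable_on_subinterval[OF _ sub']
      have ki: "k integrable_on {a..b}" "g integrable_on {a..b}" "\<phi>' integrable_on {a..b}"
        using k g \<phi>'c by (auto simp: absolutely_integrable_on_def intro: integrable_continuous_interval)
      have "integral {a..x} k + integral {x..y} k = integral {a..y} k"
        using xy integrable_on_subinterval[OF ki(1), of a y] by (intro Henstock_Kurzweil_Integration.integral_combine) auto
      moreover have "f y - f x = integral {x..y} g"
        using f xy ab unfolding has_ae_deriv_def by auto
      moreover have "\<phi> y - \<phi> x = integral {x..y} \<phi>'"
      proof -
        have "(\<phi>' has_integral (\<phi> y - \<phi> x)) {x..y}"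
          using xy sub' sub by (intro fundamental_theorem_of_calculus)
            (auto simp: has_real_derivative_iff_has_vector_derivative[symmetric] intro!: DERIV_subset[OF \<phi>])
        then show ?thesis by (simp add: integral_unique)
      qed
      moreover have "\<phi> y * f y - \<phi> x * f x = \<phi> y * (f y - f x) + f x * (\<phi> y - \<phi> x)"
        by (simp add: algebra_simps)
      ultimately have "G y - G x = \<phi> y * integral {x..y} g + f x * integral {x..y} \<phi>' - integral {x..y} k"
        unfolding G_def by simp
      also have "\<dots> = integral {x..y} (\<lambda>t. \<phi> y * g t + f x * \<phi>' t - k t)"
        using int[OF ki(1)] int[OF ki(2)] int[OF ki(3)]
        by (simp add: Henstock_Kurzweil_Integration.integral_add Henstock_Kurzweil_Integration.integral_diff integrable_add integrable_on_mult_right)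
      also have "norm \<dots> \<le> integral {x..y} (\<lambda>t. e * w t)"
      proof (rule integral_norm_bound_integral)
        show "(\<lambda>t. \<phi> y * g t + f x * \<phi>' t - k t) integrable_on {x..y}"
          using int[OF ki(1)] int[OF ki(2)] int[OF ki(3)] by (intro integrable_diff integrable_add integrable_on_mult_right)
        show "(\<lambda>t. e * w t) integrable_on {x..y}" using int[OF w] by (rule integrable_on_mult_right)
        fix t assume t: "t \<in> {x..y}"
        have "\<bar>f x - f t\<bar> \<le> e" "\<bar>\<phi> y - \<phi> t\<bar> \<le> e"
          using d(3)[of x t] d(4)[of y t] t xy d(1,2) by (auto simp: \<delta>_def)
        then have "\<bar>\<phi> y - \<phi> t\<bar> * \<bar>g t\<bar> + \<bar>f x - f t\<bar> * \<bar>\<phi>' t\<bar> \<le> e * \<bar>g t\<bar> + e * \<bar>\<phi>' t\<bar>"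
          by (intro add_mono mult_right_mono) auto
        moreover have "\<phi> y * g t + f x * \<phi>' t - k t = (\<phi> y - \<phi> t) * g t + (f x - f t) * \<phi>' t"
          by (simp add: k_def algebra_simps)
        moreover have "\<bar>(\<phi> y - \<phi> t) * g t + (f x - f t) * \<phi>' t\<bar> \<le> \<bar>\<phi> y - \<phi> t\<bar> * \<bar>g t\<bar> + \<bar>f x - f t\<bar> * \<bar>\<phi>' t\<bar>"
          unfolding abs_mult[symmetric] by (rule abs_triangle_ineq)
        ultimately show "norm (\<phi> y * g t + f x * \<phi>' t - k t) \<le> e * w t"
          unfolding w_def real_norm_def distrib_left by linarith
      qed
      finally show "\<bar>G y - G x\<bar> \<le> e * integral {x..y} w" by simp
    qed (use ab in auto)
  qed
  moreover have "0 \<le> integral {a..b} w" by (intro integral_nonneg w) (simp add: w_def)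
  ultimately have "G b - G a = 0" by (rule zero_if_le_epsilon_mult)
  then have "G b = G a" by simp
  then show "(\<lambda>r. \<phi>' r * f r + \<phi> r * g r) absolutely_integrable_on {a..b} \<and>
      \<phi> b * f b - \<phi> a * f a = integral {a..b} (\<lambda>r. \<phi>' r * f r + \<phi> r * g r)"
    using k unfolding G_def k_def by simp
qed

lemma at_within_Ioc_eq:
  fixes x :: real
  assumes "0 < a" "a < x"
  shows "at x within {0<..1} = at x within {a..1}"
proof (rule at_within_nhd)
  show "x \<in> {a<..}" "open {a<..}" using assms by auto
  show "{0<..1} \<inter> {a<..} - {x} = {a..1} \<inter> {a<..} - {x}" using assms by auto
qed

lemma has_ae_deriv_continuous_on_Ioc:
  assumes "has_ae_deriv f g"
  shows "continuous_on {0<..1} f"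
  unfolding continuous_on_eq_continuous_within
proof
  fix x :: real assume x: "x \<in> {0<..1}"
  then have "continuous (at x within {x/2..1}) f"
    using has_ae_deriv_continuous_on[OF assms, of "x/2" 1] by (auto simp: continuous_on_eq_continuous_within)
  then show "continuous (at x within {0<..1}) f"
    using at_within_Ioc_eq[of "x/2" x] x by simp
qed

lemma has_ae_deriv_add:
  assumes "has_ae_deriv f1 g1" "has_ae_deriv f2 g2"
  shows "has_ae_deriv (\<lambda>r. f1 r + f2 r) (\<lambda>r. g1 r + g2 r)"
  unfolding has_ae_deriv_def
proof (intro allI impI conjI)
  fix r s :: real assume rs: "0 < r \<and> r \<le> s \<and> s \<le> 1"
  then have i: "g1 absolutely_integrable_on {r..s}" "g2 absolutely_integrable_on {r..s}"
    and v: "f1 s - f1 r = integral {r..s} g1" "f2 s - f2 r = integral {r..s} g2"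
    using assms by (simp_all add: has_ae_deriv_def)
  show "(\<lambda>r. g1 r + g2 r) absolutely_integrable_on {r..s}" using i by (rule set_integral_add(1))
  show "f1 s + f2 s - (f1 r + f2 r) = integral {r..s} (\<lambda>r. g1 r + g2 r)"
    using i v by (simp add: Henstock_Kurzweil_Integration.integral_add set_lebesgue_integral_eq_integral(1))
qed

lemma has_ae_deriv_smooth:
  assumes "\<And>r. r \<in> {0<..1} \<Longrightarrow> (\<phi> has_real_derivative \<phi>' r) (at r within {0<..1})"
    and "continuous_on {0<..1} \<phi>'"
  shows "has_ae_deriv \<phi> \<phi>'"
proof -
  have "has_ae_deriv (\<lambda>_. 1) (\<lambda>_. 0)" by (simp add: has_ae_deriv_def)
  from has_ae_deriv_mult[OF assms this] show ?thesis by simp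
qed

lemma has_ae_deriv_cong:
  assumes "has_ae_deriv f g" "\<And>r. r \<in> {0<..1} \<Longrightarrow> f r = f' r" "\<And>r. r \<in> {0<..1} \<Longrightarrow> g r = g' r"
  shows "has_ae_deriv f' g'"
  unfolding has_ae_deriv_def
proof (intro allI impI conjI)
  fix r s :: real assume rs: "0 < r \<and> r \<le> s \<and> s \<le> 1"
  then have eq: "\<And>x. x \<in> {r..s} \<Longrightarrow> g x = g' x" using assms(3) by auto
  have "g absolutely_integrable_on {r..s}" "f s - f r = integral {r..s} g" using assms(1) rs by (simp_all add: has_ae_deriv_def)
  moreover have "g absolutely_integrable_on {r..s} \<longleftrightarrow> g' absolutely_integrable_on {r..s}"
    by (rule set_integrable_cong) (use eq in auto)
  moreover have "integral {r..s} g = integral {r..s} g'" by (rule integral_cong) (rule eq)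
  ultimately show "g' absolutely_integrable_on {r..s}" "f' s - f' r = integral {r..s} g'"
    using assms(2)[of r] assms(2)[of s] rs by auto
qed

section \<open>The decaying solution built from the amplitude\<close>

text \<open>The value 0 for t <= 0 amounts to extending the potential by zero outside the unit ball,
  which lets the amplitude equation live on the whole real line.\<close>

definition log_potential :: "(real \<Rightarrow> real) \<Rightarrow> real \<Rightarrow> real" where
  "log_potential q t = (if 0 < t then exp (- 2 * t) * q (exp (- t)) else 0)"

definition lap_radial :: "(real \<Rightarrow> real) \<Rightarrow> nat \<Rightarrow> real \<Rightarrow> real" where
  "lap_radial q N r = lap_diff (log_potential q) (real N) (- ln r)"

text \<open>The integrated Riccati equation in the variable r: 1 / r is the Jacobian of t = - ln r,
  and since t decreases in r, the decrement of the transform in t becomes an increment in r.\<close>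

lemma has_ae_deriv_lap_radial:
  assumes b: "exp_bounded (log_potential q) M (real N)"
  shows "has_ae_deriv (lap_radial q N)
    (\<lambda>r. (r ^ N * log_potential q (- ln r) - (lap_radial q N r)\<^sup>2 / r ^ N) / r)"
  unfolding has_ae_deriv_def
proof (intro allI impI)
  fix r s :: real assume rs: "0 < r \<and> r \<le> s \<and> s \<le> 1"
  let ?Q = "log_potential q"
  define h where "h = (\<lambda>t. exp (- real N * t) * ?Q t - exp (real N * t) * (lap_diff ?Q (real N) t)\<^sup>2)"
  have le: "- ln s \<le> - ln r" using rs by simp
  note inc = lap_diff_increment[OF b le, folded h_def]
  have img: "(\<lambda>x. - ln x) ` {r..s} = {- ln s..- ln r}"
  proof (intro set_eqI iffI)
    fix t assume t: "t \<in> {- ln s..- ln r}"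
    then have "exp (ln r) \<le> exp (- t)" "exp (- t) \<le> exp (ln s)" by simp_all
    then have "t = - ln (exp (- t))" "exp (- t) \<in> {r..s}" using rs by simp_all
    then show "t \<in> (\<lambda>x. - ln x) ` {r..s}" by blast
  qed (use rs in auto)
  have inj: "inj_on (\<lambda>x. - ln x) {r..s}" using rs by (auto simp: inj_on_def)
  have der: "((\<lambda>x. - ln x) has_field_derivative (- 1 / x)) (at x within {r..s})" if "x \<in> {r..s}" for x
    using rs that by (auto intro!: derivative_eq_intros)
  have eq: "\<bar>- 1 / x\<bar> * h (- ln x) = (x ^ N * ?Q (- ln x) - (lap_radial q N x)\<^sup>2 / x ^ N) / x" if "x \<in> {r..s}" for x
  proof -
    have x: "0 < x" using that rs by auto
    then have "exp (real N * ln x) = x ^ N" by (simp add: exp_of_nat_mult)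
    then show ?thesis using x unfolding h_def lap_radial_def
      by (simp add: exp_minus field_simps)
  qed
  have "(\<lambda>x. \<bar>- 1 / x\<bar> * h (- ln x)) absolutely_integrable_on {r..s} \<and>
      integral {r..s} (\<lambda>x. \<bar>- 1 / x\<bar> * h (- ln x)) = lap_diff ?Q (real N) (- ln s) - lap_diff ?Q (real N) (- ln r)"
    by (subst has_absolute_integral_change_of_variables_1'[OF _ der inj]) (use inc img in auto)
  moreover have "(\<lambda>x. \<bar>- 1 / x\<bar> * h (- ln x)) absolutely_integrable_on {r..s} \<longleftrightarrow>
     (\<lambda>x. (x ^ N * ?Q (- ln x) - (lap_radial q N x)\<^sup>2 / x ^ N) / x) absolutely_integrable_on {r..s}"
    by (rule set_integrable_cong) (use eq in auto)
  moreover have "integral {r..s} (\<lambda>x. \<bar>- 1 / x\<bar> * h (- ln x)) = integral {r..s} (\<lambda>x. (x ^ N * ?Q (- ln x) - (lap_radial q N x)\<^sup>2 / x ^ N) / x)"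
    by (rule integral_cong) (rule eq)
  ultimately show "(\<lambda>x. (x ^ N * ?Q (- ln x) - (lap_radial q N x)\<^sup>2 / x ^ N) / x) absolutely_integrable_on {r..s} \<and>
      lap_radial q N s - lap_radial q N r = integral {r..s} (\<lambda>x. (x ^ N * ?Q (- ln x) - (lap_radial q N x)\<^sup>2 / x ^ N) / x)"
    by (simp add: lap_radial_def)
qed

text \<open>The solution of interest has \<open>N = 2 * k + d - 2\<close>.\<close>

definition log_deriv :: "(real \<Rightarrow> real) \<Rightarrow> nat \<Rightarrow> nat \<Rightarrow> real \<Rightarrow> real" where
  "log_deriv q k N r = (real k + lap_radial q N r / r ^ N) / r"

text \<open>Integrating the logarithmic derivative from r to 1 makes the solution positive and equal
  to 1 at 1 by construction, and its decay at the origin can be read off a bound for the logarithmic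
  derivative.\<close>

definition regular_solution :: "(real \<Rightarrow> real) \<Rightarrow> nat \<Rightarrow> nat \<Rightarrow> real \<Rightarrow> real" where
  "regular_solution q k N r = exp (- integral {r..1} (log_deriv q k N))"

lemma regular_solution_1: "regular_solution q k N 1 = 1"
  by (simp add: regular_solution_def)

lemma regular_solution_pos: "0 < regular_solution q k N r"
  by (simp add: regular_solution_def)

lemma log_deriv_continuous:
  assumes "exp_bounded (log_potential q) M (real N)"
  shows "continuous_on {0<..1} (log_deriv q k N)"
proof -
  have "continuous_on {0<..1} (lap_radial q N)"
    by (rule has_ae_deriv_continuous_on_Ioc[OF has_ae_deriv_lap_radial[OF assms]])
  then show ?thesis unfolding log_deriv_def by (auto intro!: continuous_intros)
qed

lemma regular_solution_deriv:
  assumes "exp_bounded (log_potential q) M (real N)" "r \<in> {0<..1}"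
  shows "(regular_solution q k N has_real_derivative regular_solution q k N r * log_deriv q k N r) (at r within {0<..1})"
proof -
  let ?n = "log_deriv q k N"
  define a where "a = r / 2"
  have a: "0 < a" "a < r" "r \<le> 1" using assms(2) by (auto simp: a_def)
  have c: "continuous_on {a..1} ?n"
    using log_deriv_continuous[OF assms(1)] by (rule continuous_on_subset) (use a in auto)
  have split: "integral {x..1} ?n = integral {a..1} ?n - integral {a..x} ?n" if "x \<in> {a..1}" for x
    using Henstock_Kurzweil_Integration.integral_combine[of a x 1 ?n] that c
    by (simp add: integrable_continuous_interval algebra_simps)
  have "((\<lambda>x. integral {a..x} ?n) has_real_derivative ?n r) (at r within {a..1})"
    using a by (intro integral_has_real_derivative[OF c]) auto
  from DERIV_diff[OF this DERIV_const[of "integral {a..1} ?n"]]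
  have "((\<lambda>x. integral {a..x} ?n - integral {a..1} ?n) has_real_derivative ?n r) (at r within {a..1})"
    by simp
  from DERIV_chain2[OF DERIV_exp this]
  have "((\<lambda>x. exp (integral {a..x} ?n - integral {a..1} ?n)) has_real_derivative regular_solution q k N r * ?n r) (at r within {a..1})"
    using a by (simp only: regular_solution_def split[of r] atLeastAtMost_iff minus_diff_eq less_imp_le simp_thms)
  then have "(regular_solution q k N has_real_derivative regular_solution q k N r * ?n r) (at r within {a..1})"
  proof (rule has_field_derivative_transform_within[where d=1])
    show "exp (integral {a..x} ?n - integral {a..1} ?n) = regular_solution q k N x" if "x \<in> {a..1}" for x
      unfolding regular_solution_def split[OF that] by simp
  qed (use a in auto)
  then show ?thesis using at_within_Ioc_eq[of a r] a by simp
qed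

lemma log_deriv_bound:
  assumes "exp_bounded (log_potential q) M (real N)" "r \<in> {0<..1}"
  shows "\<bar>log_deriv q k N r - real k / r\<bar> \<le> 2 * M / r"
proof -
  have r: "0 < r" using assms by auto
  have "\<bar>lap_radial q N r\<bar> \<le> 2 * M * r ^ N"
    using lap_diff_bound[OF assms(1), of "- ln r"] r
    by (simp add: lap_radial_def exp_of_nat_mult)
  then have "\<bar>lap_radial q N r / r ^ N\<bar> \<le> 2 * M"
    using r by (simp add: abs_divide divide_le_eq)
  then have "\<bar>lap_radial q N r / r ^ N\<bar> / r \<le> 2 * M / r" by (rule divide_right_mono) (use r in simp)
  moreover have "log_deriv q k N r - real k / r = lap_radial q N r / r ^ N / r"
    by (simp add: log_deriv_def add_divide_distrib)
  ultimately show ?thesis using r by (simp only: abs_divide abs_of_pos)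
qed

text \<open>The logarithmic derivative differs from k / r by at most 2 M / r, so the solution lies
  between r^(k + 2 M) and r^(k - 2 M). The upper bound gives square integrability, and both enter
  the uniqueness proof.\<close>

lemma regular_solution_bounds:
  assumes b: "exp_bounded (log_potential q) M (real N)" and t: "0 \<le> t"
  shows "regular_solution q k N (exp (- t)) \<le> exp (- (real k - 2 * M) * t)"
    and "exp (- (real k + 2 * M) * t) \<le> regular_solution q k N (exp (- t))"
proof -
  define r where "r = exp (- t)"
  have r: "0 < r" "r \<le> 1" "ln r = - t" using t by (auto simp: r_def)
  have n: "log_deriv q k N integrable_on {r..1}"
    using r by (intro integrable_continuous_interval continuous_on_subset[OF log_deriv_continuous[OF b]]) auto
  have i: "((\<lambda>x. C / x) has_integral C * t) {r..1}" for C
  proof -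
    have "((\<lambda>x. C / x) has_integral (C * ln 1 - C * ln r)) {r..1}"
      using r by (intro fundamental_theorem_of_calculus)
        (auto simp: has_real_derivative_iff_has_vector_derivative[symmetric] intro!: derivative_eq_intros)
    then show ?thesis using r by simp
  qed
  have "real k / x - 2 * M / x \<le> log_deriv q k N x" "log_deriv q k N x \<le> real k / x + 2 * M / x" if "x \<in> {r..1}" for x
    using log_deriv_bound[OF b, of x k] that r by (auto simp: abs_le_iff)
  then have "(real k - 2 * M) / x \<le> log_deriv q k N x" "log_deriv q k N x \<le> (real k + 2 * M) / x" if "x \<in> {r..1}" for x
    using that by (simp_all add: diff_divide_distrib add_divide_distrib)
  then have "(real k - 2 * M) * t \<le> integral {r..1} (log_deriv q k N)" "integral {r..1} (log_deriv q k N) \<le> (real k + 2 * M) * t"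
    using has_integral_le[OF i integrable_integral[OF n]] has_integral_le[OF integrable_integral[OF n] i] by blast+
  then show "regular_solution q k N (exp (- t)) \<le> exp (- (real k - 2 * M) * t)"
    "exp (- (real k + 2 * M) * t) \<le> regular_solution q k N (exp (- t))"
    unfolding regular_solution_def r_def by (simp_all only: mult_minus_left exp_le_cancel_iff neg_le_iff_le)
qed

text \<open>The logarithmic derivative is only absolutely continuous, so r^(d - 1) u' is written as
  a product with one such factor: \<open>\<phi>\<close> = u / r^(2 k) is continuously differentiable
  and \<open>f\<close> = r^N (k + n) is absolutely continuous. The powers match because N + 1 = 2 k
  + (d - 1).\<close>

lemma regular_solution_ode:
  assumes b: "exp_bounded (log_potential q) M (real N)" and N: "N + 1 = 2 * k + (d - 1)" and d: "2 \<le> d"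
  shows "solves_radial_ode d q k (regular_solution q k N)"
proof -
  let ?u = "regular_solution q k N" and ?n = "log_deriv q k N" and ?m = "lap_radial q N"
  let ?g0 = "\<lambda>r. (r ^ N * log_potential q (- ln r) - (?m r)\<^sup>2 / r ^ N) / r"
  define u' where "u' r = ?u r * ?n r" for r
  define \<phi> where "\<phi> r = ?u r / r ^ (2 * k)" for r
  define \<phi>' where "\<phi>' r = (?u r * ?n r - 2 * real k * ?u r / r) / r ^ (2 * k)" for r
  define f where "f r = ?m r + real k * r ^ N" for r
  define g where "g r = \<phi>' r * f r + \<phi> r * (?g0 r + real k * real N * r ^ N / r)" for r
  have du: "(?u has_real_derivative u' r) (at r within {0<..1})" if "r \<in> {0<..1}" for r
    unfolding u'_def using regular_solution_deriv[OF b that] .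
  have pw: "((\<lambda>r. r ^ n) has_real_derivative (real n * r ^ n / r)) (at r within {0<..1})" if "r \<in> {0<..1}" for r :: real and n
  proof -
    have "real n * r ^ (n - Suc 0) = real n * r ^ n / r" using that by (cases n) auto
    then show ?thesis using DERIV_pow[of n r "{0<..1}"] by simp
  qed
  have d\<phi>: "(\<phi> has_real_derivative \<phi>' r) (at r within {0<..1})" if r: "r \<in> {0<..1}" for r
  proof -
    have "((\<lambda>r. ?u r / r ^ (2*k)) has_real_derivative (u' r * r ^ (2*k) - ?u r * (real (2*k) * r ^ (2*k) / r)) / (r ^ (2*k) * r ^ (2*k))) (at r within {0<..1})"
      by (rule DERIV_divide[OF du[OF r] pw[OF r]]) (use r in auto)
    moreover have "(u' r * r ^ (2*k) - ?u r * (real (2*k) * r ^ (2*k) / r)) / (r ^ (2*k) * r ^ (2*k)) = \<phi>' r"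
      using r unfolding \<phi>'_def u'_def by (simp add: field_simps)
    ultimately show ?thesis unfolding \<phi>_def by simp
  qed
  have nc: "continuous_on {0<..1} ?n" by (rule log_deriv_continuous[OF b])
  have uc: "continuous_on {0<..1} ?u" by (rule DERIV_continuous_on[OF du])
  have f: "has_ae_deriv f (\<lambda>r. ?g0 r + real k * real N * r ^ N / r)"
    unfolding f_def
  proof (rule has_ae_deriv_add[OF has_ae_deriv_lap_radial[OF b] has_ae_deriv_smooth])
    show "((\<lambda>r. real k * r ^ N) has_real_derivative real k * real N * r ^ N / r) (at r within {0<..1})" if "r \<in> {0<..1}" for r
      using DERIV_cmult[OF pw[OF that, of N], of "real k"] by (simp add: mult.assoc)
  qed (intro continuous_intros; auto)
  have "has_ae_deriv (\<lambda>r. \<phi> r * f r) g"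
    unfolding g_def
    by (rule has_ae_deriv_mult[OF d\<phi> _ f]) (auto simp: \<phi>'_def intro!: continuous_intros uc nc)
  moreover have pow: "r ^ (d - 1) = r ^ N * r / r ^ (2 * k)" if "0 < r" for r :: real
    using that N by (metis nonzero_mult_div_cancel_left power_add power_not_zero less_irrefl power_one_right)
  have fn: "f r = r ^ N * (r * ?n r)" if "0 < r" for r
    using that unfolding f_def log_deriv_def by (simp add: field_simps)
  have "\<phi> r * f r = r ^ (d - 1) * u' r" if "r \<in> {0<..1}" for r
  proof -
    have r: "0 < r" using that by simp
    show ?thesis unfolding fn[OF r] pow[OF r] \<phi>_def u'_def by (simp add: mult_ac)
  qed
  ultimately have P: "has_ae_deriv (\<lambda>r. r ^ (d - 1) * u' r) g"
    by (auto intro: has_ae_deriv_cong)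
  have ode: "- (1 / r ^ (d - 1)) * g r + (real k * (real k + real d - 2) / r\<^sup>2 + q r) * ?u r = 0" if r: "r \<in> {0<..<1}" for r
  proof -
    have Q: "log_potential q (- ln r) = r\<^sup>2 * q r"
    proof -
      have "exp (- 2 * (- ln r)) = r\<^sup>2" using r exp_of_nat_mult[of 2 "ln r"] by (simp add: power2_eq_square)
      then show ?thesis using r by (simp add: log_potential_def)
    qed
    \<comment> \<open>In terms of y = r u' / u the terms in y from the derivative of
      \<open>\<phi>\<close> and from the Riccati equation cancel, and k N - k^2 = k (k + d - 2) is
      the angular term.\<close>
    define y where "y = r * ?n r"
    have m: "?m r = r ^ N * (y - real k)" using fn[of r] r by (simp add: f_def y_def algebra_simps)
    have RN: "real N = 2 * real k + real d - 2" using N d by linarith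
    have r0: "0 < r" using r by simp
    have "g r = ?u r * r ^ N / (r ^ (2*k) * r) * (y * y - 2 * real k * y + (r\<^sup>2 * q r - (y - real k)\<^sup>2) + real k * real N)"
    proof -
      have e1: "?g0 r = r ^ N / r * (r\<^sup>2 * q r - (y - real k)\<^sup>2)"
        unfolding Q m using r0 by (simp add: power_mult_distrib power2_eq_square field_simps)
      have e2: "\<phi>' r * f r = ?u r * r ^ N / (r ^ (2*k) * r) * (y * y - 2 * real k * y)"
      proof -
        have "?n r = y / r" using r0 by (simp add: y_def)
        then show ?thesis unfolding \<phi>'_def fn[OF r0] y_def[symmetric] using r0 by (simp add: field_simps)
      qed
      show ?thesis unfolding g_def e2 e1 \<phi>_def using r0 by (simp add: field_simps)
    qed
    also have "y * y - 2 * real k * y + (r\<^sup>2 * q r - (y - real k)\<^sup>2) + real k * real N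
      = r\<^sup>2 * q r + real k * (real k + real d - 2)"
      unfolding RN by (simp add: power2_eq_square algebra_simps)
    finally have gr: "g r = ?u r * r ^ N / (r ^ (2*k) * r) * (r\<^sup>2 * q r + real k * (real k + real d - 2))" .
    show ?thesis unfolding gr pow[OF r0] using r0 by (simp add: field_simps power2_eq_square)
  qed
  show ?thesis
    unfolding solves_radial_ode_def
    using du P ode by (intro exI[of _ u'] exI[of _ g]) (auto intro!: AE_I2)
qed

section \<open>Uniqueness of the square integrable solution\<close>

lemma AE_Ioo_integral_zero:
  fixes g :: "real \<Rightarrow> real"
  assumes "AE r in lebesgue_on {0<..<1}. g r = 0" "0 < a" "b \<le> 1"
  shows "integral {a..b} g = 0"
proof -
  have "AE r in lebesgue. r \<in> {0<..<1} \<longrightarrow> g r = 0"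
    using assms(1) by (subst (asm) AE_restrict_space_iff) auto
  then obtain N where N: "N \<in> null_sets lebesgue" "{r. \<not> (r \<in> {0<..<1} \<longrightarrow> g r = 0)} \<subseteq> N"
    by (auto simp: eventually_ae_filter)
  \<comment> \<open>The hypothesis concerns the open interval, while the integral may reach the
    endpoint 1.\<close>
  then have "negligible (insert 1 N)" by (simp add: negligible_iff_null_sets)
  then have "integral {a..b} g = integral {a..b} (\<lambda>_. 0)"
  proof (rule integral_spike)
    show "0 = g x" if "x \<in> {a..b} - insert 1 N" for x
    proof -
      have "x \<in> {0<..<1}" "x \<notin> N" using that assms(2,3) by auto
      then show ?thesis using N(2) by auto
    qed
  qed
  then show ?thesis by simp
qed

lemma Ioc_constant:
  assumes "\<And>r. r \<in> {0<..1} \<Longrightarrow> (h has_real_derivative 0) (at r within {0<..1})" "r \<in> {0<..1}"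
  shows "h r = h (1::real)"
  by (rule has_field_derivative_zero_constant[where s="{0<..1::real}", THEN exE])
    (use assms in auto)

lemma Ioc_mono:
  fixes w :: "real \<Rightarrow> real"
  assumes d: "\<And>r. r \<in> {0<..1} \<Longrightarrow> (w has_real_derivative w' r) (at r within {0<..1})"
    and nn: "\<And>r. r \<in> {0<..1} \<Longrightarrow> 0 \<le> w' r" and r: "r \<in> {0<..1}"
  shows "w r \<le> w 1"
proof -
  have "(w' has_integral (w 1 - w r)) {r..1}"
    using r by (intro fundamental_theorem_of_calculus)
      (auto simp: has_real_derivative_iff_has_vector_derivative[symmetric] intro!: DERIV_subset[OF d])
  then have "0 \<le> w 1 - w r" by (rule has_integral_nonneg) (use nn r in auto)
  then show ?thesis by simp
qed

text \<open>
  Two solutions have constant weighted Wronskian \<open>c\<close>. If \<open>c \<noteq> 0\<close>, then the quotient of \<open>v\<close> by the decaying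
  solution grows so fast towards the origin that \<open>v\<close> is not square integrable.
\<close>

lemma solution_unique:
  assumes b: "exp_bounded (log_potential q) M (real N)" and N: "N + 1 = 2 * k + (d - 1)" "2 \<le> d" "12 * M \<le> real N"
    and q': "AE r in lebesgue_on {0<..<1}. q' r = q r"
    and v: "solves_radial_ode d q' k v" "v 1 = 1"
    and L2: "(\<integral>\<^sup>+ t. ennreal ((v (exp (- t)))\<^sup>2 * exp (- (real d - 2) * t)) * indicator {0<..} t \<partial>lborel) < \<infinity>"
    and r: "r \<in> {0<..1}"
  shows "v r = regular_solution q k N r"
proof -
  let ?u = "regular_solution q k N"
  \<comment> \<open>The upper bound on u gives r^(d - 1) u^2 <= r^(\<sigma> + 1), so a nonzero
    Wronskian makes v / u grow like r^(-\<sigma>). With the lower bound on u, the integrand in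
    \<open>L2\<close> is then at least a constant times exp ((2 \<sigma> - N - 4 M) t), and 12 M <=
    N makes this exponent nonnegative.\<close>
  define \<sigma> where "\<sigma> = real N - 4 * M"
  have M: "0 \<le> M" and \<sigma>: "0 < \<sigma>" "real N + 4 * M \<le> 2 * \<sigma>"
    using exp_boundedD(1,2)[OF b] N(3) by (auto simp: \<sigma>_def)
  have RN: "real N = 2 * real k + real d - 2" using N by linarith
  obtain u' gu where u: "\<And>r. r \<in> {0<..1} \<Longrightarrow> (?u has_real_derivative u' r) (at r within {0<..1})"
    and Pu: "has_ae_deriv (\<lambda>r. r ^ (d - 1) * u' r) gu"
    and ou: "AE r in lebesgue_on {0<..<1}. - (1 / r ^ (d - 1)) * gu r + (real k * (real k + real d - 2) / r\<^sup>2 + q r) * ?u r = 0"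
    using regular_solution_ode[OF b N(1,2)] unfolding solves_radial_ode_def by blast
  obtain v' gv where dv: "\<And>r. r \<in> {0<..1} \<Longrightarrow> (v has_real_derivative v' r) (at r within {0<..1})"
    and Pv: "has_ae_deriv (\<lambda>r. r ^ (d - 1) * v' r) gv"
    and ov: "AE r in lebesgue_on {0<..<1}. - (1 / r ^ (d - 1)) * gv r + (real k * (real k + real d - 2) / r\<^sup>2 + q' r) * v r = 0"
    using v(1) unfolding solves_radial_ode_def by blast
  have cont: "continuous_on {0<..1} w'" if "has_ae_deriv (\<lambda>r. r ^ (d - 1) * w' r) g" for w' g
  proof -
    have "continuous_on {0<..1} (\<lambda>r. (r ^ (d - 1) * w' r) / r ^ (d - 1))"
      by (intro continuous_intros has_ae_deriv_continuous_on_Ioc[OF that]) auto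
    then show ?thesis by (rule continuous_on_eq) auto
  qed
  \<comment> \<open>Each summand pairs a continuously differentiable factor with an absolutely
    continuous one, the shape that \<open>has_ae_deriv_mult\<close> handles.\<close>
  define W where "W r = ?u r * (r ^ (d - 1) * v' r) + (- v r) * (r ^ (d - 1) * u' r)" for r
  define W' where "W' r = (u' r * (r ^ (d - 1) * v' r) + ?u r * gv r) + ((- v' r) * (r ^ (d - 1) * u' r) + (- v r) * gu r)" for r
  have W: "has_ae_deriv W W'"
    unfolding W_def W'_def
    by (intro has_ae_deriv_add has_ae_deriv_mult Pu Pv u cont[OF Pu] cont[OF Pv] continuous_intros DERIV_minus dv)
  have "AE r in lebesgue_on {0<..<1}. W' r = 0"
    using ou ov q' AE_space
  proof eventually_elim
    case (elim r)
    then have p: "r ^ (d - 1) \<noteq> 0" by auto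
    define E where "E = real k * (real k + real d - 2) / r\<^sup>2 + q r"
    have "gu r = r ^ (d - 1) * (E * ?u r)" "gv r = r ^ (d - 1) * (E * v r)"
      using elim(1,2) p unfolding elim(3) E_def[symmetric] by (simp_all add: field_simps)
    then show ?case unfolding W'_def by (simp add: algebra_simps)
  qed
  then have Wc: "W r = W 1" if "r \<in> {0<..1}" for r
  proof -
    have "W 1 - W r = integral {r..1} W'" using W that unfolding has_ae_deriv_def by auto
    then show ?thesis using AE_Ioo_integral_zero[of W' r 1] \<open>AE r in lebesgue_on {0<..<1}. W' r = 0\<close> that by auto
  qed
  define c where "c = W 1"
  define h where "h r = v r / ?u r" for r
  have pos: "0 < ?u r" for r by (rule regular_solution_pos)
  have h: "(h has_real_derivative (c / (r ^ (d - 1) * (?u r)\<^sup>2))) (at r within {0<..1})" if r: "r \<in> {0<..1}" for r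
  proof -
    have "(h has_real_derivative ((v' r * ?u r - v r * u' r) / (?u r * ?u r))) (at r within {0<..1})"
      unfolding h_def by (rule DERIV_divide[OF dv[OF r] u[OF r]]) (use pos[of r] in auto)
    moreover have "v' r * ?u r - v r * u' r = c / r ^ (d - 1)"
    proof -
      have "W r = c" using Wc[OF r] by (simp add: c_def)
      then show ?thesis using r unfolding W_def by (simp add: field_simps)
    qed
    ultimately show ?thesis by (simp add: power2_eq_square mult_ac)
  qed
  have h1: "h 1 = 1" by (simp add: h_def v(2) regular_solution_1)
  have "c = 0"
  proof (rule ccontr)
    assume c: "c \<noteq> 0"
    define A where "A = \<bar>c\<bar> / \<sigma>"
    have A: "0 < A" using c \<sigma> by (simp add: A_def)
    have growth: "A * exp (\<sigma> * t) \<le> A + 1 + \<bar>h (exp (- t))\<bar>" if t: "0 \<le> t" for t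
    proof -
      \<comment> \<open>A comparison function: the derivative of
        \<open>A * r powr (- \<sigma>)\<close> is exactly minus the lower bound for the derivative
        of \<open>sgn c * h\<close>, so w is nondecreasing and w <= w 1 bounds h from below in
        modulus.\<close>
      define w where "w r = sgn c * h r + A * r powr (- \<sigma>)" for r
      have "w (exp (- t)) \<le> w 1"
      proof (rule Ioc_mono)
        fix r :: real assume r: "r \<in> {0<..1}"
        show "(w has_real_derivative sgn c * (c / (r ^ (d - 1) * (?u r)\<^sup>2)) + A * (- \<sigma> * r powr (- \<sigma> - 1))) (at r within {0<..1})"
          unfolding w_def
          by (intro DERIV_add DERIV_cmult h r has_field_derivative_at_within[OF has_real_derivative_powr]) (use r in auto)
        define s where "s = - ln r"
        have s: "0 \<le> s" "r = exp (- s)" using r by (auto simp: s_def)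
        have "?u r \<le> exp (- (real k - 2 * M) * s)" unfolding s(2) by (rule regular_solution_bounds(1)[OF b s(1)])
        then have "(?u r)\<^sup>2 \<le> (exp (- (real k - 2 * M) * s))\<^sup>2" by (rule power_mono) (use pos[of r] in auto)
        also have "(exp (- (real k - 2 * M) * s))\<^sup>2 = exp (- 2 * (real k - 2 * M) * s)"
          by (simp add: power2_eq_square exp_add[symmetric] algebra_simps)
        finally have "r ^ (d - 1) * (?u r)\<^sup>2 \<le> r ^ (d - 1) * exp (- 2 * (real k - 2 * M) * s)"
          by (rule mult_left_mono) (use r in auto)
        also have "\<dots> = exp (- (\<sigma> + 1) * s)"
          unfolding s(2) \<sigma>_def RN using N(2)
          by (simp add: exp_of_nat_mult[symmetric] exp_add[symmetric] of_nat_diff algebra_simps)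
        finally have le: "r ^ (d - 1) * (?u r)\<^sup>2 \<le> exp (- (\<sigma> + 1) * s)" .
        have "\<bar>c\<bar> * exp ((\<sigma> + 1) * s) = \<bar>c\<bar> / exp (- (\<sigma> + 1) * s)" by (simp only: mult_minus_left exp_minus divide_inverse inverse_inverse_eq)
        also have "\<dots> \<le> \<bar>c\<bar> / (r ^ (d - 1) * (?u r)\<^sup>2)"
          by (rule divide_left_mono[OF le]) (use pos[of r] r in auto)
        also have "\<dots> = sgn c * (c / (r ^ (d - 1) * (?u r)\<^sup>2))" by (simp add: abs_sgn mult.commute)
        finally have 1: "\<bar>c\<bar> * exp ((\<sigma> + 1) * s) \<le> sgn c * (c / (r ^ (d - 1) * (?u r)\<^sup>2))" .
        have "r powr (- \<sigma> - 1) = exp ((\<sigma> + 1) * s)" using r by (simp add: powr_def s_def algebra_simps)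
        then have "A * (- \<sigma> * r powr (- \<sigma> - 1)) = - (\<bar>c\<bar> * exp ((\<sigma> + 1) * s))" using \<sigma> by (simp add: A_def)
        with 1 show "0 \<le> sgn c * (c / (r ^ (d - 1) * (?u r)\<^sup>2)) + A * (- \<sigma> * r powr (- \<sigma> - 1))" by simp
      qed (use t in auto)
      moreover have "\<bar>sgn c * h (exp (- t))\<bar> = \<bar>h (exp (- t))\<bar>" using c by (simp add: abs_mult abs_sgn_eq)
      moreover have "exp (- t) powr (- \<sigma>) = exp (\<sigma> * t)" by (simp add: powr_def)
      moreover have "sgn c \<le> 1" by (simp add: sgn_real_def)
      ultimately show ?thesis unfolding w_def using h1 by auto
    qed
    \<comment> \<open>Beyond \<open>t0\<close> the constant A + 1 in \<open>growth\<close> is at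
      most half of A exp (\<sigma> t) and can be absorbed.\<close>
    define t0 where "t0 = max 0 (ln (2 * (A + 1) / A) / \<sigma>)"
    have big: "A\<^sup>2 / 4 \<le> (v (exp (- t)))\<^sup>2 * exp (- (real d - 2) * t)" if t: "t0 < t" for t
    proof -
      have t': "0 < t" using t by (simp add: t0_def)
      have "ln (2 * (A + 1) / A) < \<sigma> * t" using t \<sigma>(1) by (simp add: t0_def divide_less_eq mult.commute)
      then have "exp (ln (2 * (A + 1) / A)) < exp (\<sigma> * t)" by (simp only: exp_less_cancel_iff)
      then have "2 * (A + 1) / A < exp (\<sigma> * t)" using A by simp
      then have "2 * (A + 1) < A * exp (\<sigma> * t)" using A by (simp add: divide_less_eq mult.commute)
      then have hb: "A / 2 * exp (\<sigma> * t) \<le> \<bar>h (exp (- t))\<bar>" using growth[of t] t' by simp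
      have vh: "v (exp (- t)) = h (exp (- t)) * ?u (exp (- t))" using pos[of "exp (- t)"] by (simp add: h_def)
      have "A / 2 * exp (\<sigma> * t) * exp (- (real k + 2 * M) * t) \<le> \<bar>v (exp (- t))\<bar>"
      unfolding vh abs_mult
      proof (rule mult_mono[OF hb])
        show "exp (- (real k + 2 * M) * t) \<le> \<bar>?u (exp (- t))\<bar>"
          using regular_solution_bounds(2)[OF b, of t k] t' by linarith
      qed auto
      then have "(A / 2 * exp (\<sigma> * t) * exp (- (real k + 2 * M) * t))\<^sup>2 \<le> (v (exp (- t)))\<^sup>2"
        using A by (subst power2_abs[symmetric, of "v (exp (- t))"]) (rule power_mono; simp)
      then have "(A / 2 * exp (\<sigma> * t) * exp (- (real k + 2 * M) * t))\<^sup>2 * exp (- (real d - 2) * t) \<le> (v (exp (- t)))\<^sup>2 * exp (- (real d - 2) * t)"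
        by (rule mult_right_mono) simp
      moreover have "(A / 2 * exp (\<sigma> * t) * exp (- (real k + 2 * M) * t))\<^sup>2 * exp (- (real d - 2) * t)
        = A\<^sup>2 / 4 * exp ((2 * \<sigma> - (real N + 4 * M)) * t)"
        unfolding RN by (simp add: power2_eq_square exp_add[symmetric] field_simps)
      moreover have "A\<^sup>2 / 4 * 1 \<le> A\<^sup>2 / 4 * exp ((2 * \<sigma> - (real N + 4 * M)) * t)"
        using \<sigma>(2) t' by (intro mult_left_mono) auto
      ultimately show ?thesis by linarith
    qed
    have "\<infinity> = (\<integral>\<^sup>+ t. ennreal (A\<^sup>2 / 4) * indicator {t0<..} t \<partial>lborel)"
    proof -
      have "emeasure lborel {t0<..} = \<infinity>"
      proof (rule ccontr)
        assume "emeasure lborel {t0<..} \<noteq> \<infinity>"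
        then obtain C where C: "0 \<le> C" "emeasure lborel {t0<..} = ennreal C" by (cases "emeasure lborel {t0<..}") auto
        have "ennreal (C + 1) = emeasure lborel {t0<..<t0 + (C + 1)}" using C(1) by simp
        also have "\<dots> \<le> emeasure lborel {t0<..}" by (rule emeasure_mono) auto
        finally show False using C by (simp del: ennreal_plus)
      qed
      then show ?thesis using A by (simp add: nn_integral_cmult_indicator ennreal_mult_top)
    qed
    also have "\<dots> \<le> (\<integral>\<^sup>+ t. ennreal ((v (exp (- t)))\<^sup>2 * exp (- (real d - 2) * t)) * indicator {0<..} t \<partial>lborel)"
    proof (rule nn_integral_mono)
      fix t
      have "0 \<le> t0" by (simp add: t0_def)
      then show "ennreal (A\<^sup>2 / 4) * indicator {t0<..} t \<le> ennreal ((v (exp (- t)))\<^sup>2 * exp (- (real d - 2) * t)) * indicator {0<..} t"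
        using big[of t] by (cases "t0 < t") (auto intro!: ennreal_leI)
    qed
    finally show False using L2 by simp
  qed
  then have "h r = h 1" using Ioc_constant[of h r] h r by simp
  then show ?thesis using h1 pos[of r] by (simp add: h_def)
qed

section \<open>Moments, spherical harmonics and eigenvalues\<close>

text \<open>On the support of \<open>\<psi>\<close> the variable exp (-2 t) stays in [0,1], where
  Weierstrass approximates \<open>f\<close> uniformly by polynomials. Each polynomial integrates to
  zero, and the error is at most e times the L1 norm of \<open>\<psi>\<close>.\<close>

lemma integral_continuous_moments_zero:
  fixes \<psi> :: "real \<Rightarrow> real" and f :: "real \<Rightarrow> real"
  assumes i: "integrable lborel \<psi>" and supp: "\<And>t. t \<le> 0 \<Longrightarrow> \<psi> t = 0"
    and mom: "\<And>k::nat. (LINT t|lborel. \<psi> t * exp (- 2 * real k * t)) = 0"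
    and f: "continuous_on UNIV f"
  shows "(LINT t|lborel. \<psi> t * f (exp (- 2 * t))) = 0"
proof -
  have mult: "integrable lborel (\<lambda>t. \<psi> t * g (exp (- 2 * t)))" if g: "continuous_on UNIV g" for g :: "real \<Rightarrow> real"
  proof -
    have "compact (g ` {0..1})" by (intro compact_continuous_image continuous_on_subset[OF g]) auto
    then have "bounded (g ` {0..1})" by (rule compact_imp_bounded)
    then obtain C where C: "\<And>x. x \<in> {0..1} \<Longrightarrow> \<bar>g x\<bar> \<le> C"
      unfolding bounded_iff by (metis imageI real_norm_def)
    have [measurable]: "g \<in> borel_measurable borel" using g by (rule borel_measurable_continuous_onI)
    have [measurable]: "\<psi> \<in> borel_measurable borel" using i by simp
    show ?thesis
    proof (rule Bochner_Integration.integrable_bound[of _ "\<lambda>t. C * \<psi> t"])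
      show "integrable lborel (\<lambda>t. C * \<psi> t)" using i by simp
      have "norm (\<psi> t * g (exp (- 2 * t))) \<le> norm (C * \<psi> t)" for t
      proof (cases "0 < t")
        case True
        then have "\<bar>g (exp (- 2 * t))\<bar> \<le> C" by (intro C) auto
        then have "\<bar>\<psi> t\<bar> * \<bar>g (exp (- 2 * t))\<bar> \<le> \<bar>\<psi> t\<bar> * \<bar>C\<bar>" by (intro mult_left_mono) auto
        then show ?thesis by (simp add: abs_mult mult.commute)
      qed (use supp in auto)
      then show "AE t in lborel. norm (\<psi> t * g (exp (- 2 * t))) \<le> norm (C * \<psi> t)" by simp
    qed measurable
  qed
  have "\<bar>LINT t|lborel. \<psi> t * f (exp (- 2 * t))\<bar> \<le> e * (LINT t|lborel. \<bar>\<psi> t\<bar>)" if e: "0 < e" for e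
  proof -
    obtain p where p: "real_polynomial_function p" "\<And>x. x \<in> {0..1} \<Longrightarrow> \<bar>f x - p x\<bar> < e"
      using Stone_Weierstrass_real_polynomial_function[of "{0..1}" f e] continuous_on_subset[OF f] e by auto
    have pc: "continuous_on UNIV p"
      using p(1) continuous_on_polymonial_function real_polynomial_function_eq by blast
    obtain a n where a: "p = (\<lambda>x. \<Sum>i\<le>n. a i * x ^ i)"
      using p(1) unfolding real_polynomial_function_iff_sum by blast
    have "(LINT t|lborel. \<psi> t * p (exp (- 2 * t))) = (LINT t|lborel. (\<Sum>i\<le>n. a i * (\<psi> t * exp (- 2 * real i * t))))"
      unfolding a by (intro Bochner_Integration.integral_cong)
        (auto simp: sum_distrib_left exp_of_nat_mult[symmetric] mult_ac)
    also have "\<dots> = (\<Sum>i\<le>n. a i * (LINT t|lborel. \<psi> t * exp (- 2 * real i * t)))"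
    proof (subst Bochner_Integration.integral_sum)
      fix i
      have "integrable lborel (\<lambda>t. \<psi> t * (exp (- 2 * t)) ^ i)"
        by (rule mult[of "\<lambda>x. x ^ i"]) (intro continuous_intros)
      moreover have "exp (- 2 * t) ^ i = exp (- 2 * real i * t)" for t :: real
        by (simp add: exp_of_nat_mult[symmetric] mult_ac)
      ultimately show "integrable lborel (\<lambda>t. a i * (\<psi> t * exp (- 2 * real i * t)))"
        by (simp only: integrable_mult_right)
    qed simp
    also have "\<dots> = 0" using mom by simp
    finally have p0: "(LINT t|lborel. \<psi> t * p (exp (- 2 * t))) = 0" .
    have "(LINT t|lborel. \<psi> t * f (exp (- 2 * t))) = (LINT t|lborel. \<psi> t * f (exp (- 2 * t)) - \<psi> t * p (exp (- 2 * t)))"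
      using mult[OF f] mult[OF pc] p0 by simp
    also have "\<bar>\<dots>\<bar> \<le> (LINT t|lborel. \<bar>\<psi> t * f (exp (- 2 * t)) - \<psi> t * p (exp (- 2 * t))\<bar>)"
      by (rule integral_abs_bound)
    also have "\<dots> \<le> (LINT t|lborel. e * \<bar>\<psi> t\<bar>)"
    proof (rule integral_mono)
      fix t
      show "\<bar>\<psi> t * f (exp (- 2 * t)) - \<psi> t * p (exp (- 2 * t))\<bar> \<le> e * \<bar>\<psi> t\<bar>"
      proof (cases "0 < t")
        case True
        then have "\<bar>f (exp (- 2 * t)) - p (exp (- 2 * t))\<bar> \<le> e" by (intro less_imp_le p) auto
        then have "\<bar>\<psi> t\<bar> * \<bar>f (exp (- 2 * t)) - p (exp (- 2 * t))\<bar> \<le> \<bar>\<psi> t\<bar> * e" by (intro mult_left_mono) auto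
        then show ?thesis by (simp add: abs_mult[symmetric] right_diff_distrib mult.commute)
      qed (use supp in auto)
    qed (use i mult[OF f] mult[OF pc] in auto)
    finally show ?thesis by simp
  qed
  then show ?thesis by (rule zero_if_le_epsilon_mult[where C="LINT t|lborel. \<bar>\<psi> t\<bar>"]) (auto intro: Bochner_Integration.integral_nonneg)
qed

text \<open>Continuous ramps approximate the indicator of a half-line, so every tail integral of
  \<open>\<psi>\<close> is zero. The measures with densities \<open>ennreal (\<psi> t)\<close> and
  \<open>ennreal (- \<psi> t)\<close>, the positive and negative parts, then agree on half-lines and
  hence coincide.\<close>

lemma AE_zero_of_moments:
  fixes \<psi> :: "real \<Rightarrow> real"
  assumes i: "integrable lborel \<psi>" and supp: "\<And>t. t \<le> 0 \<Longrightarrow> \<psi> t = 0"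
    and mom: "\<And>k::nat. (LINT t|lborel. \<psi> t * exp (- 2 * real k * t)) = 0"
  shows "AE t in lborel. \<psi> t = 0"
proof -
  have [measurable]: "\<psi> \<in> borel_measurable borel" using i by simp
  have tail: "(LINT t|lborel. \<psi> t * indicator {a<..} t) = 0" for a
  proof -
    define y where "y = exp (- 2 * a)"
    \<comment> \<open>A ramp in x = exp (-2 t) that increases with n to the indicator of x < y, that
      is, of a < t.\<close>
    define f where "f n x = max 0 (min 1 (real n * (y - x)))" for n :: nat and x :: real
    have L: "(\<lambda>n. LINT t|lborel. \<psi> t * f n (exp (- 2 * t))) \<longlonglongrightarrow> (LINT t|lborel. \<psi> t * indicator {a<..} t)"
    proof (rule integral_dominated_convergence[where w="\<lambda>t. \<bar>\<psi> t\<bar>"])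
      show "AE t in lborel. (\<lambda>n. \<psi> t * f n (exp (- 2 * t))) \<longlonglongrightarrow> \<psi> t * indicator {a<..} t"
      proof (rule AE_I2, rule tendsto_mult_left)
        fix t
        show "(\<lambda>n. f n (exp (- 2 * t))) \<longlonglongrightarrow> indicator {a<..} t"
        proof (cases "a < t")
          case True
          then have "0 < y - exp (- 2 * t)" by (simp add: y_def)
          then obtain n0 where n0: "1 < real n0 * (y - exp (- 2 * t))" using reals_Archimedean3 by blast
          have "f n (exp (- 2 * t)) = 1" if "n0 \<le> n" for n
          proof -
            have "real n0 * (y - exp (- 2 * t)) \<le> real n * (y - exp (- 2 * t))"
              using that \<open>0 < y - exp (- 2 * t)\<close> by (intro mult_right_mono) auto
            then show ?thesis using n0 by (simp add: f_def)
          qed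
          then have "\<forall>\<^sub>F n in sequentially. f n (exp (- 2 * t)) = indicator {a<..} t"
            using True unfolding eventually_sequentially by auto
          then show ?thesis by (rule tendsto_eventually)
        next
          case False
          then have "y - exp (- 2 * t) \<le> 0" by (simp add: y_def)
          then have "f n (exp (- 2 * t)) = 0" for n
            using mult_nonneg_nonpos[of "real n" "y - exp (- 2 * t)"] by (simp add: f_def)
          then show ?thesis using False by simp
        qed
      qed
      show "AE t in lborel. norm (\<psi> t * f n (exp (- 2 * t))) \<le> \<bar>\<psi> t\<bar>" for n
        by (rule AE_I2) (auto simp: abs_mult f_def intro!: mult_left_le)
    qed (use i in \<open>auto simp: f_def\<close>)
    have Z: "(LINT t|lborel. \<psi> t * f n (exp (- 2 * t))) = 0" for n
      by (rule integral_continuous_moments_zero[OF assms]) (auto simp: f_def intro!: continuous_intros)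
    show ?thesis using L unfolding Z by (simp add: LIMSEQ_const_iff)
  qed
  have eq: "(\<integral>\<^sup>+ t. ennreal (\<psi> t) * indicator {a<..} t \<partial>lborel) = (\<integral>\<^sup>+ t. ennreal (- \<psi> t) * indicator {a<..} t \<partial>lborel)"
    and fin: "(\<integral>\<^sup>+ t. ennreal (\<psi> t) * indicator {a<..} t \<partial>lborel) < \<infinity>" for a
  proof -
    have ia: "integrable lborel (\<lambda>t. \<psi> t * indicator {a<..} t)"
      using i by (rule integrable_real_mult_indicator[rotated]) simp
    have e: "(\<integral>\<^sup>+ t. ennreal (\<psi> t) * indicator {a<..} t \<partial>lborel) = (\<integral>\<^sup>+ t. ennreal (\<psi> t * indicator {a<..} t) \<partial>lborel)"
      "(\<integral>\<^sup>+ t. ennreal (- \<psi> t) * indicator {a<..} t \<partial>lborel) = (\<integral>\<^sup>+ t. ennreal (- (\<psi> t * indicator {a<..} t)) \<partial>lborel)"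
      by (auto intro!: nn_integral_cong simp: indicator_def)
    have f: "(\<integral>\<^sup>+ t. ennreal (\<psi> t * indicator {a<..} t) \<partial>lborel) < \<infinity>"
      "(\<integral>\<^sup>+ t. ennreal (- (\<psi> t * indicator {a<..} t)) \<partial>lborel) < \<infinity>"
      using ia by (auto simp: real_integrable_def less_top)
    have "enn2real (\<integral>\<^sup>+ t. ennreal (\<psi> t * indicator {a<..} t) \<partial>lborel) = enn2real (\<integral>\<^sup>+ t. ennreal (- (\<psi> t * indicator {a<..} t)) \<partial>lborel)"
      using real_lebesgue_integral_def[OF ia] tail[of a] by simp
    then show "(\<integral>\<^sup>+ t. ennreal (\<psi> t) * indicator {a<..} t \<partial>lborel) = (\<integral>\<^sup>+ t. ennreal (- \<psi> t) * indicator {a<..} t \<partial>lborel)"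
      using f unfolding e by (metis ennreal_enn2real infinity_ennreal_def)
    show "(\<integral>\<^sup>+ t. ennreal (\<psi> t) * indicator {a<..} t \<partial>lborel) < \<infinity>" using f unfolding e by simp
  qed
  have "density lborel (\<lambda>t. ennreal (\<psi> t)) = density lborel (\<lambda>t. ennreal (- \<psi> t))"
    by (rule measure_eqI_lessThan) (simp_all add: emeasure_density eq fin[unfolded eq infinity_ennreal_def])
  then have "AE t in lborel. ennreal (\<psi> t) = ennreal (- \<psi> t)"
    by (intro sigma_finite_measure.density_unique[OF sigma_finite_lborel]) auto
  then show ?thesis
  proof eventually_elim
    case (elim t)
    then show ?case by (cases "0 \<le> \<psi> t") (auto simp: ennreal_neg)
  qed
qed

section \<open>A nonzero spherical harmonic of every degree\<close>

definition plane_coord :: "'a::euclidean_space \<Rightarrow> 'a \<Rightarrow> 'a \<Rightarrow> complex" where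
  "plane_coord e1 e2 x = Complex (x \<bullet> e1) (x \<bullet> e2)"

lemma plane_power_polynomial:
  "real_polynomial_function (\<lambda>x. Re (plane_coord e1 e2 x ^ k)) \<and> real_polynomial_function (\<lambda>x. Im (plane_coord e1 e2 x ^ k))"
proof (induction k)
  case (Suc k)
  have "real_polynomial_function (\<lambda>x. x \<bullet> e)" for e :: 'a
    by (intro real_polynomial_function.intros(1) bounded_linear_inner_left)
  then show ?case using Suc
    by (auto simp: plane_coord_def intro!: real_polynomial_function_diff real_polynomial_function.intros(3,4))
qed (auto intro: real_polynomial_function.intros)

text \<open>The second derivative of z^k along e carries the factor z(e)^2, where z is the complex
  coordinate. Over the basis these factors add up to 1 + i^2 = 0. The truncated exponents k - 1 and
  k - 2 are harmless, since k (k - 1) vanishes for k < 2.\<close>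

lemma laplacian_plane_power:
  assumes e: "e1 \<in> Basis" "e2 \<in> Basis" "e1 \<noteq> e2"
  shows "laplacian (\<lambda>x. Re (plane_coord e1 e2 x ^ k)) (x::'a::euclidean_space) = 0"
proof -
  let ?z = "plane_coord e1 e2"
  have add: "?z (x + t *\<^sub>R e) = ?z x + of_real t * ?z e" for e t
    by (simp add: plane_coord_def complex_eq_iff inner_add_left)
  have d: "((\<lambda>t. Re (c * (?z x + of_real t * w) ^ n)) has_real_derivative Re (c * (of_nat n * w) * (?z x + of_real t * w) ^ (n - 1))) (at t)" for c w n t
  proof -
    have "((\<lambda>s. c * (?z x + s * w) ^ n) has_field_derivative c * (of_nat n * w) * (?z x + of_real t * w) ^ (n - 1)) (at (of_real t))"
      by (auto intro!: derivative_eq_intros)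
    then have "((\<lambda>t. c * (?z x + of_real t * w) ^ n) has_vector_derivative c * (of_nat n * w) * (?z x + of_real t * w) ^ (n - 1)) (at t)"
      by (rule has_vector_derivative_real_field)
    from bounded_linear.has_vector_derivative[OF bounded_linear_Re this]
    show ?thesis by (simp add: has_real_derivative_iff_has_vector_derivative)
  qed
  have "deriv (deriv (\<lambda>t. Re (?z (x + t *\<^sub>R e) ^ k))) 0 = Re (of_nat k * of_nat (k - 1) * (?z e)\<^sup>2 * ?z x ^ (k - 2))" for e
  proof -
    have "deriv (\<lambda>t. Re (?z (x + t *\<^sub>R e) ^ k)) = (\<lambda>t. Re ((of_nat k * ?z e) * (?z x + of_real t * ?z e) ^ (k - 1)))"
      unfolding add using d[of 1 "?z e" k] by (intro ext DERIV_imp_deriv) simp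
    then show ?thesis using DERIV_imp_deriv[OF d[of "of_nat k * ?z e" "?z e" "k - 1" 0]]
      by (simp add: power2_eq_square mult_ac numeral_2_eq_2)
  qed
  then have "laplacian (\<lambda>x. Re (?z x ^ k)) x = (\<Sum>e\<in>Basis. Re (of_nat k * of_nat (k - 1) * (?z e)\<^sup>2 * ?z x ^ (k - 2)))"
    by (simp add: laplacian_def)
  also have "\<dots> = Re (of_nat k * of_nat (k - 1) * (\<Sum>e\<in>Basis. (?z e)\<^sup>2) * ?z x ^ (k - 2))"
    by (simp only: Re_sum[symmetric] sum_distrib_left sum_distrib_right)
  also have "(\<Sum>e\<in>Basis. (?z e)\<^sup>2) = (\<Sum>e\<in>{e1, e2}. (?z e)\<^sup>2)"
    using e by (intro sum.mono_neutral_right) (auto simp: plane_coord_def inner_Basis complex_eq_iff power2_eq_square)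
  also have "\<dots> = 0"
    using e by (simp add: plane_coord_def inner_Basis complex_eq_iff power2_eq_square)
  finally show ?thesis by simp
qed

text \<open>The integrability condition in \<open>radial_solution\<close> ranges over all harmonics
  of degree k, so it excludes a second solution only if some harmonic is nonzero. Two coordinate
  directions are available because the dimension is at least 2.\<close>

lemma exists_spherical_harmonic:
  assumes "2 \<le> DIM('a::euclidean_space)"
  obtains P :: "'a::euclidean_space \<Rightarrow> real" where "spherical_harmonic k P" "continuous_on UNIV P"
    "\<And>c x. P (c *\<^sub>R x) = c ^ k * P x" "\<And>x. \<bar>P x\<bar> \<le> norm x ^ k" "\<exists>x. P x \<noteq> 0"
proof -
  obtain e1 e2 :: 'a where e: "e1 \<in> Basis" "e2 \<in> Basis" "e1 \<noteq> e2"
    using assms by (metis card_le_Suc0_iff_eq finite_Basis not_less_eq_eq numeral_2_eq_2)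
  let ?z = "plane_coord e1 e2" and ?P = "\<lambda>x. Re (plane_coord e1 e2 x ^ k)"
  have sc: "?z (c *\<^sub>R x) = of_real c * ?z x" for c x
    by (simp add: plane_coord_def complex_eq_iff)
  have hom: "?P (c *\<^sub>R x) = c ^ k * ?P x" for c x
    unfolding sc power_mult_distrib of_real_power[symmetric] by simp
  have pol: "real_polynomial_function ?P" using plane_power_polynomial by blast
  show ?thesis
  proof
    show "spherical_harmonic k ?P"
      unfolding spherical_harmonic_def using pol hom laplacian_plane_power[OF e] by (intro exI[of _ ?P]) auto
    show "continuous_on UNIV ?P"
      using pol continuous_on_polymonial_function real_polynomial_function_eq by blast
    show "?P (c *\<^sub>R x) = c ^ k * ?P x" for c x by (rule hom)
    have "?P e1 = 1" using e by (simp add: plane_coord_def inner_Basis complex_eq_iff Complex_eq_1)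
    then show "\<exists>x. ?P x \<noteq> 0" by (intro exI[of _ e1]) simp
    show "\<bar>?P x\<bar> \<le> norm x ^ k" for x
    proof -
      have "\<bar>?P x\<bar> \<le> cmod (?z x) ^ k" using abs_Re_le_cmod[of "?z x ^ k"] by (simp add: norm_power)
      also have "cmod (?z x) \<le> norm x"
      proof -
        have "(x \<bullet> e1)\<^sup>2 + (x \<bullet> e2)\<^sup>2 = (\<Sum>e\<in>{e1, e2}. (x \<bullet> e)\<^sup>2)" using e(3) by simp
        also have "\<dots> \<le> (\<Sum>e\<in>Basis. (x \<bullet> e)\<^sup>2)" using e by (intro sum_mono2) auto
        also have "\<dots> = (norm x)\<^sup>2" unfolding power2_norm_eq_inner euclidean_inner[of x x] by (simp add: power2_eq_square)
        finally show ?thesis unfolding plane_coord_def cmod_def by (intro real_le_lsqrt) auto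
      qed
      then have "cmod (?z x) ^ k \<le> norm x ^ k" by (rule power_mono) simp
      finally show ?thesis .
    qed
  qed
qed

section \<open>Weighted square integrability in the logarithmic variable\<close>

lemma borel_continuous_Ioc_compose:
  fixes v :: "real \<Rightarrow> real"
  assumes "continuous_on {0<..1} v"
  shows "(\<lambda>t. indicator {0<..} t * v (exp (- t))) \<in> borel_measurable borel"
proof -
  have "continuous_on {0<..} (\<lambda>t. v (exp (- t)))"
    by (rule continuous_on_compose2[OF assms]) (auto intro!: continuous_intros)
  from borel_measurable_continuous_on_indicator[OF _ this] show ?thesis by simp
qed

text \<open>Polar coordinates with the angular weight P^2 factor the integral into a constant
  \<open>C\<close> and a radial integral, in which norm x ^ (-2) becomes exp (2 t). As 0 < C,
  finiteness passes to the radial factor.\<close>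

lemma weighted_L2_imp_log_L2:
  fixes v :: "real \<Rightarrow> real" and P :: "'a::euclidean_space \<Rightarrow> real"
  assumes L2: "in_weighted_L2 (\<lambda>x::'a. v (norm x) * P (x /\<^sub>R norm x))"
    and P: "continuous_on UNIV P" "\<And>c x. P (c *\<^sub>R x) = c ^ k * P x" "\<And>x. \<bar>P x\<bar> \<le> norm x ^ k" "\<exists>x. P x \<noteq> 0"
    and v: "continuous_on {0<..1} v"
  shows "(\<integral>\<^sup>+ t. ennreal ((v (exp (- t)))\<^sup>2 * exp (- (real DIM('a) - 2) * t)) * indicator {0<..} t \<partial>lborel) < \<infinity>"
proof -
  have [measurable]: "P \<in> borel_measurable borel" using P(1) by (rule borel_measurable_continuous_onI)
  define g :: "'a \<Rightarrow> ennreal" where "g x = ennreal ((P (x /\<^sub>R norm x))\<^sup>2)" for x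
  have [measurable]: "g \<in> borel_measurable borel" unfolding g_def by measurable
  have gm: "(\<lambda>x. g x * indicator (ball 0 1) x) \<in> borel_measurable lborel"
    using borel_measurable_times_ennreal[OF \<open>g \<in> borel_measurable borel\<close> borel_measurable_indicator[of "ball 0 1" borel]] by simp
  have hom: "g (c *\<^sub>R x) = g x" if "0 < c" for c x
  proof -
    have "inverse (c * norm x) * c = inverse (norm x)" using that by (simp add: field_simps)
    then have "(c *\<^sub>R x) /\<^sub>R norm (c *\<^sub>R x) = x /\<^sub>R norm x"
      using that by (simp only: norm_scaleR scaleR_scaleR abs_of_pos)
    then show ?thesis by (simp only: g_def)
  qed
  define C where "C = (\<integral>\<^sup>+ x. g x * indicator (ball 0 1) x \<partial>lborel)"
  have "g x \<le> 1" for x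
  proof -
    have "\<bar>P (x /\<^sub>R norm x)\<bar> \<le> 1"
    proof (rule order_trans[OF P(3)])
      show "norm (x /\<^sub>R norm x) ^ k \<le> 1" by (cases "x = 0") (auto intro!: power_le_one)
    qed
    then show ?thesis unfolding g_def by (simp add: abs_square_le_1)
  qed
  then have "C \<le> (\<integral>\<^sup>+ x. indicator (ball (0::'a) 1) x \<partial>lborel)"
    unfolding C_def by (intro nn_integral_mono) (auto simp: indicator_def)
  then have Cfin: "C < \<infinity>" using emeasure_lborel_ball_finite[of "0::'a" 1] by (simp add: le_less_trans)
  \<comment> \<open>By continuity and homogeneity P is nonzero on a nonempty open subset of the
    punctured ball, which cannot be a null set.\<close>
  have C0: "C \<noteq> 0"
  proof
    assume "C = 0"
    then have "AE x in lborel. g x * indicator (ball 0 1) x = 0"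
      using nn_integral_0_iff_AE[OF gm] by (simp add: C_def)
    then have "AE x in lebesgue. g x * indicator (ball 0 1) x = 0" by (rule AE_completion)
    then obtain N where N: "N \<in> null_sets lebesgue" "{x. \<not> (g x * indicator (ball 0 1) x = 0)} \<subseteq> N"
      by (auto simp: eventually_ae_filter)
    obtain x0 where x0: "P x0 \<noteq> 0" using P(4) by blast
    define S where "S = {x. P x \<noteq> 0} \<inter> (ball 0 1 - {0})"
    have "open {x. P x \<noteq> 0}" using P(1) by (intro open_Collect_neq continuous_on_const)
    then have "open S" unfolding S_def by (intro open_Int open_Diff) auto
    moreover have "S \<subseteq> N"
    proof
      fix x assume x: "x \<in> S"
      then have "P (x /\<^sub>R norm x) \<noteq> 0" by (simp add: S_def P(2))
      then show "x \<in> N" using N(2) x by (auto simp: S_def g_def)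
    qed
    then have "negligible S" using N(1) negligible_subset by (auto simp: negligible_iff_null_sets)
    moreover have "S \<noteq> {}"
    proof (cases "x0 = 0")
      \<comment> \<open>A homogeneous P can be nonzero at the origin only for k = 0, and then it is
        constant.\<close>
      case True
      then have "k = 0" using P(2)[of 0 0] x0 by (cases k) auto
      then have "P x \<noteq> 0" for x using P(2)[of 0 x] x0 True by simp
      moreover obtain e :: 'a where "e \<in> Basis" using nonempty_Basis by blast
      ultimately have "(1/2) *\<^sub>R e \<in> S" by (auto simp: S_def)
      then show ?thesis by blast
    next
      case False
      then have "(1 / (2 * norm x0)) *\<^sub>R x0 \<in> S" using x0 by (simp add: S_def P(2))
      then show ?thesis by blast
    qed
    ultimately show False using open_not_negligible by blast
  qed
  define f where "f t = ennreal ((indicator {0<..} t * v (exp (- t)))\<^sup>2 * exp (2 * t))" for t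
  have [measurable]: "f \<in> borel_measurable borel"
    using borel_continuous_Ioc_compose[OF v] unfolding f_def by measurable
  let ?F = "\<lambda>x::'a. (v (norm x) * P (x /\<^sub>R norm x))\<^sup>2 / (norm x)\<^sup>2"
  have int: "?F absolutely_integrable_on ball 0 1" using L2 by (simp add: in_weighted_L2_def)
  have "(\<integral>\<^sup>+ x. g x * f (- ln (norm x)) * indicator (ball 0 1) x \<partial>lborel)
    = (\<integral>\<^sup>+ x. g x * f (- ln (norm x)) * indicator (ball 0 1) x \<partial>lebesgue)"
    by (rule nn_integral_completion[symmetric])
  also have "\<dots> = (\<integral>\<^sup>+ x. ennreal (norm (indicator (ball 0 1) x *\<^sub>R ?F x)) \<partial>lebesgue)"
  proof (rule nn_integral_cong)
    fix x :: 'a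
    have "exp (2 * - ln (norm x)) = 1 / (norm x)\<^sup>2" if "x \<noteq> 0"
      using that exp_of_nat_mult[of 2 "ln (norm x)"] by (simp add: exp_minus divide_inverse)
    then have "(P (x /\<^sub>R norm x))\<^sup>2 * ((v (norm x))\<^sup>2 * exp (2 * - ln (norm x))) = ?F x" if "x \<noteq> 0"
      using that by (simp add: power_mult_distrib)
    then show "g x * f (- ln (norm x)) * indicator (ball 0 1) x = ennreal (norm (indicator (ball 0 1) x *\<^sub>R ?F x))"
      by (cases "x = 0") (auto simp: f_def g_def indicator_def ennreal_mult[symmetric])
  qed
  also have "\<dots> < \<infinity>"
    using int unfolding set_integrable_def integrable_iff_bounded by simp
  finally have fin: "(\<integral>\<^sup>+ x. g x * f (- ln (norm x)) * indicator (ball 0 1) x \<partial>lborel) < \<infinity>" .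
  have "C * (\<integral>\<^sup>+ t. f t * ennreal (real DIM('a) * exp (- real DIM('a) * t)) * indicator {0<..} t \<partial>lborel) < \<infinity>"
    using fin by (subst nn_integral_polar[OF _ hom C_def Cfin, symmetric]) auto
  then have 1: "(\<integral>\<^sup>+ t. f t * ennreal (real DIM('a) * exp (- real DIM('a) * t)) * indicator {0<..} t \<partial>lborel) < \<infinity>"
    using C0 by (auto simp: ennreal_mult_less_top)
  have "(\<integral>\<^sup>+ t. ennreal ((v (exp (- t)))\<^sup>2 * exp (- (real DIM('a) - 2) * t)) * indicator {0<..} t \<partial>lborel)
    \<le> (\<integral>\<^sup>+ t. f t * ennreal (real DIM('a) * exp (- real DIM('a) * t)) * indicator {0<..} t \<partial>lborel)"
  proof (rule nn_integral_mono)
    fix t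
    have "exp (- (real DIM('a) - 2) * t) = exp (2 * t) * exp (- real DIM('a) * t)"
      by (simp add: exp_add[symmetric] algebra_simps)
    also have "\<dots> \<le> exp (2 * t) * (real DIM('a) * exp (- real DIM('a) * t))"
      using DIM_positive[where 'a='a] by (intro mult_left_mono) (auto simp: Suc_le_eq simp flip: of_nat_le_iff)
    finally have "(v (exp (- t)))\<^sup>2 * exp (- (real DIM('a) - 2) * t) \<le> (v (exp (- t)))\<^sup>2 * (exp (2 * t) * (real DIM('a) * exp (- real DIM('a) * t)))"
      by (rule mult_left_mono) simp
    then show "ennreal ((v (exp (- t)))\<^sup>2 * exp (- (real DIM('a) - 2) * t)) * indicator {0<..} t
      \<le> f t * ennreal (real DIM('a) * exp (- real DIM('a) * t)) * indicator {0<..} t"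
      by (cases "0 < t") (auto simp: f_def ennreal_mult[symmetric] mult.assoc intro!: ennreal_leI)
  qed
  then show ?thesis using 1 by (rule le_less_trans)
qed

text \<open>The harmonic is bounded on the compact sphere, and decay, weight and Jacobian combine to
  a multiple of exp (-(2 a + d - 2) t), with d = \<open>DIM('a)\<close>.\<close>

lemma in_weighted_L2_decaying:
  fixes u :: "real \<Rightarrow> real" and Y :: "'a::euclidean_space \<Rightarrow> real"
  assumes u: "continuous_on {0<..1} u"
    and bound: "\<And>t. 0 < t \<Longrightarrow> \<bar>u (exp (- t))\<bar> \<le> exp (- a * t)" and a: "0 < 2 * a + real DIM('a) - 2"
    and Y: "spherical_harmonic k Y"
  shows "in_weighted_L2 (\<lambda>x::'a. u (norm x) * Y (x /\<^sub>R norm x))"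
proof -
  obtain P where P: "real_polynomial_function P" "\<And>\<omega>. \<omega> \<in> sphere 0 1 \<Longrightarrow> Y \<omega> = P \<omega>"
    using Y unfolding spherical_harmonic_def by blast
  have Pc: "continuous_on UNIV P"
    using P(1) continuous_on_polymonial_function real_polynomial_function_eq by blast
  have "bounded (P ` sphere 0 1)"
    by (intro compact_imp_bounded compact_continuous_image continuous_on_subset[OF Pc] compact_sphere) auto
  then obtain K where K: "\<And>\<omega>. \<omega> \<in> sphere 0 1 \<Longrightarrow> \<bar>P \<omega>\<bar> \<le> K"
    unfolding bounded_iff by (metis imageI real_norm_def)
  let ?f = "\<lambda>x::'a. u (norm x) * Y (x /\<^sub>R norm x)"
  let ?S = "ball (0::'a) 1 - {0}"
  \<comment> \<open>\<open>Y\<close> is prescribed only on the sphere, and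
    \<open>x /\<^sub>R norm x\<close> is 0 for x = 0. So \<open>F\<close> uses the polynomial away
    from the origin, and the value at 0 is restored as a separate term when measurability is
    shown.\<close>
  define F where "F x = indicator ?S x * (u (norm x) * P (x /\<^sub>R norm x))" for x :: 'a
  have "continuous_on ?S (\<lambda>x. u (norm x) * P (x /\<^sub>R norm x))"
    by (intro continuous_intros continuous_on_compose2[OF u] continuous_on_compose2[OF Pc]) auto
  from borel_measurable_continuous_on_indicator[OF _ this]
  have F[measurable]: "F \<in> borel_measurable borel" by (simp add: F_def[abs_def])
  have fF: "?f x = F x" if "x \<in> ?S" for x
    using that P(2)[of "x /\<^sub>R norm x"] by (simp add: F_def)
  have "?f \<in> borel_measurable (lebesgue_on (ball 0 1)) \<longleftrightarrow> (\<lambda>x. F x + ?f 0 * indicator {0} x) \<in> borel_measurable (lebesgue_on (ball 0 1))"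
    by (rule measurable_cong) (use fF in \<open>auto simp: F_def indicator_def\<close>)
  moreover have "(\<lambda>x. F x + ?f 0 * indicator {0} x) \<in> borel_measurable (lebesgue_on (ball 0 1))"
  proof -
    have "(\<lambda>x. F x + ?f 0 * indicator {0} x) \<in> borel_measurable borel"
      by (intro borel_measurable_add F borel_measurable_times borel_measurable_indicator) auto
    then have "(\<lambda>x. F x + ?f 0 * indicator {0} x) \<in> borel_measurable lebesgue"
      by (simp add: measurable_completion)
    then show ?thesis by (rule measurable_restrict_space1)
  qed
  ultimately have meas: "?f \<in> borel_measurable (lebesgue_on (ball 0 1))" by blast
  have eq: "indicator (ball 0 1) x *\<^sub>R ((?f x)\<^sup>2 / (norm x)\<^sup>2) = (F x)\<^sup>2 / (norm x)\<^sup>2" for x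
  proof (cases "x \<in> ?S")
    case True
    then have "indicator (ball 0 1) x = (1::real)" by simp
    then show ?thesis by (simp only: fF[OF True] scaleR_one)
  qed (auto simp: F_def)
  have "(\<integral>\<^sup>+ x. ennreal (norm ((F x)\<^sup>2 / (norm x)\<^sup>2)) \<partial>lebesgue) = (\<integral>\<^sup>+ x. ennreal ((F x)\<^sup>2 / (norm x)\<^sup>2) \<partial>lborel)"
    by (simp add: nn_integral_completion)
  also have "\<dots> \<le> (\<integral>\<^sup>+ x. ennreal (K\<^sup>2 * (exp (- 2 * a * (- ln (norm x))) * exp (2 * (- ln (norm x))))) * indicator (ball (0::'a) 1) x \<partial>lborel)"
  proof (rule nn_integral_mono)
    fix x :: 'a
    show "ennreal ((F x)\<^sup>2 / (norm x)\<^sup>2) \<le> ennreal (K\<^sup>2 * (exp (- 2 * a * (- ln (norm x))) * exp (2 * (- ln (norm x))))) * indicator (ball 0 1) x"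
    proof (cases "x \<in> ?S")
      case True
      define t where "t = - ln (norm x)"
      have t: "0 < t" "norm x = exp (- t)" using True by (auto simp: t_def)
      have "(F x)\<^sup>2 = (P (x /\<^sub>R norm x))\<^sup>2 * (u (exp (- t)))\<^sup>2" using True by (simp add: F_def t(2)[symmetric] power_mult_distrib)
      also have "\<dots> \<le> K\<^sup>2 * (exp (- a * t))\<^sup>2"
      proof (rule mult_mono)
        show "(P (x /\<^sub>R norm x))\<^sup>2 \<le> K\<^sup>2"
          by (subst power2_abs[symmetric], rule power_mono) (use K[of "x /\<^sub>R norm x"] True in auto)
        show "(u (exp (- t)))\<^sup>2 \<le> (exp (- a * t))\<^sup>2"
          by (subst power2_abs[symmetric], rule power_mono) (use bound[OF t(1)] in auto)
      qed auto
      also have "(exp (- a * t))\<^sup>2 = exp (- 2 * a * t)" by (simp add: power2_eq_square exp_add[symmetric])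
      finally have "(F x)\<^sup>2 / (norm x)\<^sup>2 \<le> K\<^sup>2 * exp (- 2 * a * t) / (norm x)\<^sup>2" by (rule divide_right_mono) simp
      also have "\<dots> = K\<^sup>2 * (exp (- 2 * a * t) * exp (2 * t))"
        unfolding t(2) by (simp add: power2_eq_square exp_add[symmetric] exp_minus field_simps)
      finally show ?thesis using True unfolding t_def by (auto intro!: ennreal_leI)
    qed (auto simp: F_def)
  qed
  also have "\<dots> = ennreal (sphere_area TYPE('a)) * (\<integral>\<^sup>+ t. ennreal (K\<^sup>2 * (exp (- 2 * a * t) * exp (2 * t))) * ennreal (exp (- real DIM('a) * t)) * indicator {0<..} t \<partial>lborel)"
    by (rule nn_integral_radial) simp
  also have "\<dots> < \<infinity>"
  proof -
    define l where "l = 2 * a + real DIM('a) - 2"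
    have l: "0 < l" using a by (simp add: l_def)
    have "(\<integral>\<^sup>+ t. ennreal (K\<^sup>2 * (exp (- 2 * a * t) * exp (2 * t))) * ennreal (exp (- real DIM('a) * t)) * indicator {0<..} t \<partial>lborel)
      \<le> (\<integral>\<^sup>+ t. ennreal (K\<^sup>2 / l) * (ennreal (l * exp (- l * t)) * indicator {0..} t) \<partial>lborel)"
    proof (rule nn_integral_mono)
      fix t
      have "K\<^sup>2 * (exp (- 2 * a * t) * exp (2 * t)) * exp (- real DIM('a) * t) = K\<^sup>2 / l * (l * exp (- l * t))"
      proof -
        have "exp (- 2 * a * t) * exp (2 * t) * exp (- real DIM('a) * t) = exp (- l * t)"
          by (simp add: l_def exp_add[symmetric] algebra_simps)
        then show ?thesis using l by (simp add: mult.assoc)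
      qed
      then have "ennreal (K\<^sup>2 * (exp (- 2 * a * t) * exp (2 * t))) * ennreal (exp (- real DIM('a) * t)) = ennreal (K\<^sup>2 / l) * ennreal (l * exp (- l * t))"
        using l by (simp add: ennreal_mult[symmetric])
      then show "ennreal (K\<^sup>2 * (exp (- 2 * a * t) * exp (2 * t))) * ennreal (exp (- real DIM('a) * t)) * indicator {0<..} t
        \<le> ennreal (K\<^sup>2 / l) * (ennreal (l * exp (- l * t)) * indicator {0..} t)"
        by (auto simp: indicator_def)
    qed
    also have "\<dots> = ennreal (K\<^sup>2 / l) * ennreal (exp (- l * 0))"
      by (subst nn_integral_cmult, simp) (simp only: nn_integral_exp_tail[OF l])
    also have "\<dots> < \<infinity>" by (simp add: ennreal_mult_less_top)
    finally show ?thesis by (simp add: ennreal_mult_less_top)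
  qed
  finally have "(\<lambda>x. (?f x)\<^sup>2 / (norm x)\<^sup>2) absolutely_integrable_on ball 0 1"
    unfolding set_integrable_def eq integrable_iff_bounded by (auto simp: measurable_completion)
  with meas show ?thesis by (simp add: in_weighted_L2_def)
qed

section \<open>Null sets in the radial variable\<close>

lemma norm_eq_exp: "x \<noteq> 0 \<Longrightarrow> norm x = exp (- (- ln (norm (x::'a::real_normed_vector))))"
  by simp

lemma AE_not_zero_restrict: "AE x in lebesgue_on S. x \<noteq> (0::'a::euclidean_space)" if "S \<in> sets lebesgue"
proof -
  have "AE x in lebesgue. x \<noteq> (0::'a)" by (intro AE_completion AE_lborel_singleton)
  then show ?thesis using that by (subst AE_restrict_space_iff) (auto elim: eventually_mono)
qed

lemma AE_norm_iff:
  assumes [measurable]: "Measurable.pred borel P"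
  shows "(AE x in lebesgue_on (ball (0::'a::euclidean_space) 1). P (norm x)) \<longleftrightarrow> (AE t in lborel. 0 < t \<longrightarrow> P (exp (- t)))"
proof -
  have "(AE x in lebesgue_on (ball (0::'a) 1). P (norm x)) \<longleftrightarrow> (AE x in lebesgue_on (ball (0::'a) 1). P (exp (- (- ln (norm x)))))"
  proof (rule eventually_cong)
    show "AE x in lebesgue_on (ball (0::'a) 1). x \<noteq> 0" by (rule AE_not_zero_restrict) simp
  qed (simp add: norm_eq_exp[symmetric])
  also have "\<dots> \<longleftrightarrow> (AE t in lborel. 0 < t \<longrightarrow> P (exp (- t)))"
    by (rule AE_radial_iff) measurable
  finally show ?thesis .
qed

text \<open>The interval is the positive half of the one-dimensional unit ball, so this is
  \<open>AE_norm_iff\<close> in dimension one; a reflection supplies the negative half.\<close>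

lemma AE_Ioo_iff:
  fixes P :: "real \<Rightarrow> bool"
  assumes [measurable]: "Measurable.pred borel P"
  shows "(AE r in lebesgue_on {0<..<1}. P r) \<longleftrightarrow> (AE t in lborel. 0 < t \<longrightarrow> P (exp (- t)))"
proof
  assume "AE t in lborel. 0 < t \<longrightarrow> P (exp (- t))"
  then have "AE x in lebesgue_on (ball (0::real) 1). P (norm x)" by (subst AE_norm_iff) auto
  then have "AE x in lebesgue. x \<in> ball (0::real) 1 \<longrightarrow> P (norm x)" by (subst (asm) AE_restrict_space_iff) auto
  then show "AE r in lebesgue_on {0<..<1}. P r"
    by (subst AE_restrict_space_iff) (auto elim!: eventually_mono)
next
  assume "AE r in lebesgue_on {0<..<1}. P r"
  then have "AE r in lebesgue. r \<in> {0<..<1} \<longrightarrow> P r" by (subst (asm) AE_restrict_space_iff) auto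
  then have 1: "AE r in lborel. r \<in> {0<..<1} \<longrightarrow> P r" by (subst (asm) AE_completion_iff) auto
  then have 2: "AE r in lborel. (0 + (-1) * r) \<in> {0<..<1} \<longrightarrow> P (0 + (-1) * r)"
    by (intro AE_borel_affine[of "-1" "\<lambda>r. r \<in> {0<..<1} \<longrightarrow> P r" 0]) auto
  have "AE x in lborel. x \<in> ball (0::real) 1 \<longrightarrow> P (norm x)"
    using 1 2 AE_lborel_singleton[of "0::real"] by eventually_elim (auto simp: abs_if)
  then have "AE x in lebesgue. x \<in> ball (0::real) 1 \<longrightarrow> P (norm x)" by (rule AE_completion)
  then have "AE x in lebesgue_on (ball (0::real) 1). P (norm x)" by (subst AE_restrict_space_iff) auto
  then show "AE t in lborel. 0 < t \<longrightarrow> P (exp (- t))" by (subst (asm) AE_norm_iff) auto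
qed

lemma radial_profile_unique:
  fixes V :: "'a::euclidean_space \<Rightarrow> real"
  assumes "radial_profile V q" "radial_profile V q'"
  shows "AE r in lebesgue_on {0<..<1}. q' r = q r"
proof -
  have [measurable]: "q \<in> borel_measurable borel" "q' \<in> borel_measurable borel"
    using assms by (simp_all add: radial_profile_def)
  have "AE x in lebesgue_on (ball (0::'a) 1). q' (norm x) = q (norm x)"
    using assms unfolding radial_profile_def by (auto elim: eventually_elim2)
  then show ?thesis by (subst AE_Ioo_iff, simp, subst (asm) AE_norm_iff) auto
qed

lemma solves_radial_ode_continuous:
  assumes "solves_radial_ode d q k v" shows "continuous_on {0<..1} v"
  using assms unfolding solves_radial_ode_def by (auto intro: DERIV_continuous_on)

text \<open>At r = 1 the solution is 1 and its logarithmic derivative is k + n(0). Uniqueness turns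
  this derivative into the value of the definite description. A competing solution may come with
  another profile of V, but two profiles agree almost everywhere.\<close>

lemma dn_eigenvalue_eq:
  fixes V :: "'a::euclidean_space \<Rightarrow> real"
  assumes d: "2 \<le> DIM('a)" and q: "radial_profile V q"
    and N: "N = 2 * k + (DIM('a) - 2)" and b: "exp_bounded (log_potential q) M (real N)" "12 * M \<le> real N"
  shows "dn_eigenvalue V k = real k + lap_diff (log_potential q) (real N) 0"
proof -
  let ?u = "regular_solution q k N"
  let ?l = "real k + lap_diff (log_potential q) (real N) 0"
  have M: "0 \<le> M" "0 < real N" using exp_boundedD[OF b(1)] by auto
  have N1: "N + 1 = 2 * k + (DIM('a) - 1)" using N d by simp
  have ode: "solves_radial_ode DIM('a) q k ?u" by (rule regular_solution_ode[OF b(1) N1 d])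
  have RN: "real N = 2 * real k + real DIM('a) - 2" using N d by (simp add: of_nat_diff)
  have sol: "radial_solution V k ?u"
    unfolding radial_solution_def
  proof (intro conjI allI impI exI)
    show "radial_profile V q" "solves_radial_ode DIM('a) q k ?u" "?u 1 = 1"
      by (rule q ode regular_solution_1)+
    fix Y :: "'a \<Rightarrow> real" assume Y: "spherical_harmonic k Y"
    show "in_weighted_L2 (\<lambda>x. ?u (norm x) * Y (x /\<^sub>R norm x))"
    proof (rule in_weighted_L2_decaying[OF solves_radial_ode_continuous[OF ode] _ _ Y, where a="real k - 2 * M"])
      show "\<bar>?u (exp (- t))\<bar> \<le> exp (- (real k - 2 * M) * t)" if "0 < t" for t
        using regular_solution_bounds(1)[OF b(1), of t k] regular_solution_pos[of q k N "exp (- t)"] that by linarith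
      have "0 < real N - 4 * M" using M b(2) by linarith
      then show "0 < 2 * (real k - 2 * M) + real DIM('a) - 2" unfolding RN by (simp add: algebra_simps)
    qed
  qed
  have "log_deriv q k N 1 = ?l" by (simp add: log_deriv_def lap_radial_def)
  then have der: "(?u has_real_derivative ?l) (at 1 within {0<..1})"
    using regular_solution_deriv[OF b(1), of 1 k] by (simp add: regular_solution_1)
  obtain P :: "'a \<Rightarrow> real" where P: "spherical_harmonic k P" "continuous_on UNIV P"
    "\<And>c x. P (c *\<^sub>R x) = c ^ k * P x" "\<And>x. \<bar>P x\<bar> \<le> norm x ^ k" "\<exists>x. P x \<noteq> 0"
    using exists_spherical_harmonic[OF d] by blast
  have "l = ?l" if v: "radial_solution V k v" "(v has_real_derivative l) (at 1 within {0<..1})" for v l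
  proof -
    obtain q' where q': "radial_profile V q'" "solves_radial_ode DIM('a) q' k v"
      using v(1) unfolding radial_solution_def by blast
    have "v r = ?u r" if "r \<in> {0<..1}" for r
    proof (rule solution_unique[OF b(1) N1 d b(2) radial_profile_unique[OF q q'(1)] q'(2) _ _ that])
      show "v 1 = 1" using v(1) by (simp add: radial_solution_def)
      have "in_weighted_L2 (\<lambda>x. v (norm x) * P (x /\<^sub>R norm x))" using v(1) P(1) by (simp add: radial_solution_def)
      from weighted_L2_imp_log_L2[OF this P(2-5) solves_radial_ode_continuous[OF q'(2)]]
      show "(\<integral>\<^sup>+ t. ennreal ((v (exp (- t)))\<^sup>2 * exp (- (real DIM('a) - 2) * t)) * indicator {0<..} t \<partial>lborel) < \<infinity>" .
    qed
    then have "(?u has_real_derivative l) (at 1 within {0<..1})"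
      by (intro has_field_derivative_transform_within[OF v(2), where d=1]) auto
    then have A: "((\<lambda>y. (?u y - ?u 1) / (y - 1)) \<longlongrightarrow> l) (at 1 within {0<..1})"
      by (simp only: has_field_derivative_iff)
    have B: "((\<lambda>y. (?u y - ?u 1) / (y - 1)) \<longlongrightarrow> ?l) (at 1 within {0<..1})"
      using der by (simp only: has_field_derivative_iff)
    \<comment> \<open>Limits are unique only along a nontrivial filter, and 1 is the right endpoint
      of the domain.\<close>
    have "at (1::real) within {1/2..1} = at_left 1" by (rule at_within_Icc_at_left) simp
    then have "at (1::real) within {0<..1} \<noteq> bot"
      using at_within_Ioc_eq[of "1/2" 1] by simp
    then show "l = ?l" by (rule tendsto_unique[OF _ A B])
  qed
  then have unique: "l = ?l" if "\<exists>v. radial_solution V k v \<and> (v has_real_derivative l) (at 1 within {0<..1})" for l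
    using that by blast
  show ?thesis unfolding dn_eigenvalue_def
  proof (rule the_equality)
    show "\<exists>u. radial_solution V k u \<and> (u has_real_derivative ?l) (at 1 within {0<..1})"
      using sol der by blast
  qed (rule unique)
qed

section \<open>Potentials and Born approximations\<close>

lemma log_potential_measurable:
  assumes [measurable]: "q \<in> borel_measurable borel"
  shows "log_potential q \<in> borel_measurable borel"
  unfolding log_potential_def by measurable

lemma dyadic_shell_iff:
  assumes "x \<noteq> 0"
  shows "x \<in> dyadic_shell j \<longleftrightarrow> - ln (norm x) \<in> {real j * ln 2<..<real (j + 1) * ln 2}"
proof -
  have e: "1 / 2 ^ n = exp (- (real n * ln 2))" for n
    by (simp add: exp_minus exp_of_nat_mult divide_inverse)
  have n: "exp a < norm x \<longleftrightarrow> a < ln (norm x)" "norm x < exp a \<longleftrightarrow> ln (norm x) < a" for a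
    using assms by (metis exp_ln exp_less_cancel_iff zero_less_norm_iff)+
  show ?thesis unfolding dyadic_shell_def e mem_Collect_eq n greaterThanLessThan_iff by auto
qed

text \<open>The weight norm x ^ (2 - d) and the Jacobian exp (-d t) leave exp (-2 t), the factor in
  \<open>log_potential\<close>. Up to the sphere area, the norm of the potential is thus the uniform
  local L1 norm of Q over intervals of length ln 2.\<close>

lemma dyadic_shell_integral:
  fixes V :: "'a::euclidean_space \<Rightarrow> real"
  assumes q: "radial_profile V q"
  shows "(\<integral>\<^sup>+ x \<in> dyadic_shell j. ennreal (\<bar>V x\<bar> * norm x powr (2 - real DIM('a))) \<partial>lebesgue)
    = ennreal (sphere_area TYPE('a)) * (\<integral>\<^sup>+ t. ennreal \<bar>log_potential q t\<bar> * indicator {real j * ln 2<..<real (j + 1) * ln 2} t \<partial>lborel)"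
proof -
  have [measurable]: "q \<in> borel_measurable borel" using q by (simp add: radial_profile_def)
  define f where "f t = ennreal (\<bar>q (exp (- t))\<bar> * exp (- t) powr (2 - real DIM('a))) * indicator {real j * ln 2<..<real (j + 1) * ln 2} t" for t
  have [measurable]: "f \<in> borel_measurable borel" unfolding f_def by measurable
  have "AE x in lebesgue_on (ball (0::'a) 1). V x = q (norm x)" using q by (simp add: radial_profile_def)
  then have ae: "AE x in lebesgue. x \<in> ball (0::'a) 1 \<longrightarrow> V x = q (norm x)" by (subst (asm) AE_restrict_space_iff) auto
  have "(\<integral>\<^sup>+ x \<in> dyadic_shell j. ennreal (\<bar>V x\<bar> * norm x powr (2 - real DIM('a))) \<partial>lebesgue)
    = (\<integral>\<^sup>+ x. f (- ln (norm x)) * indicator (ball (0::'a) 1) x \<partial>lebesgue)"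
  proof (rule nn_integral_cong_AE)
    have "(1::real) / 2 ^ j \<le> 1" by simp
    have "AE x in lebesgue. x \<noteq> (0::'a)" by (intro AE_completion AE_lborel_singleton)
    with ae show "AE x in lebesgue. ennreal (\<bar>V x\<bar> * norm x powr (2 - real DIM('a))) * indicator (dyadic_shell j) x
       = f (- ln (norm x)) * indicator (ball 0 1) x"
    proof eventually_elim
      case (elim x)
      show ?case
      proof (cases "x \<in> dyadic_shell j")
        case True
        then have "norm x < 1 / 2 ^ j" by (simp add: dyadic_shell_def)
        then have "norm x < 1" using \<open>(1::real) / 2 ^ j \<le> 1\<close> by (rule less_le_trans)
        then show ?thesis using True elim dyadic_shell_iff[of x j] by (simp add: f_def)
      next
        case False
        then show ?thesis using elim dyadic_shell_iff[of x j] by (simp add: f_def indicator_def)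
      qed
    qed
  qed
  also have "\<dots> = (\<integral>\<^sup>+ x. f (- ln (norm x)) * indicator (ball (0::'a) 1) x \<partial>lborel)"
    by (rule nn_integral_completion)
  also have "\<dots> = ennreal (sphere_area TYPE('a)) * (\<integral>\<^sup>+ t. f t * ennreal (exp (- real DIM('a) * t)) * indicator {0<..} t \<partial>lborel)"
    by (rule nn_integral_radial) simp
  also have "(\<integral>\<^sup>+ t. f t * ennreal (exp (- real DIM('a) * t)) * indicator {0<..} t \<partial>lborel)
    = (\<integral>\<^sup>+ t. ennreal \<bar>log_potential q t\<bar> * indicator {real j * ln 2<..<real (j + 1) * ln 2} t \<partial>lborel)"
  proof (rule nn_integral_cong)
    fix t
    show "f t * ennreal (exp (- real DIM('a) * t)) * indicator {0<..} t = ennreal \<bar>log_potential q t\<bar> * indicator {real j * ln 2<..<real (j + 1) * ln 2} t"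
    proof (cases "t \<in> {real j * ln 2<..<real (j + 1) * ln 2}")
      case True
      have "0 \<le> real j * ln 2" by simp
      then have t: "0 < t" using True unfolding greaterThanLessThan_iff by linarith
      have "exp (- t) powr (2 - real DIM('a)) * exp (- real DIM('a) * t) = exp (- 2 * t)"
        by (simp add: powr_def exp_add[symmetric] algebra_simps)
      then have "\<bar>q (exp (- t))\<bar> * exp (- t) powr (2 - real DIM('a)) * exp (- real DIM('a) * t) = \<bar>log_potential q t\<bar>"
        using t by (simp add: log_potential_def abs_mult mult.assoc)
      then show ?thesis using True t by (simp add: f_def ennreal_mult[symmetric])
    qed (simp add: f_def)
  qed
  finally show ?thesis .
qed

lemma exp_weighted_blocks:
  fixes Q :: "real \<Rightarrow> real"
  assumes [measurable]: "Q \<in> borel_measurable borel" and supp: "\<And>x. x \<le> 0 \<Longrightarrow> Q x = 0" and l: "0 < l" and c: "1 \<le> c" "ln 2 = l"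
    and block: "\<And>j::nat. (\<integral>\<^sup>+ x. ennreal \<bar>Q x\<bar> * indicator {real j * l<..<real (j + 1) * l} x \<partial>lborel) \<le> ennreal m" and m: "0 \<le> m"
  shows "(\<integral>\<^sup>+ x. indicator {t..} x * ennreal (\<bar>Q x\<bar> * exp (- c * (x - t))) \<partial>lborel) \<le> ennreal (4 * m)"
proof -
  \<comment> \<open>\<open>i\<close> is the block of t, or 0 if t is negative. On block j >= i the
    exponential is at most exp ((i + 1) l - j l) = 2 (1/2)^(j - i), because c >= 1 and l = ln 2, and
    these weights add up to 4.\<close>
  define i where "i = nat \<lfloor>t / l\<rfloor>"
  define w where "w j = (if i \<le> j then 2 * (1/2) ^ (j - i) else 0 :: real)" for j
  have w0: "0 \<le> w j" for j by (simp add: w_def)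
  have "(\<lambda>j. 2 * (1/2) ^ j) sums (2 * (1 / (1 - 1/2)) :: real)" by (intro sums_mult geometric_sums) simp
  then have "(\<lambda>j. w (j + i)) sums 4" by (simp add: w_def)
  then have sw: "w sums 4" by (subst (asm) sums_iff_shift) (simp add: w_def)
  let ?B = "\<lambda>j. {real j * l<..<real (j + 1) * l}"
  have ti: "t < real (i + 1) * l"
  proof -
    have "t / l < real_of_int \<lfloor>t / l\<rfloor> + 1" by linarith
    also have "\<dots> \<le> real (i + 1)" by (simp add: i_def)
    finally show ?thesis using l by (simp add: divide_less_eq)
  qed
  have ti': "real i * l \<le> t \<or> i = 0"
  proof (cases "0 \<le> \<lfloor>t / l\<rfloor>")
    case True
    then have "real i = real_of_int \<lfloor>t / l\<rfloor>" by (simp add: i_def)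
    also have "\<dots> \<le> t / l" by linarith
    finally show ?thesis using l by (simp add: le_divide_eq)
  qed (simp add: i_def)
  have weight: "exp (- c * (x - t)) \<le> w j" if "x \<in> ?B j" "t \<le> x" for x j
  proof -
    have "i \<le> j"
    proof (cases "i = 0")
      case False
      then have "real i * l < real (j + 1) * l" using ti' that by auto
      then show ?thesis using l by (simp add: mult_less_cancel_right)
    qed simp
    have "- c * (x - t) \<le> - (x - t)" using that(2) c(1) mult_right_mono[of 1 c "x - t"] by simp
    also have "\<dots> \<le> real (i + 1) * l - real j * l" using that ti by auto
    also have "\<dots> = ln 2 - real (j - i) * ln 2" using \<open>i \<le> j\<close> c(2) by (simp add: of_nat_diff algebra_simps)
    finally have "exp (- c * (x - t)) \<le> exp (ln 2 - real (j - i) * ln 2)" by simp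
    also have "\<dots> = 2 / 2 ^ (j - i)" unfolding exp_diff exp_of_nat_mult by simp
    also have "\<dots> = w j" using \<open>i \<le> j\<close> by (simp add: w_def power_divide)
    finally show ?thesis .
  qed
  \<comment> \<open>The blocks are open, like the dyadic shells, so their countably many endpoints
    have to be discarded.\<close>
  have ae: "AE x in lborel. x \<notin> range (\<lambda>j::nat. real j * l)"
    by (intro AE_not_in countable_imp_null_set_lborel) auto
  have "(\<integral>\<^sup>+ x. indicator {t..} x * ennreal (\<bar>Q x\<bar> * exp (- c * (x - t))) \<partial>lborel)
    \<le> (\<integral>\<^sup>+ x. (\<Sum>j. ennreal (w j) * (ennreal \<bar>Q x\<bar> * indicator (?B j) x)) \<partial>lborel)"
  proof (rule nn_integral_mono_AE)
    show "AE x in lborel. indicator {t..} x * ennreal (\<bar>Q x\<bar> * exp (- c * (x - t)))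
      \<le> (\<Sum>j. ennreal (w j) * (ennreal \<bar>Q x\<bar> * indicator (?B j) x))"
      using ae
    proof eventually_elim
    case (elim x)
    show ?case
    proof (cases "0 < x \<and> t \<le> x")
      case True
      define j where "j = nat \<lfloor>x / l\<rfloor>"
      have "0 \<le> \<lfloor>x / l\<rfloor>" using True l by simp
      then have "real j = real_of_int \<lfloor>x / l\<rfloor>" by (simp add: j_def)
      then have "real j \<le> x / l" "x / l < real (j + 1)" by linarith+
      then have "real j * l \<le> x" "x < real (j + 1) * l" using l by (simp_all only: le_divide_eq divide_less_eq if_True)
      moreover have "x \<noteq> real j * l" using elim by auto
      ultimately have B: "x \<in> ?B j" by auto
      have "\<bar>Q x\<bar> * exp (- c * (x - t)) \<le> w j * \<bar>Q x\<bar>"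
        using mult_left_mono[OF weight[OF B], of "\<bar>Q x\<bar>"] True by (simp add: mult.commute)
      then have "indicator {t..} x * ennreal (\<bar>Q x\<bar> * exp (- c * (x - t))) \<le> ennreal (w j) * (ennreal \<bar>Q x\<bar> * indicator (?B j) x)"
        using True B w0[of j] by (simp add: ennreal_mult[symmetric] ennreal_leI)
      also have "\<dots> \<le> (\<Sum>j. ennreal (w j) * (ennreal \<bar>Q x\<bar> * indicator (?B j) x))"
        using sum_le_suminf[OF summableI, of "{j}" "\<lambda>j. ennreal (w j) * (ennreal \<bar>Q x\<bar> * indicator (?B j) x)"] by simp
      finally show ?thesis .
    next
      case False
      then have "indicator {t..} x * ennreal (\<bar>Q x\<bar> * exp (- c * (x - t))) = 0" using supp[of x] by auto
      then show ?thesis by (simp only: zero_le)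
    qed
    qed
  qed
  also have "\<dots> = (\<Sum>j. \<integral>\<^sup>+ x. ennreal (w j) * (ennreal \<bar>Q x\<bar> * indicator (?B j) x) \<partial>lborel)"
    by (rule nn_integral_suminf) measurable
  also have "\<dots> = (\<Sum>j. ennreal (w j) * (\<integral>\<^sup>+ x. ennreal \<bar>Q x\<bar> * indicator (?B j) x \<partial>lborel))"
    by (subst nn_integral_cmult) auto
  also have "\<dots> \<le> (\<Sum>j. ennreal (w j) * ennreal m)"
    by (intro suminf_le mult_left_mono block summableI) auto
  also have "\<dots> = (\<Sum>j. ennreal (w j * m))" using w0 m by (simp add: ennreal_mult)
  also have "\<dots> = ennreal (\<Sum>j. w j * m)"
    by (rule suminf_ennreal2) (use w0 m summable_mult2[OF sums_summable[OF sw]] in auto)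
  also have "(\<Sum>j. w j * m) = 4 * m" by (rule sums_unique[OF sums_mult2[OF sw, of m], symmetric])
  finally show ?thesis .
qed

text \<open>The bound m does not depend on c, so one m serves all large k. It is 4 K / |S|, with K
  the norm of V, |S| the sphere area and 4 the sum of the geometric weights.\<close>

lemma potential_exp_bounded:
  fixes V :: "'a::euclidean_space \<Rightarrow> real"
  assumes V: "V \<in> potential_space" and q: "radial_profile V q"
  obtains m where "0 \<le> m" "\<And>c. 1 \<le> c \<Longrightarrow> 4 * m \<le> c \<Longrightarrow> exp_bounded (log_potential q) m c"
proof -
  have qm: "q \<in> borel_measurable borel" using q by (simp add: radial_profile_def)
  obtain K where K: "0 \<le> K" "potential_norm V = ennreal K"
    using V by (cases "potential_norm V") (auto simp: potential_space_def)
  let ?S = "sphere_area TYPE('a)"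
  have S: "0 < ?S" by (rule sphere_area_pos)
  have block: "(\<integral>\<^sup>+ t. ennreal \<bar>log_potential q t\<bar> * indicator {real j * ln 2<..<real (j + 1) * ln 2} t \<partial>lborel) \<le> ennreal (K / ?S)" for j
  proof -
    let ?I = "\<integral>\<^sup>+ t. ennreal \<bar>log_potential q t\<bar> * indicator {real j * ln 2<..<real (j + 1) * ln 2} t \<partial>lborel"
    have "ennreal ?S * ?I \<le> ennreal K"
      unfolding dyadic_shell_integral[OF q, symmetric] K(2)[symmetric] potential_norm_def
      by (rule SUP_upper) simp
    then have "ennreal (1 / ?S) * (ennreal ?S * ?I) \<le> ennreal (1 / ?S) * ennreal K" by (rule mult_left_mono) simp
    then show ?thesis using S K(1) by (simp add: mult.assoc[symmetric] ennreal_mult[symmetric])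
  qed
  show ?thesis
  proof
    show "0 \<le> 4 * (K / ?S)" using K S by simp
    fix c :: real assume c: "1 \<le> c" "4 * (4 * (K / ?S)) \<le> c"
    show "exp_bounded (log_potential q) (4 * (K / ?S)) c"
      unfolding exp_bounded_def
    proof (intro conjI allI)
      show "(\<integral>\<^sup>+ x. indicator {t..} x * ennreal (\<bar>log_potential q x\<bar> * exp (- c * (x - t))) \<partial>lborel) \<le> ennreal (4 * (K / ?S))" for t
        by (rule exp_weighted_blocks[OF log_potential_measurable[OF qm] _ _ c(1) refl block])
          (use K S in \<open>auto simp: log_potential_def\<close>)
    qed (use c K S log_potential_measurable[OF qm] in auto)
  qed
qed

lemma integral_radial:
  fixes f :: "real \<Rightarrow> real"
  assumes f[measurable]: "f \<in> borel_measurable borel"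
  defines "F \<equiv> \<lambda>x::'a::euclidean_space. f (- ln (norm x))"
    and "h \<equiv> \<lambda>t. indicator {0<..} t * (f t * exp (- real DIM('a) * t))"
  shows "F absolutely_integrable_on ball 0 1 \<longleftrightarrow> integrable lborel h"
    and "F absolutely_integrable_on ball 0 1 \<Longrightarrow> integral (ball 0 1) F = sphere_area TYPE('a) * (LINT t|lborel. h t)"
proof -
  let ?S = "sphere_area TYPE('a)"
  have S: "0 < ?S" by (rule sphere_area_pos)
  have [measurable]: "h \<in> borel_measurable borel" unfolding h_def by measurable
  define G where "G = (\<lambda>x::'a. indicator (ball 0 1) x * F x)"
  have Gm[measurable]: "G \<in> borel_measurable borel"
    unfolding G_def F_def by (intro borel_measurable_times borel_measurable_indicator) auto
  \<comment> \<open>Positive homogeneity of \<open>g\<close> lets it commute with the exponential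
    density; absolute value, identity and negation are the instances that yield integrability and
    the two parts of the integral.\<close>
  have nn: "(\<integral>\<^sup>+ x. ennreal (g (G x)) \<partial>lborel) = ennreal ?S * (\<integral>\<^sup>+ t. ennreal (g (h t)) \<partial>lborel)"
    if [measurable]: "g \<in> borel_measurable borel" and g: "\<And>a y. 0 \<le> a \<Longrightarrow> g (y * a) = g y * a" for g :: "real \<Rightarrow> real"
  proof -
    have g0: "g 0 = 0" using g[of 0 0] by simp
    have "(\<integral>\<^sup>+ x. ennreal (g (G x)) \<partial>lborel) = (\<integral>\<^sup>+ x. ennreal (g (f (- ln (norm x)))) * indicator (ball (0::'a) 1) x \<partial>lborel)"
      by (rule nn_integral_cong) (simp add: G_def F_def indicator_def g0)
    also have "\<dots> = ennreal ?S * (\<integral>\<^sup>+ t. ennreal (g (f t)) * ennreal (exp (- real DIM('a) * t)) * indicator {0<..} t \<partial>lborel)"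
      by (rule nn_integral_radial) simp
    also have "(\<integral>\<^sup>+ t. ennreal (g (f t)) * ennreal (exp (- real DIM('a) * t)) * indicator {0<..} t \<partial>lborel) = (\<integral>\<^sup>+ t. ennreal (g (h t)) \<partial>lborel)"
    proof (rule nn_integral_cong)
      fix t
      show "ennreal (g (f t)) * ennreal (exp (- real DIM('a) * t)) * indicator {0<..} t = ennreal (g (h t))"
        by (cases "0 < t") (simp_all add: h_def g0 g[of "exp (- (real DIM('a) * t))"] ennreal_mult'')
    qed
    finally show ?thesis .
  qed
  have abs: "F absolutely_integrable_on ball 0 1 \<longleftrightarrow> integrable lborel G"
    unfolding set_integrable_def G_def[symmetric] real_scaleR_def by (rule integrable_completion) simp
  have "(\<integral>\<^sup>+ x. ennreal \<bar>G x\<bar> \<partial>lborel) = ennreal ?S * (\<integral>\<^sup>+ t. ennreal \<bar>h t\<bar> \<partial>lborel)"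
    by (rule nn) (auto simp: abs_mult)
  then show iff: "F absolutely_integrable_on ball 0 1 \<longleftrightarrow> integrable lborel h"
    unfolding abs using S by (auto simp: integrable_iff_bounded ennreal_mult_less_top)
  show "integral (ball 0 1) F = ?S * (LINT t|lborel. h t)" if F: "F absolutely_integrable_on ball 0 1"
  proof -
    have i: "integrable lborel G" "integrable lborel h" using F abs iff by auto
    have "integral (ball 0 1) F = (LINT x:ball 0 1|lebesgue. F x)"
      by (rule set_lebesgue_integral_eq_integral(2)[OF F, symmetric])
    also have "\<dots> = (LINT x|lborel. G x)"
      unfolding set_lebesgue_integral_def real_scaleR_def G_def[symmetric] by (rule integral_completion) simp
    also have "\<dots> = ?S * (LINT t|lborel. h t)"
      unfolding real_lebesgue_integral_def[OF i(1)] real_lebesgue_integral_def[OF i(2)]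
      using nn[of "\<lambda>x. x"] nn[of uminus] S by (simp add: enn2real_mult right_diff_distrib)
    finally show ?thesis .
  qed
qed

lemma integral_cong_AE_restrict:
  fixes f g :: "'a::euclidean_space \<Rightarrow> real"
  assumes "AE x in lebesgue_on S. f x = g x" "S \<in> sets lebesgue"
  shows "integral S f = integral S g" "f absolutely_integrable_on S \<longleftrightarrow> g absolutely_integrable_on S"
proof -
  have "AE x in lebesgue. x \<in> S \<longrightarrow> f x = g x"
    using assms by (subst (asm) AE_restrict_space_iff) auto
  then obtain N where N: "N \<in> null_sets lebesgue" "{x. \<not> (x \<in> S \<longrightarrow> f x = g x)} \<subseteq> N"
    by (auto simp: eventually_ae_filter)
  have n: "negligible N" using N(1) by (simp add: negligible_iff_null_sets)
  show "integral S f = integral S g"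
    by (rule integral_spike[OF n]) (use N(2) in auto)
  show "f absolutely_integrable_on S \<longleftrightarrow> g absolutely_integrable_on S"
    by (rule absolutely_integrable_spike_eq[OF n]) (use N(2) in auto)
qed

lemma AE_outer_shell_iff:
  fixes f f' :: "'a::euclidean_space \<Rightarrow> real"
  assumes p: "radial_profile f p" "radial_profile f' p'" and b: "0 < b"
  shows "(AE x in lebesgue_on (outer_shell b). f x = f' x) \<longleftrightarrow> (AE t in lborel. 0 < t \<and> t < - ln b \<longrightarrow> p (exp (- t)) = p' (exp (- t)))"
proof -
  have [measurable]: "p \<in> borel_measurable borel" "p' \<in> borel_measurable borel"
    using p by (simp_all add: radial_profile_def)
  have "outer_shell b = (ball 0 1 - cball 0 b :: 'a set)" by (auto simp: outer_shell_def)
  then have S: "(outer_shell b :: 'a set) \<in> sets lebesgue" by simp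
  have "(AE x in lebesgue_on (outer_shell b). f x = f' x) \<longleftrightarrow> (AE x in lebesgue. x \<in> outer_shell b \<longrightarrow> f x = f' x)"
    by (rule AE_restrict_space_iff) (use S in simp)
  also have "\<dots> \<longleftrightarrow> (AE x in lebesgue. x \<in> ball 0 1 \<longrightarrow> b < norm x \<longrightarrow> f x = f' x)"
    by (rule eventually_cong[OF always_eventually]) (auto simp: outer_shell_def)
  also have "\<dots> \<longleftrightarrow> (AE x in lebesgue_on (ball 0 1). b < norm x \<longrightarrow> f x = f' x)"
    by (rule AE_restrict_space_iff[symmetric]) simp
  also have "\<dots> \<longleftrightarrow> (AE x in lebesgue_on (ball (0::'a) 1). b < norm x \<longrightarrow> p (norm x) = p' (norm x))"
  proof (rule eventually_cong)
    show "AE x in lebesgue_on (ball 0 1). f x = p (norm x) \<and> f' x = p' (norm x)"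
      using p by (auto simp: radial_profile_def)
  qed auto
  also have "\<dots> \<longleftrightarrow> (AE t in lborel. 0 < t \<longrightarrow> b < exp (- t) \<longrightarrow> p (exp (- t)) = p' (exp (- t)))"
    by (rule AE_norm_iff) measurable
  also have "\<dots> \<longleftrightarrow> (AE t in lborel. 0 < t \<and> t < - ln b \<longrightarrow> p (exp (- t)) = p' (exp (- t)))"
  proof -
    have "b < exp (- t) \<longleftrightarrow> t < - ln b" for t
      using b by (metis exp_ln exp_less_cancel_iff less_minus_iff)
    then show ?thesis by (intro eventually_cong[OF always_eventually]) auto
  qed
  finally show ?thesis .
qed

text \<open>Both sides have the same exponential moments for all large k: those of w by the defining
  property of the Born approximation, those of the amplitude because its transform at time 0 is the
  eigenvalue minus k.\<close>

lemma born_amplitude: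
  fixes V W :: "'a::euclidean_space \<Rightarrow> real"
  assumes d: "2 \<le> DIM('a)" and V: "V \<in> potential_space" and q: "radial_profile V q"
    and born: "born_approximation V W" and w: "radial_profile W w"
  shows "AE t in lborel. 0 < t \<longrightarrow> exp (- 2 * t) * w (exp (- t)) = amp_real (log_potential q) 0 t"
proof -
  let ?Q = "log_potential q" and ?d = "real DIM('a)"
  have [measurable]: "w \<in> borel_measurable borel" and qm: "q \<in> borel_measurable borel"
    using w q by (simp_all add: radial_profile_def)
  have W: "AE x in lebesgue_on (ball 0 1). W x = w (norm x)" using w by (simp add: radial_profile_def)
  have nz: "AE x in lebesgue_on (ball 0 1). x \<noteq> (0::'a)" by (rule AE_not_zero_restrict) simp
  obtain m where m: "0 \<le> m" "\<And>c. 1 \<le> c \<Longrightarrow> 4 * m \<le> c \<Longrightarrow> exp_bounded ?Q m c"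
    using potential_exp_bounded[OF V q] by blast
  obtain s where s: "0 < s" "(\<lambda>x. W x * norm x powr (2 * s)) absolutely_integrable_on ball 0 1"
    using born by (auto simp: born_approximation_def)
  obtain K where K: "\<And>k. K \<le> k \<Longrightarrow> 1 / sphere_area TYPE('a) * integral (ball 0 1) (\<lambda>x. W x * norm x ^ (2 * k)) = dn_eigenvalue V k - real k"
    using born by (auto simp: born_approximation_def eventually_sequentially)
  obtain k1 :: nat where k1: "max s (max 1 (12 * m)) \<le> real k1" using real_arch_simple by blast
  \<comment> \<open>Beyond \<open>k0\<close> four things hold at once: the moment identity
    (\<open>K\<close>), integrability of W norm x ^ (2 k) (k >= s), the Laplace bound (N >= 1 and N
    >= 4 m), and uniqueness of the solution (N >= 12 m).\<close>
  define k0 where "k0 = max K k1"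
  have k0: "K \<le> k" "s \<le> real k" "1 \<le> real k" "12 * m \<le> real k" if "k0 \<le> k" for k
    using k1 that by (auto simp: k0_def)
  define N where "N k = 2 * k + (DIM('a) - 2)" for k
  have RN: "real (N k) = 2 * real k + ?d - 2" for k using d by (simp add: N_def of_nat_diff)
  have Nk: "real k \<le> real (N k)" for k by (simp add: N_def)
  have eb: "exp_bounded ?Q m (real (N k))" "12 * m \<le> real (N k)" if "k0 \<le> k" for k
    using k0[OF that] Nk[of k] m(1) by (auto intro!: m(2))
  define h where "h k t = indicator {0<..} t * (w (exp (- t)) * exp (- 2 * real k * t) * exp (- ?d * t))" for k t
  have hm: "h k \<in> borel_measurable borel" for k unfolding h_def by measurable
  have "(\<lambda>x::'a. w (exp (- (- ln (norm x)))) * exp (- 2 * s * (- ln (norm x)))) absolutely_integrable_on ball 0 1"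
  proof (subst integral_cong_AE_restrict(2)[where g="\<lambda>x. W x * norm x powr (2 * s)"])
    show "AE x in lebesgue_on (ball (0::'a) 1). w (exp (- (- ln (norm x)))) * exp (- 2 * s * (- ln (norm x))) = W x * norm x powr (2 * s)"
      using W nz by eventually_elim (simp add: powr_def)
  qed (use s in auto)
  then have hs: "integrable lborel (\<lambda>t. indicator {0<..} t * (w (exp (- t)) * exp (- 2 * s * t) * exp (- ?d * t)))"
    by (subst (asm) integral_radial(1)[where f="\<lambda>t. w (exp (- t)) * exp (- 2 * s * t)"]) auto
  have hi: "integrable lborel (h k)" if "k0 \<le> k" for k
  proof (rule Bochner_Integration.integrable_bound[OF hs])
    have "norm (h k t) \<le> norm (indicator {0<..} t * (w (exp (- t)) * exp (- 2 * s * t) * exp (- ?d * t)))" for t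
    proof (cases "0 < t")
      case True
      have "exp (- 2 * real k * t) \<le> exp (- 2 * s * t)" using k0(2)[OF that] True by simp
      then have "\<bar>w (exp (- t))\<bar> * exp (- 2 * real k * t) * exp (- ?d * t) \<le> \<bar>w (exp (- t))\<bar> * exp (- 2 * s * t) * exp (- ?d * t)"
        by (intro mult_right_mono mult_left_mono) auto
      then show ?thesis using True by (simp add: h_def abs_mult)
    qed (simp add: h_def)
    then show "AE t in lborel. norm (h k t) \<le> norm (indicator {0<..} t * (w (exp (- t)) * exp (- 2 * s * t) * exp (- ?d * t)))" by simp
  qed (use hm in auto)
  have hv: "(LINT t|lborel. h k t) = lap_diff ?Q (real (N k)) 0" if "k0 \<le> k" for k
  proof -
    let ?F = "\<lambda>x::'a. w (exp (- (- ln (norm x)))) * exp (- 2 * real k * (- ln (norm x)))"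
    have "?F absolutely_integrable_on ball 0 1"
      using hi[OF that] unfolding h_def
      by (subst integral_radial(1)[where f="\<lambda>t. w (exp (- t)) * exp (- 2 * real k * t)"]) auto
    then have "integral (ball 0 1) ?F = sphere_area TYPE('a) * (LINT t|lborel. h k t)"
      unfolding h_def by (subst integral_radial(2)[where f="\<lambda>t. w (exp (- t)) * exp (- 2 * real k * t)"]) auto
    moreover have "integral (ball 0 1) (\<lambda>x. W x * norm x ^ (2 * k)) = integral (ball 0 1) ?F"
    proof (rule integral_cong_AE_restrict(1))
      show "AE x in lebesgue_on (ball (0::'a) 1). W x * norm x ^ (2 * k) = ?F x"
        using W nz
      proof eventually_elim
        case (elim x)
        have "exp (real (2 * k) * ln (norm x)) = norm x ^ (2 * k)" using elim(2) by (subst exp_of_nat_mult) simp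
        then show ?case using elim by simp
      qed
    qed simp
    ultimately have "(LINT t|lborel. h k t) = dn_eigenvalue V k - real k"
      using K[OF k0(1)[OF that]] sphere_area_pos[where 'a='a] by simp
    also have "\<dots> = lap_diff ?Q (real (N k)) 0"
      using dn_eigenvalue_eq[OF d q N_def eb[OF that]] by simp
    finally show ?thesis .
  qed
  define a where "a k t = indicator {0<..} t * (amp_real ?Q 0 t * exp (- real (N k) * t))" for k t
  have ai: "integrable lborel (a k)" "(LINT t|lborel. a k t) = lap_diff ?Q (real (N k)) 0" if "k0 \<le> k" for k
  proof -
    note l = lap_diff_integral[OF eb(1)[OF that], of 0]
    have [measurable]: "amp_real ?Q 0 \<in> borel_measurable borel"
      by (rule amp_real_measurable[OF log_potential_measurable[OF qm]])
    have am: "a k \<in> borel_measurable lborel" unfolding a_def by measurable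
    have e: "AE t in lborel. amp_real ?Q 0 t * exp (- real (N k) * t) = a k t"
      using AE_lborel_singleton[of "0::real"]
      by eventually_elim (auto simp: a_def indicator_def amp_real_support)
    show "integrable lborel (a k)"
      using l(1) am by (subst integrable_cong_AE[OF _ _ e, symmetric]) auto
    show "(LINT t|lborel. a k t) = lap_diff ?Q (real (N k)) 0"
      unfolding l(2) using l(1) am by (subst integral_cong_AE[OF _ _ e]) auto
  qed
  \<comment> \<open>Moments are known only from \<open>k0\<close> on. Absorbing the weight of index
    \<open>k0\<close> into the function gives an integrable function whose moments of every index j
    vanish, since raising k by j multiplies both weights by exp (-2 j t).\<close>
  define \<psi> where "\<psi> t = h k0 t - a k0 t" for t
  have "AE t in lborel. \<psi> t = 0"
  proof (rule AE_zero_of_moments)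
    show "integrable lborel \<psi>" unfolding \<psi>_def using hi[of k0] ai(1)[of k0] by simp
    show "\<psi> t = 0" if "t \<le> 0" for t using that by (simp add: \<psi>_def h_def a_def)
    fix j :: nat
    have "\<psi> t * exp (- 2 * real j * t) = h (k0 + j) t - a (k0 + j) t" for t
    proof -
      have 1: "exp (- 2 * real k0 * t) * exp (- 2 * real j * t) = exp (- 2 * real (k0 + j) * t)"
        by (simp add: exp_add[symmetric] algebra_simps)
      have 2: "exp (- real (N k0) * t) * exp (- 2 * real j * t) = exp (- real (N (k0 + j)) * t)"
        unfolding RN by (simp add: exp_add[symmetric] algebra_simps)
      have "(i * (p * x * y) - i * (r * z)) * E = i * (p * (x * E) * y) - i * (r * (z * E))" for i p x y r z E :: real
        by (simp add: algebra_simps)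
      then show ?thesis unfolding \<psi>_def h_def a_def 1[symmetric] 2[symmetric] .
    qed
    then have "(LINT t|lborel. \<psi> t * exp (- 2 * real j * t)) = (LINT t|lborel. h (k0 + j) t - a (k0 + j) t)" by simp
    also have "\<dots> = 0" using hi[of "k0 + j"] ai[of "k0 + j"] hv[of "k0 + j"] by simp
    finally show "(LINT t|lborel. \<psi> t * exp (- 2 * real j * t)) = 0" .
  qed
  then show ?thesis
  proof eventually_elim
    case (elim t)
    show ?case
    proof
      assume t: "0 < t"
      \<comment> \<open>As N = 2 k0 + d - 2, comparing the two weights leaves the factor exp (-2 t)
        on w.\<close>
      have "exp (- 2 * real k0 * t) * exp (- ?d * t) = exp (- 2 * t) * exp (- real (N k0) * t)"
        unfolding RN by (simp add: exp_add[symmetric] algebra_simps)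
      then have "(exp (- 2 * t) * w (exp (- t))) * exp (- real (N k0) * t) = amp_real ?Q 0 t * exp (- real (N k0) * t)"
        using elim t unfolding \<psi>_def h_def a_def by (simp add: mult_ac)
      then show "exp (- 2 * t) * w (exp (- t)) = amp_real ?Q 0 t" by simp
    qed
  qed
qed

theorem theorem2:
  fixes V1 V2 V1B V2B :: "'a::euclidean_space \<Rightarrow> real" and b :: real
  assumes "2 \<le> DIM('a)"
    and "V1 \<in> potential_space" and "V2 \<in> potential_space"
    and "born_approximation V1 V1B" and "born_approximation V2 V2B"
    and "0 < b" and "b < 1"
  shows "(AE x in lebesgue_on (outer_shell b). V1B x = V2B x) \<longleftrightarrow>
         (AE x in lebesgue_on (outer_shell b). V1 x = V2 x)"
proof -
  define T where "T = - ln b"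
  obtain q1 q2 where q: "radial_profile V1 q1" "radial_profile V2 q2"
    using assms(2,3) by (auto simp: potential_space_def radial_def)
  obtain w1 w2 where w: "radial_profile V1B w1" "radial_profile V2B w2"
    using assms(4,5) by (auto simp: born_approximation_def radial_def)
  have amp1: "AE t in lborel. 0 < t \<longrightarrow> exp (- 2 * t) * w1 (exp (- t)) = amp_real (log_potential q1) 0 t"
    by (rule born_amplitude[OF assms(1,2) q(1) assms(4) w(1)])
  \<comment> \<open>The profile of \<open>V2\<close> stays free because the converse direction
    replaces it by a better adapted one.\<close>
  have amp2: "AE t in lborel. 0 < t \<longrightarrow> exp (- 2 * t) * w2 (exp (- t)) = amp_real (log_potential q) 0 t"
    if "radial_profile V2 q" for q
    by (rule born_amplitude[OF assms(1,3) that assms(5) w(2)])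
  have born_iff: "(AE x in lebesgue_on (outer_shell b). V1B x = V2B x) \<longleftrightarrow>
    (AE t in lborel. 0 < t \<and> t < T \<longrightarrow> amp_real (log_potential q1) 0 t = amp_real (log_potential q) 0 t)"
    if "radial_profile V2 q" for q
    unfolding AE_outer_shell_iff[OF w assms(6)] T_def[symmetric]
  proof (rule eventually_cong)
    show "AE t in lborel. (0 < t \<longrightarrow> exp (- 2 * t) * w1 (exp (- t)) = amp_real (log_potential q1) 0 t)
      \<and> (0 < t \<longrightarrow> exp (- 2 * t) * w2 (exp (- t)) = amp_real (log_potential q) 0 t)"
      using amp1 amp2[OF that] by (rule AE_conjI)
    fix t
    assume "(0 < t \<longrightarrow> exp (- 2 * t) * w1 (exp (- t)) = amp_real (log_potential q1) 0 t)
      \<and> (0 < t \<longrightarrow> exp (- 2 * t) * w2 (exp (- t)) = amp_real (log_potential q) 0 t)"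
    then show "(0 < t \<and> t < T \<longrightarrow> w1 (exp (- t)) = w2 (exp (- t))) \<longleftrightarrow>
      (0 < t \<and> t < T \<longrightarrow> amp_real (log_potential q1) 0 t = amp_real (log_potential q) 0 t)"
      by (cases "0 < t") (metis exp_not_eq_zero mult_cancel_left, simp)
  qed
  show ?thesis
  proof
    assume "AE x in lebesgue_on (outer_shell b). V1B x = V2B x"
    then have eq: "AE t in lborel. 0 < t \<and> t < T \<longrightarrow> amp_real (log_potential q1) 0 t = amp_real (log_potential q2) 0 t"
      using born_iff[OF q(2)] by simp
    obtain m1 where m1: "\<And>c. 1 \<le> c \<Longrightarrow> 4 * m1 \<le> c \<Longrightarrow> exp_bounded (log_potential q1) m1 c"
      using potential_exp_bounded[OF assms(2) q(1)] by blast
    obtain m2 where m2: "\<And>c. 1 \<le> c \<Longrightarrow> 4 * m2 \<le> c \<Longrightarrow> exp_bounded (log_potential q2) m2 c"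
      using potential_exp_bounded[OF assms(3) q(2)] by blast
    \<comment> \<open>The comparison needs one bound and one Laplace exponent for both potentials;
      \<open>exp_bounded\<close> survives enlarging the bound as long as 4 M <= c.\<close>
    define M where "M = max m1 m2"
    define c where "c = max 1 (4 * M)"
    have up: "exp_bounded Q M c" if "exp_bounded Q m c" "m \<le> M" for Q m
      using that unfolding exp_bounded_def c_def by (auto intro: order_trans ennreal_leI)
    have "exp_bounded (log_potential q1) M c" by (rule up[OF m1]) (simp_all add: c_def M_def)
    moreover have "exp_bounded (log_potential q2) M c" by (rule up[OF m2]) (simp_all add: c_def M_def)
    ultimately have "AE x in lborel. 0 < x \<and> x < T \<longrightarrow> log_potential q1 x = log_potential q2 x"
      using eq by (rule amp_determines_potential)
    then
    have "AE t in lborel. 0 < t \<and> t < T \<longrightarrow> q1 (exp (- t)) = q2 (exp (- t))"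
      by eventually_elim (simp add: log_potential_def)
    then show "AE x in lebesgue_on (outer_shell b). V1 x = V2 x"
      unfolding AE_outer_shell_iff[OF q assms(6)] T_def .
  next
    assume V: "AE x in lebesgue_on (outer_shell b). V1 x = V2 x"
    \<comment> \<open>A profile of \<open>V2\<close> that agrees with \<open>q1\<close> everywhere on \<open>(b,1)\<close>, not just almost everywhere, makes the amplitudes equal pointwise.\<close>
    define q where "q r = (if r \<in> {b<..<1} then q1 r else q2 r)" for r
    have [measurable]: "q1 \<in> borel_measurable borel" "q2 \<in> borel_measurable borel"
      using q by (simp_all add: radial_profile_def)
    have "outer_shell b = (ball 0 1 - cball 0 b :: 'a set)" by (auto simp: outer_shell_def)
    then have "(outer_shell b :: 'a set) \<in> sets lebesgue" by simp
    with V have V': "AE x in lebesgue. x \<in> outer_shell b \<longrightarrow> V1 x = V2 x"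
      by (subst (asm) AE_restrict_space_iff) auto
    have ball: "AE x in lebesgue. x \<in> ball 0 1 \<longrightarrow> Vj x = qj (norm x)" if "radial_profile Vj qj" for Vj :: "'a \<Rightarrow> real" and qj
      using that by (subst AE_restrict_space_iff[symmetric]) (auto simp: radial_profile_def)
    have "AE x in lebesgue. x \<in> ball 0 1 \<longrightarrow> V2 x = q (norm x)"
      using V' ball[OF q(1)] ball[OF q(2)]
      by eventually_elim (auto simp: q_def outer_shell_def)
    then have "AE x in lebesgue_on (ball 0 1). V2 x = q (norm x)"
      by (subst AE_restrict_space_iff) auto
    then have prof: "radial_profile V2 q"
      unfolding radial_profile_def q_def by simp
    \<comment> \<open>Causality refers to the whole half-line below T, including t <= 0, where both
      potentials are 0 by convention.\<close>
    have "log_potential q1 t = log_potential q t" if "t < T" for t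
    proof (cases "0 < t")
      case True
      have "exp (ln b) < exp (- t)" using that by (simp add: T_def del: exp_ln)
      then have "b < exp (- t)" using assms(6) by simp
      then show ?thesis using True by (simp add: log_potential_def q_def)
    qed (simp add: log_potential_def)
    then have "amp_real (log_potential q1) 0 t = amp_real (log_potential q) 0 t" if "t < T" for t
      using amp_local[of T "log_potential q1" "log_potential q" t _ 0] that by (simp add: amp_real_def)
    then show "AE x in lebesgue_on (outer_shell b). V1B x = V2B x"
      unfolding born_iff[OF prof] by simp
  qed
qed

end
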